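(* There is a universal constant $C>0$ with the following property. Given two vector fields $S,T\in W^{1,1}(\mathbb{R}^2,\mathbb{R}^2)$, define $$S^P:=(S^x-|S^y|)^+,\quad S^N:=(S^x-|S^y|)^-,\quad T^P:=(T^y-|T^x|)^+,\quad T^N:=(T^y-|T^x|)^-.$$ Let $\chi:\mathbb{R}^2\to[0,1]$ be a Borel function supported in a bounded set. Then $$\int_{\mathbb{R}^2}\chi\min\{S^P,T^P\}\le C\|\chi\|_{L^2}\Big[\int_{\mathbb{R}^2}(|S|+|\operatorname{div}S|)\Big]^{1/2}\Big[\int_{\mathbb{R}^2}(|T|+|\operatorname{div}T|)\Big]^{1/2}+C\int_{\mathbb{R}^2}(|\operatorname{div}S|+|\operatorname{div}T|)+\int_{\mathbb{R}^2}(S^N+T^N).$$ The same holds if $S^x,S^y,T^x,T^y,\operatorname{div}S,\operatorname{div}T$ are just real-valued measures on the plane with finite total variation.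
   Context: Components are written $S=(S^x,S^y)$, $T=(T^x,T^y)$; $a^+=\max\{a,0\}$, $a^-=\max\{-a,0\}$; $\|\chi\|_{L^2}$ is with respect to Lebesgue measure. In the case of measures, $\operatorname{div}$ is the distributional divergence, $\int_{\mathbb{R}^2}|S|$ means the total variation $|S|(\mathbb{R}^2)$ (and similarly for the other terms), and $S^P,S^N,T^P,T^N$ are the nonnegative measures defined by the same formulas: writing $S=\sigma|S|$ with $|\sigma|=1$ (polar decomposition), $S^P=(\sigma^x-|\sigma^y|)^+|S|$ and $S^N=(\sigma^x-|\sigma^y|)^-|S|$, and similarly for $T$ with $x,y$ interchanged. For real-valued measures $\mu,\nu$, $\min\{\mu,\nu\}:=(\mu+\nu-|\mu-\nu|)/2$. *)

theory Defs
  imports "HOL-Analysis.Analysis"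
begin

section \<open>Test functions\<close>

primrec Ck :: "nat \<Rightarrow> ('a::real_normed_vector \<Rightarrow> 'b::real_normed_vector) \<Rightarrow> bool" where
  "Ck 0 f \<longleftrightarrow> continuous_on UNIV f"
| "Ck (Suc k) f \<longleftrightarrow>
     (\<forall>x. f differentiable (at x)) \<and> (\<forall>v. Ck k (\<lambda>x. frechet_derivative f (at x) v))"

definition test_function :: "('a::real_normed_vector \<Rightarrow> real) \<Rightarrow> bool" where
  "test_function \<phi> \<longleftrightarrow> (\<forall>k. Ck k \<phi>) \<and> compact (closure {x. \<phi> x \<noteq> 0})"

definition partial_x :: "(real \<times> real \<Rightarrow> real) \<Rightarrow> real \<times> real \<Rightarrow> real" where
  "partial_x \<phi> z = frechet_derivative \<phi> (at z) (1, 0)"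

definition partial_y :: "(real \<times> real \<Rightarrow> real) \<Rightarrow> real \<times> real \<Rightarrow> real" where
  "partial_y \<phi> z = frechet_derivative \<phi> (at z) (0, 1)"

definition grad :: "(real \<times> real \<Rightarrow> real) \<Rightarrow> real \<times> real \<Rightarrow> real \<times> real" where
  "grad \<phi> z = (partial_x \<phi> z, partial_y \<phi> z)"


section \<open>Sobolev vector fields on the plane\<close>

text \<open>Elements of \<open>L\<^sup>1\<close> and \<open>W\<^sup>1\<^sup>,\<^sup>1\<close> are represented by Lebesgue measurable functions. The weak
  derivatives below are required to be integrable; they are unique up to null sets.\<close>

definition has_weak_partial_x :: "(real \<times> real \<Rightarrow> real) \<Rightarrow> (real \<times> real \<Rightarrow> real) \<Rightarrow> bool" where
  "has_weak_partial_x f g \<longleftrightarrow> integrable lebesgue g \<and>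
     (\<forall>\<phi>. test_function \<phi> \<longrightarrow>
        (LINT z|lebesgue. f z * partial_x \<phi> z) = - (LINT z|lebesgue. g z * \<phi> z))"

definition has_weak_partial_y :: "(real \<times> real \<Rightarrow> real) \<Rightarrow> (real \<times> real \<Rightarrow> real) \<Rightarrow> bool" where
  "has_weak_partial_y f g \<longleftrightarrow> integrable lebesgue g \<and>
     (\<forall>\<phi>. test_function \<phi> \<longrightarrow>
        (LINT z|lebesgue. f z * partial_y \<phi> z) = - (LINT z|lebesgue. g z * \<phi> z))"

definition W11 :: "(real \<times> real \<Rightarrow> real) \<Rightarrow> bool" where
  "W11 f \<longleftrightarrow> integrable lebesgue f \<and> (\<exists>g. has_weak_partial_x f g) \<and> (\<exists>g. has_weak_partial_y f g)"

definition W11_field :: "(real \<times> real \<Rightarrow> real \<times> real) \<Rightarrow> bool" where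
  "W11_field S \<longleftrightarrow> W11 (\<lambda>z. fst (S z)) \<and> W11 (\<lambda>z. snd (S z))"

definition weak_partial_x :: "(real \<times> real \<Rightarrow> real) \<Rightarrow> real \<times> real \<Rightarrow> real" where
  "weak_partial_x f = (SOME g. has_weak_partial_x f g)"

definition weak_partial_y :: "(real \<times> real \<Rightarrow> real) \<Rightarrow> real \<times> real \<Rightarrow> real" where
  "weak_partial_y f = (SOME g. has_weak_partial_y f g)"

definition weak_div :: "(real \<times> real \<Rightarrow> real \<times> real) \<Rightarrow> real \<times> real \<Rightarrow> real" where
  "weak_div S z = weak_partial_x (\<lambda>w. fst (S w)) z + weak_partial_y (\<lambda>w. snd (S w)) z"

definition L2norm :: "(real \<times> real \<Rightarrow> real) \<Rightarrow> real" where
  "L2norm f = sqrt (LINT z|lebesgue. (f z)\<^sup>2)"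


section \<open>Signed and vector-valued Borel measures\<close>

text \<open>A real- or vector-valued measure is a set function of which only the values on Borel sets
  matter.\<close>

definition variation ::
    "('a::topological_space set \<Rightarrow> 'b::real_normed_vector) \<Rightarrow> 'a set \<Rightarrow> ennreal" where
  "variation \<mu> E =
     (SUP A \<in> {A :: nat \<Rightarrow> 'a set. range A \<subseteq> sets borel \<and> disjoint_family A \<and> (\<Union>i. A i) = E}.
        \<Sum>i. ennreal (norm (\<mu> (A i))))"

definition finite_vector_measure ::
    "('a::topological_space set \<Rightarrow> 'b::real_normed_vector) \<Rightarrow> bool" where
  "finite_vector_measure \<mu> \<longleftrightarrow>
     (\<forall>A :: nat \<Rightarrow> 'a set. range A \<subseteq> sets borel \<longrightarrow> disjoint_family A \<longrightarrow>
        (\<lambda>i. \<mu> (A i)) sums \<mu> (\<Union>i. A i)) \<and>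
     variation \<mu> UNIV < \<infinity>"

text \<open>The positive measure \<open>|\<mu>|\<close>.\<close>

definition variation_measure ::
    "('a::topological_space set \<Rightarrow> 'b::real_normed_vector) \<Rightarrow> 'a measure" where
  "variation_measure \<mu> = measure_of UNIV (sets borel) (variation \<mu>)"

definition total_variation ::
    "('a::topological_space set \<Rightarrow> 'b::real_normed_vector) \<Rightarrow> real" where
  "total_variation \<mu> = measure (variation_measure \<mu>) UNIV"

definition is_polar ::
    "('a::topological_space set \<Rightarrow> 'b::euclidean_space) \<Rightarrow> ('a \<Rightarrow> 'b) \<Rightarrow> bool" where
  "is_polar \<mu> \<sigma> \<longleftrightarrow> \<sigma> \<in> borel_measurable borel \<and> (\<forall>z. norm (\<sigma> z) = 1) \<and>
     (\<forall>A\<in>sets borel. \<mu> A = (LINT z:A|variation_measure \<mu>. \<sigma> z))"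

text \<open>The \<open>\<sigma>\<close> with \<open>\<mu> = \<sigma>|\<mu>|\<close>; for a measure of finite total variation it exists and is
  unique up to \<open>|\<mu>|\<close>-null sets.\<close>

definition polar ::
    "('a::topological_space set \<Rightarrow> 'b::euclidean_space) \<Rightarrow> 'a \<Rightarrow> 'b" where
  "polar \<mu> = (SOME \<sigma>. is_polar \<mu> \<sigma>)"

text \<open>The integral \<open>\<integral> f \<cdot> d\<mu> = \<integral> f \<cdot> \<sigma> d|\<mu>|\<close>; the inner product is multiplication for real-valued
  \<open>\<mu>\<close>.\<close>

definition vint ::
    "('a::topological_space set \<Rightarrow> 'b::euclidean_space) \<Rightarrow> ('a \<Rightarrow> 'b) \<Rightarrow> real" where
  "vint \<mu> f = (LINT z|variation_measure \<mu>. f z \<bullet> polar \<mu> z)"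

text \<open>The real-valued measure \<open>p(\<sigma>)|\<mu>|\<close>.\<close>

definition polar_image ::
    "('b::euclidean_space \<Rightarrow> real) \<Rightarrow> ('a::topological_space set \<Rightarrow> 'b) \<Rightarrow> 'a set \<Rightarrow> real" where
  "polar_image p \<mu> A = (LINT z:A|variation_measure \<mu>. p (polar \<mu> z))"

definition min_measure ::
    "('a::topological_space set \<Rightarrow> real) \<Rightarrow> ('a set \<Rightarrow> real) \<Rightarrow> 'a set \<Rightarrow> real" where
  "min_measure \<mu> \<nu> A =
     (\<mu> A + \<nu> A - measure (variation_measure (\<lambda>B. \<mu> B - \<nu> B)) A) / 2"

definition has_measure_div ::
    "((real \<times> real) set \<Rightarrow> real \<times> real) \<Rightarrow> ((real \<times> real) set \<Rightarrow> real) \<Rightarrow> bool" where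
  "has_measure_div S D \<longleftrightarrow> (\<forall>\<phi>. test_function \<phi> \<longrightarrow> vint S (grad \<phi>) = - vint D \<phi>)"


section \<open>Positive and negative parts with respect to the diagonal cones\<close>

text \<open>Applied pointwise to a vector field, or through \<^const>\<open>polar_image\<close> to a vector-valued
  measure, \<open>xP\<close> and \<open>xN\<close> give \<open>S\<^sup>P\<close> and \<open>S\<^sup>N\<close>, and \<open>yP\<close> and \<open>yN\<close> give \<open>T\<^sup>P\<close> and \<open>T\<^sup>N\<close>.\<close>

definition xP :: "real \<times> real \<Rightarrow> real" where
  "xP v = max (fst v - \<bar>snd v\<bar>) 0"

definition xN :: "real \<times> real \<Rightarrow> real" where
  "xN v = max (- (fst v - \<bar>snd v\<bar>)) 0"

definition yP :: "real \<times> real \<Rightarrow> real" where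
  "yP v = max (snd v - \<bar>fst v\<bar>) 0"

definition yN :: "real \<times> real \<Rightarrow> real" where
  "yN v = max (- (snd v - \<bar>fst v\<bar>)) 0"

end

theory Submission
  imports Defs
begin

text \<open>If \<open>\<bar>\<partial>\<^sub>y g\<bar> \<le> \<partial>\<^sub>x g \<le> 1\<close> then pointwise \<open>\<partial>\<^sub>x g S\<^sup>P - S\<^sup>N \<le> S \<bullet> \<nabla>g\<close>, so a smooth \<open>g\<close> with
  \<open>0 \<le> g \<le> M\<close> gives \<open>\<integral> \<partial>\<^sub>x g S\<^sup>P \<le> \<integral> S\<^sup>N + M \<integral> \<bar>div S\<bar>\<close>; symmetrically for \<open>T\<close> and a function \<open>k\<close> with
  \<open>0 \<le> k \<le> N\<close> that increases in the \<open>y\<close>-direction. It therefore suffices to find \<open>g\<close> and \<open>k\<close> with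
  \<open>\<partial>\<^sub>x g + \<partial>\<^sub>y k \<ge> \<chi> - \<epsilon>\<close> and \<open>M N\<close> bounded by a multiple of \<open>\<parallel>\<chi>\<parallel>\<^sup>2\<close>, and to balance \<open>M\<close> against \<open>N\<close>.

  In the coordinates \<open>x + y\<close> and \<open>x - y\<close> the two cones become quadrants. On a fine lattice, \<open>\<chi>\<close> splits in
  the manner of Erdos-Szekeres into a part all of whose chains are light and a part all of whose
  antichains are light; their last-passage potentials, mollified at the scale of the lattice, are
  \<open>g\<close> and \<open>k\<close>.\<close>

section \<open>Weighted chains in the planar lattice\<close>

text \<open>The cone condition on the gradient of \<open>g\<close> says that \<open>g\<close>
  increases in both diagonal coordinates, which is why weights of heaviest chains can serve as
  potentials; the bound of the derivative by 1 keeps the coefficient of \<open>S\<^sup>N\<close>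
  equal to 1. Nothing is lost as the mesh \<open>h\<close> shrinks: the potentials are lattice sums
  rescaled by \<open>h\<close>, so their heights multiply to a constant times
  \<open>h\<^sup>2\<close> times the sum of the squared weights, a quantity controlled by the
  integral of \<open>\<chi>\<^sup>2\<close>. Two obstacles shape the rest. A nonzero
  \<open>g\<close> of this kind has no compact support, so the divergence identity must be extended
  from test functions to bounded smooth functions with bounded gradient. And the minimum of
  \<open>S\<^sup>P\<close> and \<open>T\<^sup>P\<close> may be singular to Lebesgue measure while
  \<open>\<chi>\<close> is only Borel, so \<open>\<chi>\<close> is replaced by a continuous function
  controlled for both measures at once. The constant 48 is 16 + 32, the contributions of the two
  fluxes after balancing.\<close>

text \<open>The splitting is read off a near-minimiser \<open>v\<close> of \<open>(\<Sum>p\<in>F. (w p - v p)\<^sup>2) / 2 + L * m v\<close>, where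
  \<open>m v\<close> is the largest weight of an antichain: raising \<open>v\<close> by \<open>t\<close> on a chain raises \<open>m v\<close> by at most \<open>t\<close>, so
  a heavy chain of \<open>w - v\<close> would decrease the functional.\<close>

lemma chain_antichain_split:
  fixes w :: "'a \<Rightarrow> real"
  assumes F: "finite F" and w: "\<And>p. p \<in> F \<Longrightarrow> 0 \<le> w p" and L: "L > 0" and q: "q > 0"
    and wq: "(\<Sum>p\<in>F. (w p)\<^sup>2) \<le> q" and Q0: "Q {}"
    and meet: "\<And>C D x y. P C \<Longrightarrow> Q D \<Longrightarrow> x \<in> C \<inter> D \<Longrightarrow> y \<in> C \<inter> D \<Longrightarrow> x = y"
  shows "\<exists>w'. (\<forall>p\<in>F. 0 \<le> w' p \<and> w' p \<le> w p) \<and>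
    (\<forall>C\<subseteq>F. P C \<longrightarrow> (\<Sum>p\<in>C. w p - w' p) \<le> 2 * L) \<and>
    (\<forall>D\<subseteq>F. Q D \<longrightarrow> (\<Sum>p\<in>D. w' p) \<le> q / L)"
proof -
  define m where "m v = Max ((\<lambda>D. \<Sum>p\<in>D. v p) ` {D. D \<subseteq> F \<and> Q D})" for v :: "'a \<Rightarrow> real"
  have fin: "finite {D. D \<subseteq> F \<and> Q D}" using F by simp
  have m_ge: "(\<Sum>p\<in>D. v p) \<le> m v" if "D \<subseteq> F" "Q D" for D v
    unfolding m_def using fin that by (intro Max_ge) auto
  have m_le: "m v \<le> c" if "\<And>D. D \<subseteq> F \<Longrightarrow> Q D \<Longrightarrow> (\<Sum>p\<in>D. v p) \<le> c" for c v
    unfolding m_def using fin that Q0 by (subst Max_le_iff) auto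
  have m_nonneg: "0 \<le> m v" for v using m_ge[of "{}" v] Q0 by simp
  define E where "E v = (\<Sum>p\<in>F. (w p - v p)\<^sup>2) / 2 + L * m v" for v
  define X where "X = {v. \<forall>p\<in>F. 0 \<le> v p \<and> v p \<le> w p}"
  have E_nonneg: "0 \<le> E v" for v
    unfolding E_def using m_nonneg L by (auto intro!: add_nonneg_nonneg sum_nonneg)
  have bdd: "bdd_below (E ` X)" using E_nonneg by (intro bdd_belowI[of _ 0]) auto
  have zX: "(\<lambda>_. 0) \<in> X" unfolding X_def using w by auto
  have "m (\<lambda>_. 0) \<le> 0" by (rule m_le) simp
  then have E0: "E (\<lambda>_. 0) \<le> q / 2"
    using wq L mult_nonneg_nonpos[of L "m (\<lambda>_. 0)"] unfolding E_def by simp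
  \<comment> \<open>\<open>t\<close> is the size of the perturbation used below. The first bound
    makes the second-order terms \<open>t + t * card C / 2\<close> smaller than \<open>L\<close>;
    the second keeps the slack of the near-minimiser at most \<open>q / 2\<close>. A slack of
    \<open>t\<^sup>2\<close> is of second order in \<open>t\<close>, so an exact minimiser is
    dispensable.\<close>
  define t where "t = min (L / (real (card F) + 2)) (sqrt (q / 2))"
  have t: "t > 0" unfolding t_def using L q by auto
  have tL: "t * (real (card F) + 2) \<le> L"
  proof -
    have "t * (real (card F) + 2) \<le> L / (real (card F) + 2) * (real (card F) + 2)"
      unfolding t_def by (intro mult_right_mono) auto
    then show ?thesis by simp
  qed
  have "t \<le> sqrt (q / 2)" unfolding t_def by simp
  then have "t\<^sup>2 \<le> (sqrt (q / 2))\<^sup>2" using t by (intro power_mono) auto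
  then have tq: "t\<^sup>2 \<le> q / 2" using q by simp
  have "\<exists>e\<in>E ` X. e < Inf (E ` X) + t\<^sup>2"
    using zX t by (intro cInf_lessD) (auto intro: less_add_same_cancel1[THEN iffD2])
  then obtain v where v: "v \<in> X" "E v < Inf (E ` X) + t\<^sup>2" by auto
  have near: "E v < E v' + t\<^sup>2" if "v' \<in> X" for v'
    using cInf_lower[OF _ bdd, of "E v'"] that v(2) by auto
  have v01: "0 \<le> v p" "v p \<le> w p" if "p \<in> F" for p using v that unfolding X_def by auto
  \<comment> \<open>Comparison with the competitor 0, whose energy is at most \<open>q / 2\<close>;
    the slack contributes at most another \<open>q / 2\<close>.\<close>
  have "L * m v \<le> E v" unfolding E_def by (simp add: sum_nonneg)
  also have "\<dots> \<le> q" using near[OF zX] E0 tq by linarith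
  finally have mv: "m v \<le> q / L" using L by (simp add: field_simps)
  have chain: "(\<Sum>p\<in>C. w p - v p) \<le> 2 * L" if C: "C \<subseteq> F" "P C" for C
  proof -
    have finC: "finite C" using C F finite_subset by auto
    define v' where "v' p = (if p \<in> C then min (w p) (v p + t) else v p)" for p
    have v'X: "v' \<in> X" unfolding X_def v'_def using v01 t by fastforce
    have "m v' \<le> m v + t"
    proof (rule m_le)
      fix D assume D: "D \<subseteq> F" "Q D"
      have finD: "finite D" using D F finite_subset by auto
      have "(\<Sum>p\<in>D. v' p) \<le> (\<Sum>p\<in>D. v p + (if p \<in> C \<inter> D then t else 0))"
        unfolding v'_def by (intro sum_mono) auto
      also have "\<dots> = (\<Sum>p\<in>D. v p) + (\<Sum>p\<in>D. if p \<in> C \<inter> D then t else 0)"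
        by (simp only: sum.distrib)
      also have "(\<Sum>p\<in>D. if p \<in> C \<inter> D then t else 0) = t * real (card (C \<inter> D))"
        using finD by (simp add: sum.If_cases Int_commute Int_assoc)
      also have "\<dots> \<le> t"
      proof -
        have "card (C \<inter> D) \<le> 1"
          using meet[OF C(2) D(2)] finC by (subst card_le_Suc0_iff_eq[unfolded One_nat_def[symmetric]]) auto
        then show ?thesis using t mult_left_le[of "real (card (C \<inter> D))" t] by auto
      qed
      finally show "(\<Sum>p\<in>D. v' p) \<le> m v + t" using m_ge[OF D, of v] by linarith
    qed
    then have mm: "L * m v' \<le> L * m v + L * t" using L by (simp flip: distrib_left)
    \<comment> \<open>If the cap at \<open>w p\<close> is active, the left side is 0 and the right
      side is the perfect square of \<open>w p - v p - t\<close>; in all other cases the two sides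
      agree.\<close>
    have sq: "(w p - v' p)\<^sup>2 \<le> (w p - v p)\<^sup>2 + (if p \<in> C then t\<^sup>2 - 2 * t * (w p - v p) else 0)"
      if "p \<in> F" for p
    proof (cases "p \<in> C \<and> w p - v p < t")
      case True
      then have "(w p - v' p)\<^sup>2 = 0" unfolding v'_def by simp
      also have "0 \<le> (w p - v p - t)\<^sup>2" by simp
      finally show ?thesis using True by (simp add: power2_eq_square algebra_simps)
    next
      case False
      then show ?thesis unfolding v'_def by (auto simp: power2_eq_square algebra_simps)
    qed
    define G where "G = (\<Sum>p\<in>C. w p - v p)"
    have CF: "F \<inter> C = C" using C by auto
    have "(\<Sum>p\<in>F. (w p - v' p)\<^sup>2)
        \<le> (\<Sum>p\<in>F. (w p - v p)\<^sup>2 + (if p \<in> C then t\<^sup>2 - 2 * t * (w p - v p) else 0))"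
      by (intro sum_mono sq)
    also have "\<dots> = (\<Sum>p\<in>F. (w p - v p)\<^sup>2) + (\<Sum>p\<in>C. t\<^sup>2 - 2 * t * (w p - v p))"
      using F CF by (simp add: sum.distrib sum.If_cases)
    also have "(\<Sum>p\<in>C. t\<^sup>2 - 2 * t * (w p - v p)) = t\<^sup>2 * card C - 2 * t * G"
      unfolding G_def by (subst sum_subtractf) (simp only: sum_distrib_left sum_constant mult.commute)
    finally have "(\<Sum>p\<in>F. (w p - v' p)\<^sup>2)
        \<le> (\<Sum>p\<in>F. (w p - v p)\<^sup>2) + (t\<^sup>2 * card C - 2 * t * G)" .
    \<comment> \<open>The first-order change of the energy is \<open>L * t - t * G\<close>.
      Near-minimality forbids it to be too negative, and division by \<open>t\<close> turns this
      into an upper bound for the chain weight \<open>G\<close>.\<close>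
    then have "E v' \<le> E v + (t\<^sup>2 * card C / 2 - t * G) + L * t"
      using mm unfolding E_def by linarith
    then have "t * G < t\<^sup>2 + t\<^sup>2 * card C / 2 + L * t"
      using near[OF v'X] by linarith
    also have "\<dots> = t * (t + t * card C / 2 + L)"
      by (simp add: power2_eq_square distrib_left)
    finally have "G < t + t * card C / 2 + L" using t by (simp only: mult_less_cancel_left_pos)
    moreover have "t * card C \<le> t * card F"
      using t card_mono[OF F C(1)] by simp
    moreover have "t * card F + 2 * t \<le> L" using tL by (simp add: algebra_simps)
    ultimately show ?thesis using t L unfolding G_def by linarith
  qed
  show ?thesis
    using v01 chain order_trans[OF m_ge mv] by (intro exI[of _ v] conjI ballI allI impI)
qed

text \<open>Both coordinates increase strictly. With weak inequalities a whole row would be a chain,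
  and the diagonal increments of the potential could not be bounded by a single weight.\<close>

definition ne_chain :: "(int \<times> int) set \<Rightarrow> bool" where
  "ne_chain C \<longleftrightarrow> (\<forall>p\<in>C. \<forall>q\<in>C. p \<noteq> q \<longrightarrow>
     fst p < fst q \<and> snd p < snd q \<or> fst q < fst p \<and> snd q < snd p)"

definition se_chain :: "(int \<times> int) set \<Rightarrow> bool" where
  "se_chain C \<longleftrightarrow> (\<forall>p\<in>C. \<forall>q\<in>C. p \<noteq> q \<longrightarrow>
     fst p < fst q \<and> snd q < snd p \<or> fst q < fst p \<and> snd p < snd q)"

text \<open>The last-passage potential: the point \<open>(i, j)\<close> is the lower left corner of the cell
  \<open>(i, j)\<close>. The upper bound on the diagonal increment holds because a chain meets the union of
  one row and one column in at most one cell.\<close>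

lemma ne_chain_potential:
  fixes w :: "int \<times> int \<Rightarrow> real"
  assumes F: "finite F" and w: "\<And>p. p \<in> F \<Longrightarrow> 0 \<le> w p" "\<And>p. p \<in> F \<Longrightarrow> w p \<le> 1"
    and w0: "\<And>p. p \<notin> F \<Longrightarrow> w p = 0"
    and K: "\<And>C. C \<subseteq> F \<Longrightarrow> ne_chain C \<Longrightarrow> (\<Sum>p\<in>C. w p) \<le> K"
  shows "\<exists>U :: int \<Rightarrow> int \<Rightarrow> real. (\<forall>i j. 0 \<le> U i j \<and> U i j \<le> K) \<and>
    (\<forall>i j i' j'. i \<le> i' \<longrightarrow> j \<le> j' \<longrightarrow> U i j \<le> U i' j') \<and>
    (\<forall>i j. w (i, j) \<le> U (i + 1) (j + 1) - U i j \<and> U (i + 1) (j + 1) - U i j \<le> 1)"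
proof -
  \<comment> \<open>The bounds are strict: the cell \<open>(i, j)\<close> is not counted at its own
    lower left corner, hence it can be appended to every chain counted there.\<close>
  define \<C> where "\<C> i j = {C. C \<subseteq> F \<inter> ({..<i} \<times> {..<j}) \<and> ne_chain C}" for i j
  define U where "U i j = Max ((\<lambda>C. \<Sum>p\<in>C. w p) ` \<C> i j)" for i j
  have ne0: "ne_chain {}" by (simp add: ne_chain_def)
  have fin: "finite (\<C> i j)" for i j
    by (rule finite_subset[of _ "Pow F"]) (auto simp: \<C>_def F)
  have U_ge: "(\<Sum>p\<in>C. w p) \<le> U i j" if "C \<in> \<C> i j" for C i j
    unfolding U_def using fin that by (intro Max_ge) auto
  have U_le: "U i j \<le> c" if "\<And>C. C \<in> \<C> i j \<Longrightarrow> (\<Sum>p\<in>C. w p) \<le> c" for c i j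
  proof -
    have "{} \<in> \<C> i j" using ne0 unfolding \<C>_def by simp
    then show ?thesis unfolding U_def using fin that by (subst Max_le_iff) auto
  qed
  have 1: "0 \<le> U i j" for i j using U_ge[of "{}" i j] ne0 unfolding \<C>_def by simp
  have 2: "U i j \<le> K" for i j using K by (intro U_le) (auto simp: \<C>_def)
  have 3: "U i j \<le> U i' j'" if "i \<le> i'" "j \<le> j'" for i j i' j'
    using that by (intro U_le U_ge) (force simp: \<C>_def)
  have 4: "w (i, j) \<le> U (i + 1) (j + 1) - U i j" for i j
  proof (cases "(i, j) \<in> F")
    case True
    have "U i j \<le> U (i + 1) (j + 1) - w (i, j)"
    proof (rule U_le)
      fix C assume C: "C \<in> \<C> i j"
      then have "finite C" "(i, j) \<notin> C" using F finite_subset by (auto simp: \<C>_def)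
      moreover have "insert (i, j) C \<in> \<C> (i + 1) (j + 1)"
        using C True unfolding \<C>_def ne_chain_def by fastforce
      ultimately show "(\<Sum>p\<in>C. w p) \<le> U (i + 1) (j + 1) - w (i, j)"
        using U_ge[of "insert (i, j) C" "i + 1" "j + 1"] by simp
    qed
    then show ?thesis by simp
  next
    case False
    then show ?thesis using w0 3[of i "i + 1" j "j + 1"] by simp
  qed
  have 5: "U (i + 1) (j + 1) \<le> U i j + 1" for i j
  proof (rule U_le)
    fix C assume C: "C \<in> \<C> (i + 1) (j + 1)"
    then have CF: "finite C" "C \<subseteq> F" using F finite_subset by (auto simp: \<C>_def)
    define D where "D = C \<inter> {p. fst p = i \<or> snd p = j}"
    have "p = q" if "p \<in> D" "q \<in> D" for p q
    proof (rule ccontr)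
      assume "p \<noteq> q"
      with C that have "fst p < fst q \<and> snd p < snd q \<or> fst q < fst p \<and> snd q < snd p"
        unfolding D_def \<C>_def ne_chain_def by blast
      moreover have "fst p \<le> i" "snd p \<le> j" "fst q \<le> i" "snd q \<le> j"
        using C that unfolding D_def \<C>_def by auto
      ultimately show False using that unfolding D_def by auto
    qed
    then have "card D \<le> 1"
      using CF by (subst card_le_Suc0_iff_eq[unfolded One_nat_def[symmetric]]) (auto simp: D_def)
    moreover have "(\<Sum>p\<in>D. w p) \<le> (\<Sum>p\<in>D. 1)"
      using w CF by (intro sum_mono) (auto simp: D_def)
    ultimately have D1: "(\<Sum>p\<in>D. w p) \<le> 1" by simp
    have "C - D \<in> \<C> i j"
      using C unfolding D_def \<C>_def ne_chain_def by fastforce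
    then have "(\<Sum>p\<in>C - D. w p) \<le> U i j" by (rule U_ge)
    moreover have "(\<Sum>p\<in>C. w p) = (\<Sum>p\<in>C - D. w p) + (\<Sum>p\<in>D. w p)"
      using CF by (intro sum.subset_diff) (auto simp: D_def)
    ultimately show "(\<Sum>p\<in>C. w p) \<le> U i j + 1" using D1 by simp
  qed
  have 6: "U (i + 1) (j + 1) - U i j \<le> 1" for i j using 5[of i j] by linarith
  show ?thesis
    by (intro exI[of _ U] conjI allI impI 1 2 3 4 6)
qed

text \<open>The reflection of the second index exchanges the two kinds of chains. It acts on cells,
  so the resulting potential at \<open>(i, j)\<close> collects chains of cells with first index
  below \<open>i\<close> and second index above \<open>j\<close>, and the increment that sees the
  cell \<open>(i, j)\<close> leads to \<open>(i + 1, j - 1)\<close>.\<close>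

lemma se_chain_potential:
  fixes w :: "int \<times> int \<Rightarrow> real"
  assumes F: "finite F" and w: "\<And>p. p \<in> F \<Longrightarrow> 0 \<le> w p" "\<And>p. p \<in> F \<Longrightarrow> w p \<le> 1"
    and w0: "\<And>p. p \<notin> F \<Longrightarrow> w p = 0"
    and K: "\<And>C. C \<subseteq> F \<Longrightarrow> se_chain C \<Longrightarrow> (\<Sum>p\<in>C. w p) \<le> K"
  shows "\<exists>V :: int \<Rightarrow> int \<Rightarrow> real. (\<forall>i j. 0 \<le> V i j \<and> V i j \<le> K) \<and>
    (\<forall>i j i' j'. i \<le> i' \<longrightarrow> j' \<le> j \<longrightarrow> V i j \<le> V i' j') \<and>
    (\<forall>i j. w (i, j) \<le> V (i + 1) (j - 1) - V i j \<and> V (i + 1) (j - 1) - V i j \<le> 1)"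
proof -
  define r :: "int \<times> int \<Rightarrow> int \<times> int" where "r p = (fst p, - snd p)" for p
  have rr [simp]: "r (r p) = p" for p by (simp add: r_def)
  have inj: "inj_on r A" for A by (rule inj_on_inverseI[of _ r]) simp
  have in_r: "r p \<in> F \<longleftrightarrow> p \<in> r ` F" for p by (metis image_iff rr)
  have "\<exists>U :: int \<Rightarrow> int \<Rightarrow> real. (\<forall>i j. 0 \<le> U i j \<and> U i j \<le> K) \<and>
    (\<forall>i j i' j'. i \<le> i' \<longrightarrow> j \<le> j' \<longrightarrow> U i j \<le> U i' j') \<and>
    (\<forall>i j. (w \<circ> r) (i, j) \<le> U (i + 1) (j + 1) - U i j \<and> U (i + 1) (j + 1) - U i j \<le> 1)"
  proof (rule ne_chain_potential[of "r ` F"])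
    fix C assume C: "C \<subseteq> r ` F" "ne_chain C"
    have "se_chain (r ` C)"
      unfolding se_chain_def
    proof (intro ballI impI)
      fix p q assume "p \<in> r ` C" "q \<in> r ` C" "p \<noteq> q"
      then obtain a b where "a \<in> C" "b \<in> C" "a \<noteq> b" "p = r a" "q = r b" by blast
      then show "fst p < fst q \<and> snd q < snd p \<or> fst q < fst p \<and> snd p < snd q"
        using C(2) unfolding ne_chain_def r_def by (auto dest!: bspec)
    qed
    moreover have "r ` C \<subseteq> F" using C(1) by force
    ultimately show "(\<Sum>p\<in>C. (w \<circ> r) p) \<le> K" using K[of "r ` C"] by (simp add: sum.reindex inj)
  qed (use F w w0 in \<open>auto simp: in_r\<close>)
  then obtain U :: "int \<Rightarrow> int \<Rightarrow> real" where U: "\<And>i j. 0 \<le> U i j \<and> U i j \<le> K"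
    "\<And>i j i' j'. i \<le> i' \<Longrightarrow> j \<le> j' \<Longrightarrow> U i j \<le> U i' j'"
    "\<And>i j. w (i, - j) \<le> U (i + 1) (j + 1) - U i j \<and> U (i + 1) (j + 1) - U i j \<le> 1"
    unfolding o_def r_def fst_conv snd_conv by blast
  show ?thesis
  proof (intro exI[of _ "\<lambda>i j. U i (- j)"] conjI allI impI)
    fix i j
    show "w (i, j) \<le> U (i + 1) (- (j - 1)) - U i (- j)" "U (i + 1) (- (j - 1)) - U i (- j) \<le> 1"
      using U(3)[of i "- j"] by (simp_all add: add.commute)
  qed (use U(1,2) in auto)
qed

text \<open>A north-east chain and a south-east chain share at most one cell; this is what makes the
  two families of weighted chains dual to each other.\<close>

lemma lattice_potentials:
  fixes w :: "int \<times> int \<Rightarrow> real"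
  assumes F: "finite F" and w: "\<And>p. p \<in> F \<Longrightarrow> 0 \<le> w p" "\<And>p. p \<in> F \<Longrightarrow> w p \<le> 1"
    and w0: "\<And>p. p \<notin> F \<Longrightarrow> w p = 0"
    and L: "L > 0" and q: "q > 0" and wq: "(\<Sum>p\<in>F. (w p)\<^sup>2) \<le> q"
  shows "\<exists>U V :: int \<Rightarrow> int \<Rightarrow> real.
    (\<forall>i j. 0 \<le> U i j \<and> U i j \<le> 2 * L) \<and> (\<forall>i j. 0 \<le> V i j \<and> V i j \<le> q / L) \<and>
    (\<forall>i j i' j'. i \<le> i' \<longrightarrow> j \<le> j' \<longrightarrow> U i j \<le> U i' j') \<and>
    (\<forall>i j i' j'. i \<le> i' \<longrightarrow> j' \<le> j \<longrightarrow> V i j \<le> V i' j') \<and>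
    (\<forall>i j. U (i + 1) (j + 1) - U i j \<le> 1) \<and> (\<forall>i j. V (i + 1) (j - 1) - V i j \<le> 1) \<and>
    (\<forall>i j. w (i, j) \<le> (U (i + 1) (j + 1) - U i j) + (V (i + 1) (j - 1) - V i j))"
proof -
  have "\<exists>w'. (\<forall>p\<in>F. 0 \<le> w' p \<and> w' p \<le> w p) \<and>
    (\<forall>C\<subseteq>F. ne_chain C \<longrightarrow> (\<Sum>p\<in>C. w p - w' p) \<le> 2 * L) \<and>
    (\<forall>D\<subseteq>F. se_chain D \<longrightarrow> (\<Sum>p\<in>D. w' p) \<le> q / L)"
  proof (rule chain_antichain_split[OF F w(1) L q wq])
    show "se_chain {}" by (simp add: se_chain_def)
    show "x = y" if "ne_chain C" "se_chain D" "x \<in> C \<inter> D" "y \<in> C \<inter> D" for C D x y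
      using that unfolding se_chain_def ne_chain_def by (metis IntD1 IntD2 order_less_asym)
  qed
  then obtain w' where w'_all: "\<forall>p\<in>F. 0 \<le> w' p \<and> w' p \<le> w p"
    "\<forall>C\<subseteq>F. ne_chain C \<longrightarrow> (\<Sum>p\<in>C. w p - w' p) \<le> 2 * L"
    "\<forall>D\<subseteq>F. se_chain D \<longrightarrow> (\<Sum>p\<in>D. w' p) \<le> q / L"
    by blast
  then have w': "\<And>p. p \<in> F \<Longrightarrow> 0 \<le> w' p" "\<And>p. p \<in> F \<Longrightarrow> w' p \<le> w p"
    "\<And>C. C \<subseteq> F \<Longrightarrow> ne_chain C \<Longrightarrow> (\<Sum>p\<in>C. w p - w' p) \<le> 2 * L"
    "\<And>D. D \<subseteq> F \<Longrightarrow> se_chain D \<Longrightarrow> (\<Sum>p\<in>D. w' p) \<le> q / L"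
    by simp_all
  \<comment> \<open>The splitting controls \<open>w'\<close> on \<open>F\<close> only, whereas the
    potentials ask for weights that vanish elsewhere.\<close>
  define w2 where "w2 p = (if p \<in> F then w' p else 0)" for p
  define w1 where "w1 p = w p - w2 p" for p
  have s1: "(\<Sum>p\<in>C. w1 p) \<le> 2 * L" if "C \<subseteq> F" "ne_chain C" for C
  proof -
    have "(\<Sum>p\<in>C. w1 p) = (\<Sum>p\<in>C. w p - w' p)"
      using that(1) by (intro sum.cong) (auto simp: w1_def w2_def)
    then show ?thesis using w'(3)[OF that] by simp
  qed
  have s2: "(\<Sum>p\<in>C. w2 p) \<le> q / L" if "C \<subseteq> F" "se_chain C" for C
  proof -
    have "(\<Sum>p\<in>C. w2 p) = (\<Sum>p\<in>C. w' p)"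
      using that(1) by (intro sum.cong) (auto simp: w2_def)
    then show ?thesis using w'(4)[OF that] by simp
  qed
  have b: "0 \<le> w1 p" "w1 p \<le> 1" "0 \<le> w2 p" "w2 p \<le> 1" if "p \<in> F" for p
    using w'(1,2)[OF that] w[OF that] that by (auto simp: w1_def w2_def)
  have z: "w1 p = 0" "w2 p = 0" if "p \<notin> F" for p
    using w0[OF that] that by (auto simp: w1_def w2_def)
  obtain U :: "int \<Rightarrow> int \<Rightarrow> real" where U: "\<And>i j. 0 \<le> U i j \<and> U i j \<le> 2 * L"
    "\<And>i j i' j'. i \<le> i' \<Longrightarrow> j \<le> j' \<Longrightarrow> U i j \<le> U i' j'"
    "\<And>i j. w1 (i, j) \<le> U (i + 1) (j + 1) - U i j \<and> U (i + 1) (j + 1) - U i j \<le> 1"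
    using ne_chain_potential[of F w1 "2 * L", OF F b(1,2) z(1) s1] by blast
  obtain V :: "int \<Rightarrow> int \<Rightarrow> real" where V: "\<And>i j. 0 \<le> V i j \<and> V i j \<le> q / L"
    "\<And>i j i' j'. i \<le> i' \<Longrightarrow> j' \<le> j \<Longrightarrow> V i j \<le> V i' j'"
    "\<And>i j. w2 (i, j) \<le> V (i + 1) (j - 1) - V i j \<and> V (i + 1) (j - 1) - V i j \<le> 1"
    using se_chain_potential[of F w2 "q / L", OF F b(3,4) z(2) s2] by blast
  have "w (i, j) \<le> (U (i + 1) (j + 1) - U i j) + (V (i + 1) (j - 1) - V i j)" for i j
    using U(3)[of i j] V(3)[of i j] unfolding w1_def by linarith
  then show ?thesis using U V by (intro exI[of _ U] exI[of _ V]) blast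
qed

section \<open>Smooth functions and test functions\<close>

definition smooth :: "('a::real_normed_vector \<Rightarrow> 'b::real_normed_vector) \<Rightarrow> bool" where
  "smooth f \<longleftrightarrow> (\<forall>k. Ck k f)"

text \<open>By uniqueness of the derivative, any explicit family of derivatives may replace
  \<open>frechet_derivative\<close>. The inductions below run through this form, where a formula for
  the derivative can be supplied.\<close>

lemma Ck_Suc_iff:
  "Ck (Suc k) f \<longleftrightarrow> (\<exists>f'. (\<forall>x. (f has_derivative f' x) (at x)) \<and> (\<forall>v. Ck k (\<lambda>x. f' x v)))"
proof
  assume "Ck (Suc k) f"
  then show "\<exists>f'. (\<forall>x. (f has_derivative f' x) (at x)) \<and> (\<forall>v. Ck k (\<lambda>x. f' x v))"
    by (intro exI[of _ "\<lambda>x. frechet_derivative f (at x)"]) (auto simp: frechet_derivative_works)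
next
  assume "\<exists>f'. (\<forall>x. (f has_derivative f' x) (at x)) \<and> (\<forall>v. Ck k (\<lambda>x. f' x v))"
  then obtain f' where f': "\<And>x. (f has_derivative f' x) (at x)" "\<And>v. Ck k (\<lambda>x. f' x v)"
    by blast
  have "frechet_derivative f (at x) = f' x" for x
    using frechet_derivative_at[OF f'(1)[of x]] by simp
  moreover have "f differentiable (at x)" for x
    using f'(1)[of x] unfolding differentiable_def by blast
  ultimately show "Ck (Suc k) f" using f'(2) by simp
qed

lemma Ck_SucI:
  "(\<And>x. (f has_derivative f' x) (at x)) \<Longrightarrow> (\<And>v. Ck k (\<lambda>x. f' x v)) \<Longrightarrow> Ck (Suc k) f"
  unfolding Ck_Suc_iff by (intro exI[of _ f'] conjI allI)

declare Ck.simps(2) [simp del]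

lemma Ck_Suc_D: "Ck (Suc k) f \<Longrightarrow> Ck k f"
proof (induction k arbitrary: f)
  case 0
  then obtain f' where "\<And>x. (f has_derivative f' x) (at x)" unfolding Ck_Suc_iff by blast
  then have "isCont f x" for x using has_derivative_continuous by blast
  then show ?case by (simp add: continuous_at_imp_continuous_on)
next
  case (Suc k)
  then show ?case unfolding Ck_Suc_iff[of "Suc k"] Ck_Suc_iff[of k] by blast
qed

lemma Ck_const: "Ck k (\<lambda>_. c)"
proof (induction k arbitrary: c)
  case (Suc k)
  show ?case by (rule Ck_SucI[of _ "\<lambda>_ _. 0"]) (auto intro: Suc)
qed simp

lemma Ck_add: "Ck k f \<Longrightarrow> Ck k g \<Longrightarrow> Ck k (\<lambda>x. f x + g x)"
proof (induction k arbitrary: f g)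
  case 0
  then show ?case by (auto intro: continuous_on_add)
next
  case (Suc k)
  obtain f' where f: "\<And>x. (f has_derivative f' x) (at x)" "\<And>v. Ck k (\<lambda>x. f' x v)"
    using Suc.prems(1) unfolding Ck_Suc_iff by blast
  obtain g' where g: "\<And>x. (g has_derivative g' x) (at x)" "\<And>v. Ck k (\<lambda>x. g' x v)"
    using Suc.prems(2) unfolding Ck_Suc_iff by blast
  show ?case
    by (rule Ck_SucI[of _ "\<lambda>x v. f' x v + g' x v"])
       (auto intro!: has_derivative_add f(1) g(1) Suc.IH f(2) g(2))
qed

lemma Ck_mult:
  fixes f g :: "'a::real_normed_vector \<Rightarrow> 'b::real_normed_algebra"
  shows "Ck k f \<Longrightarrow> Ck k g \<Longrightarrow> Ck k (\<lambda>x. f x * g x)"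
proof (induction k arbitrary: f g)
  case 0
  then show ?case by (auto intro: continuous_on_mult)
next
  case (Suc k)
  obtain f' where f: "\<And>x. (f has_derivative f' x) (at x)" "\<And>v. Ck k (\<lambda>x. f' x v)"
    using Suc.prems(1) unfolding Ck_Suc_iff by blast
  obtain g' where g: "\<And>x. (g has_derivative g' x) (at x)" "\<And>v. Ck k (\<lambda>x. g' x v)"
    using Suc.prems(2) unfolding Ck_Suc_iff by blast
  show ?case
    by (rule Ck_SucI, rule has_derivative_mult[OF f(1) g(1)])
       (intro Ck_add Suc.IH f(2) g(2) Ck_Suc_D[OF Suc.prems(1)] Ck_Suc_D[OF Suc.prems(2)])
qed

lemma Ck_inverse:
  fixes f :: "'a::real_normed_vector \<Rightarrow> 'b::real_normed_field"
  assumes "\<And>x. f x \<noteq> 0"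
  shows "Ck k f \<Longrightarrow> Ck k (\<lambda>x. inverse (f x))"
proof (induction k)
  case 0
  then show ?case using assms by (auto intro: continuous_on_inverse)
next
  case (Suc k)
  obtain f' where f: "\<And>x. (f has_derivative f' x) (at x)" "\<And>v. Ck k (\<lambda>x. f' x v)"
    using Suc.prems(1) unfolding Ck_Suc_iff by blast
  have inv: "Ck k (\<lambda>x. inverse (f x))" using Suc Ck_Suc_D by blast
  have "((\<lambda>x. inverse (f x)) has_derivative (\<lambda>v. (- 1) * (inverse (f x) * f' x v * inverse (f x)))) (at x)" for x
    using Deriv.has_derivative_inverse[OF assms f(1), of x] by simp
  then show ?case
    by (rule Ck_SucI) (intro Ck_mult Ck_const inv f(2))
qed

text \<open>For an affine inner map the derivative of the composition is again a derivative of
  \<open>f\<close> composed with the same map, so the induction closes without a general chain rule.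
  Translations, scalings, projections and the coordinate swap are all of this kind.\<close>

lemma Ck_affine:
  assumes L: "bounded_linear L"
  shows "Ck k f \<Longrightarrow> Ck k (\<lambda>x. f (L x + c))"
proof (induction k arbitrary: f)
  case 0
  then have "continuous_on UNIV f" by simp
  then have "continuous_on UNIV (\<lambda>x. f (L x + c))"
    by (rule continuous_on_compose2)
       (auto intro!: continuous_on_add continuous_on_const
         bounded_linear.continuous_on[OF L continuous_on_id])
  then show ?case by simp
next
  case (Suc k)
  obtain f' where f: "\<And>x. (f has_derivative f' x) (at x)" "\<And>v. Ck k (\<lambda>x. f' x v)"
    using Suc.prems(1) unfolding Ck_Suc_iff by blast
  have "((\<lambda>x. f (L x + c)) has_derivative (\<lambda>v. f' (L x + c) (L v))) (at x)" for x
  proof (rule has_derivative_compose[OF _ f(1)])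
    have "(L has_derivative L) (at x)" by (rule bounded_linear_imp_has_derivative[OF L])
    then show "((\<lambda>x. L x + c) has_derivative L) (at x)"
      using has_derivative_add[OF _ has_derivative_const] by fastforce
  qed
  then show ?case by (rule Ck_SucI) (rule Suc.IH f(2))+
qed

lemma smooth_const: "smooth (\<lambda>_. c)"
  and smooth_add: "smooth f \<Longrightarrow> smooth g \<Longrightarrow> smooth (\<lambda>x. f x + g x)"
  and smooth_affine: "bounded_linear L \<Longrightarrow> smooth h \<Longrightarrow> smooth (\<lambda>x. h (L x + d))"
  unfolding smooth_def by (blast intro: Ck_const Ck_add Ck_affine)+

lemma smooth_mult:
  fixes f g :: "'a::real_normed_vector \<Rightarrow> 'b::real_normed_algebra"
  shows "smooth f \<Longrightarrow> smooth g \<Longrightarrow> smooth (\<lambda>x. f x * g x)"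
  unfolding smooth_def by (blast intro: Ck_mult)

lemma smooth_inverse:
  fixes f :: "'a::real_normed_vector \<Rightarrow> 'b::real_normed_field"
  shows "(\<And>x. f x \<noteq> 0) \<Longrightarrow> smooth f \<Longrightarrow> smooth (\<lambda>x. inverse (f x))"
  unfolding smooth_def by (blast intro: Ck_inverse)

lemma smooth_diff:
  fixes f g :: "'a::real_normed_vector \<Rightarrow> 'b::real_normed_algebra_1"
  assumes "smooth f" "smooth g"
  shows "smooth (\<lambda>x. f x - g x)"
  using smooth_add[OF assms(1) smooth_mult[OF smooth_const[of "- 1"] assms(2)]] by simp

text \<open>A family that contains all directional derivatives of its members reaches every order
  \<open>k\<close> by one induction over the whole family. It is applied to all
  \<open>flat_exp p\<close>, and to all convolutions of a fixed function with test
  functions.\<close>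

lemma smooth_coinduct:
  assumes "f \<in> F"
    and "\<And>f. f \<in> F \<Longrightarrow> \<exists>f'. (\<forall>x. (f has_derivative f' x) (at x)) \<and> (\<forall>v. (\<lambda>x. f' x v) \<in> F)"
  shows "smooth f"
proof -
  have "\<forall>f\<in>F. Ck k f" for k
  proof (induction k)
    case 0
    show ?case using assms(2) has_derivative_continuous
      by (auto intro!: continuous_at_imp_continuous_on) blast
  next
    case (Suc k)
    then show ?case using assms(2) unfolding Ck_Suc_iff by blast
  qed
  then show ?thesis using assms(1) unfolding smooth_def by blast
qed

lemma smooth_differentiable: "smooth f \<Longrightarrow> f differentiable (at x)"
  and smooth_frechet_derivative: "smooth f \<Longrightarrow> smooth (\<lambda>x. frechet_derivative f (at x) v)"
  unfolding smooth_def by (metis Ck.simps(2))+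

lemma smooth_has_derivative:
  "smooth f \<Longrightarrow> (f has_derivative frechet_derivative f (at x)) (at x)"
  using smooth_differentiable frechet_derivative_works by blast

lemma smooth_continuous_on: "smooth f \<Longrightarrow> continuous_on S f"
  unfolding smooth_def by (metis Ck.simps(1) continuous_on_subset subset_UNIV)

lemma smooth_borel_measurable:
  fixes f :: "'a::euclidean_space \<Rightarrow> real"
  shows "smooth f \<Longrightarrow> f \<in> borel_measurable borel"
  by (simp add: borel_measurable_continuous_onI smooth_continuous_on)

lemma smooth_DERIV:
  assumes "smooth (f :: real \<Rightarrow> real)" "\<And>x. (f has_real_derivative f' x) (at x)"
  shows "smooth f'"
proof -
  have "frechet_derivative f (at x) = (\<lambda>v. f' x * v)" for x
    using frechet_derivative_at assms(2) unfolding has_field_derivative_def by metis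
  then show ?thesis using smooth_frechet_derivative[OF assms(1), of 1] by simp
qed

lemma smooth_partial:
  assumes "smooth f"
  shows "smooth (partial_x f)" "smooth (partial_y f)"
  using smooth_frechet_derivative[OF assms] unfolding partial_x_def partial_y_def by auto

lemma frechet_derivative_partials:
  assumes "smooth f"
  shows "frechet_derivative f (at z) v = fst v * partial_x f z + snd v * partial_y f z"
proof -
  interpret linear "frechet_derivative f (at z)"
    using smooth_has_derivative[OF assms] has_derivative_linear by blast
  have "v = fst v *\<^sub>R (1, 0) + snd v *\<^sub>R (0, 1)" by (simp add: prod_eq_iff)
  then have "frechet_derivative f (at z) v =
      fst v *\<^sub>R frechet_derivative f (at z) (1, 0) + snd v *\<^sub>R frechet_derivative f (at z) (0, 1)"
    by (metis add scale)
  then show ?thesis by (simp add: partial_x_def partial_y_def)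
qed

lemma has_derivative_partials:
  assumes "smooth f"
  shows "(f has_derivative (\<lambda>v. fst v * partial_x f z + snd v * partial_y f z)) (at z)"
  using smooth_has_derivative[OF assms, of z] frechet_derivative_partials[OF assms, of z]
  by (metis (no_types, lifting) ext)

lemma partials_eqI:
  assumes "(f has_derivative f') (at z)"
  shows "partial_x f z = f' (1, 0)" "partial_y f z = f' (0, 1)"
  using frechet_derivative_at[OF assms] by (simp_all add: partial_x_def partial_y_def)


section \<open>Smooth steps\<close>

text \<open>The classical flat function exp(-1/x), extended by zero to the left. The polynomial
  factor in 1/x makes the class closed under differentiation.\<close>

definition flat_exp :: "real poly \<Rightarrow> real \<Rightarrow> real" where
  "flat_exp p x = (if x \<le> 0 then 0 else poly p (1 / x) * exp (- (1 / x)))"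

lemma poly_div_exp_tendsto_0: "((\<lambda>s. poly p s / exp s) \<longlongrightarrow> 0) at_top" for p :: "real poly"
proof -
  have "((\<lambda>s. \<Sum>i\<le>degree p. coeff p i * (s ^ i / exp s)) \<longlongrightarrow> 0) at_top"
    by (intro tendsto_null_sum tendsto_mult_right_zero tendsto_power_div_exp_0)
  then show ?thesis by (simp add: poly_altdef sum_divide_distrib)
qed

text \<open>In the variable s = 1/x, differentiation in x is -s^2 d/ds, which sends p(s) exp(-s) to
  s^2 (p(s) - p'(s)) exp(-s); the polynomial \<open>[:0, 0, 1:]\<close> is s^2. At the origin the
  difference quotient has the same form and tends to 0.\<close>

lemma flat_exp_DERIV:
  "(flat_exp p has_real_derivative flat_exp ([:0, 0, 1:] * (p - pderiv p)) x) (at x)"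
proof -
  consider "x < 0" | "x = 0" | "x > 0" by linarith
  then show ?thesis
  proof cases
    case 1
    have "((\<lambda>_. 0) has_real_derivative 0) (at x)" by simp
    then have "(flat_exp p has_real_derivative 0) (at x)"
      by (rule DERIV_cong_ev[THEN iffD1, rotated 3, OF _ ])
         (use 1 in \<open>auto simp: flat_exp_def intro!: eventually_nhds_in_open[of "{..<0}", THEN eventually_mono]\<close>)
    then show ?thesis using 1 by (simp add: flat_exp_def)
  next
    case 3
    have "((\<lambda>x. poly p (1 / x) * exp (- (1 / x))) has_real_derivative
        poly ([:0, 0, 1:] * (p - pderiv p)) (1 / x) * exp (- (1 / x))) (at x)"
      using 3 by (auto intro!: derivative_eq_intros DERIV_chain2[OF poly_DERIV]
          simp: field_simps power2_eq_square)
    then have "(flat_exp p has_real_derivative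
        poly ([:0, 0, 1:] * (p - pderiv p)) (1 / x) * exp (- (1 / x))) (at x)"
      by (rule DERIV_cong_ev[THEN iffD1, rotated 3])
         (use 3 in \<open>auto simp: flat_exp_def intro!: eventually_nhds_in_open[of "{0<..}", THEN eventually_mono]\<close>)
    then show ?thesis using 3 by (simp add: flat_exp_def)
  next
    case 2
    have "((\<lambda>h. flat_exp p h / h) \<longlongrightarrow> 0) (at_right 0)"
    proof -
      \<comment> \<open>Dividing by \<open>h\<close> costs one more power of s = 1/h, and
        \<open>pCons 0 p\<close> is s p(s).\<close>
      have "((\<lambda>h. poly (pCons 0 p) (inverse h) / exp (inverse h)) \<longlongrightarrow> 0) (at_right (0::real))"
        using filterlim_compose[OF poly_div_exp_tendsto_0 filterlim_inverse_at_top_right] .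
      then show ?thesis
        by (rule Lim_transform_eventually)
           (auto intro!: eventually_at_right_less[THEN eventually_mono]
             simp: flat_exp_def exp_minus field_simps)
    qed
    moreover have "((\<lambda>h. flat_exp p h / h) \<longlongrightarrow> 0) (at_left 0)"
      by (rule tendsto_eventually) (auto simp: eventually_at_filter flat_exp_def)
    ultimately have "((\<lambda>h. flat_exp p h / h) \<longlongrightarrow> 0) (at 0)"
      unfolding filterlim_def at_eq_sup_left_right filtermap_sup by simp
    then show ?thesis using 2 by (simp add: DERIV_def flat_exp_def)
  qed
qed

lemma smooth_flat_exp: "smooth (flat_exp p)"
proof (rule smooth_coinduct[of _ "range flat_exp"])
  fix f assume "f \<in> range flat_exp"
  then obtain p where p: "f = flat_exp p" by auto
  let ?p' = "[:0, 0, 1:] * (p - pderiv p)"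
  show "\<exists>f'. (\<forall>x. (f has_derivative f' x) (at x)) \<and> (\<forall>v. (\<lambda>x. f' x v) \<in> range flat_exp)"
  proof (intro exI[of _ "\<lambda>x v. flat_exp ?p' x * v"] conjI allI)
    fix v
    have "(\<lambda>x. flat_exp ?p' x * v) = flat_exp (smult v ?p')"
      by (auto simp: flat_exp_def fun_eq_iff)
    then show "(\<lambda>x. flat_exp ?p' x * v) \<in> range flat_exp" by (metis rangeI)
  qed (use flat_exp_DERIV[of p] p in \<open>simp add: has_field_derivative_def\<close>)
qed simp

text \<open>With \<open>e\<close> the flat exponential, the quotient of e(x + \<delta>) by e(x +
  \<delta>) + e(\<delta> - x) is a smooth step: at least one of the two arguments is positive, so
  the denominator never vanishes, and each term vanishes on its own side.\<close>

lemma smooth_step: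
  fixes \<delta> :: real
  assumes d: "\<delta> > 0"
  obtains B b where "smooth B" "smooth b" "\<And>x. (B has_real_derivative b x) (at x)"
    "\<And>x. 0 \<le> b x" "\<And>x. x \<le> - \<delta> \<Longrightarrow> B x = 0" "\<And>x. \<delta> \<le> x \<Longrightarrow> B x = 1" "mono B"
    "\<And>x. \<delta> \<le> \<bar>x\<bar> \<Longrightarrow> b x = 0"
proof -
  define e where "e = flat_exp 1"
  have e: "smooth e" unfolding e_def by (rule smooth_flat_exp)
  have e_pos: "0 < e x" if "x > 0" for x using that by (simp add: e_def flat_exp_def)
  have e_zero: "e x = 0" if "x \<le> 0" for x using that by (simp add: e_def flat_exp_def)
  have e_mono: "e x \<le> e y" if "x \<le> y" for x y
    using that by (auto simp: e_def flat_exp_def divide_simps)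
  have e_nonneg: "0 \<le> e x" for x using e_pos e_zero by (metis less_eq_real_def linorder_not_le)
  define D where "D x = e (1 * x + \<delta>) + e (- 1 * x + \<delta>)" for x
  define B where "B x = e (1 * x + \<delta>) * inverse (D x)" for x
  have D_pos: "D x > 0" for x
    using e_pos[of "x + \<delta>"] e_pos[of "\<delta> - x"] e_nonneg[of "x + \<delta>"] e_nonneg[of "\<delta> - x"] d
    unfolding D_def by (cases "x > 0") (auto intro: add_pos_nonneg add_nonneg_pos)
  have e1: "smooth (\<lambda>x. e (c * x + \<delta>))" for c
    by (rule smooth_affine[OF bounded_linear_mult_right e])
  have "smooth D" unfolding D_def by (intro smooth_add e1)
  then have B: "smooth B"
    unfolding B_def using D_pos by (intro smooth_mult smooth_inverse e1) (metis order_less_irrefl)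
  have "\<exists>d. (B has_real_derivative d) (at x)" for x
    using smooth_differentiable[OF B] real_differentiable_def by blast
  then obtain b where b: "\<And>x. (B has_real_derivative b x) (at x)" by metis
  have monoB: "mono B"
  proof (rule monoI)
    fix x y :: real assume xy: "x \<le> y"
    have "e (x + \<delta>) * e (\<delta> - y) \<le> e (y + \<delta>) * e (\<delta> - x)"
      using xy by (intro mult_mono e_mono e_nonneg) auto
    then have "e (x + \<delta>) * D y \<le> e (y + \<delta>) * D x" by (simp add: D_def algebra_simps)
    then show "B x \<le> B y" using D_pos[of x] D_pos[of y] by (simp add: B_def divide_simps flip: divide_inverse)
  qed
  have b_nonneg: "0 \<le> b x" for x
  proof (rule ccontr)
    assume "\<not> 0 \<le> b x"
    then obtain d where "d > 0" "\<forall>h>0. h < d \<longrightarrow> B (x + h) < B x"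
      using DERIV_neg_dec_right[OF b[of x]] by auto
    then have "B (x + d / 2) < B x" by simp
    then show False using monoD[OF monoB, of x "x + d / 2"] \<open>d > 0\<close> by simp
  qed
  have B0: "B x = 0" if "x \<le> - \<delta>" for x using that e_zero[of "x + \<delta>"] by (simp add: B_def)
  have B1: "B x = 1" if "\<delta> \<le> x" for x
    using that e_zero[of "- x + \<delta>"] D_pos[of x] by (simp add: B_def D_def)
  have sb: "smooth b" by (rule smooth_DERIV[OF B b])
  have b0: "b x = 0" if "\<delta> < \<bar>x\<bar>" for x
  proof (cases "x < 0")
    case True
    have "((\<lambda>_. 0) has_real_derivative 0) (at x)" by simp
    then have "(B has_real_derivative 0) (at x)"
      by (rule DERIV_cong_ev[THEN iffD1, rotated 3])
         (use True that B0 in \<open>auto intro!: eventually_nhds_in_open[of "{..<- \<delta>}", THEN eventually_mono]\<close>)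
    then show ?thesis using b DERIV_unique by blast
  next
    case False
    have "((\<lambda>_. 1) has_real_derivative 0) (at x)" by simp
    then have "(B has_real_derivative 0) (at x)"
      by (rule DERIV_cong_ev[THEN iffD1, rotated 3])
         (use False that B1 in \<open>auto intro!: eventually_nhds_in_open[of "{\<delta><..}", THEN eventually_mono]\<close>)
    then show ?thesis using b DERIV_unique by blast
  qed
  \<comment> \<open>\<open>B\<close> is locally constant only where
    \<open>\<delta> < \<bar>x\<bar>\<close>; the two boundary points are reached by continuity of
    \<open>b\<close>.\<close>
  have "{x. \<delta> \<le> \<bar>x\<bar>} \<subseteq> closure {x. \<delta> < \<bar>x\<bar>}"
  proof -
    have "{x. \<delta> \<le> \<bar>x\<bar>} = {\<delta>..} \<union> {..- \<delta>}" "{x. \<delta> < \<bar>x\<bar>} = {\<delta><..} \<union> {..<- \<delta>}" by auto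
    then show ?thesis by simp
  qed
  moreover have "closed {x. b x = 0}"
    by (intro closed_Collect_eq smooth_continuous_on sb continuous_on_const)
  then have "closure {x. \<delta> < \<bar>x\<bar>} \<subseteq> {x. b x = 0}"
    using b0 by (intro closure_minimal) auto
  ultimately have "b x = 0" if "\<delta> \<le> \<bar>x\<bar>" for x using that by auto
  with that B sb b b_nonneg B0 B1 monoB show ?thesis by blast
qed

section \<open>Mollification in the plane\<close>

lemma test_function_iff: "test_function \<phi> \<longleftrightarrow> smooth \<phi> \<and> bounded {x. \<phi> x \<noteq> 0}"
  for \<phi> :: "'a::euclidean_space \<Rightarrow> real"
  unfolding test_function_def smooth_def compact_eq_bounded_closed
  by (metis bounded_closure bounded_subset closed_closure closure_subset)

lemma bounded_support_cases:
  fixes f :: "'a::real_normed_vector \<Rightarrow> real"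
  assumes "bounded {x. f x \<noteq> 0}"
  obtains R where "R > 0" "\<And>x. R \<le> norm x \<Longrightarrow> f x = 0"
proof -
  obtain R where "\<And>x. f x \<noteq> 0 \<Longrightarrow> norm x \<le> R" using assms unfolding bounded_iff by auto
  then show ?thesis by (intro that[of "max R 0 + 1"]) (auto, force)
qed

lemma bounded_of_compact_support:
  fixes f :: "'a::euclidean_space \<Rightarrow> real"
  assumes "continuous_on UNIV f" "bounded {x. f x \<noteq> 0}"
  obtains K where "K > 0" "\<And>x. \<bar>f x\<bar> \<le> K"
proof -
  obtain R where R: "R > 0" "\<And>x. R \<le> norm x \<Longrightarrow> f x = 0" using bounded_support_cases[OF assms(2)] by blast
  have "compact (f ` cball 0 R)"
    by (intro compact_continuous_image continuous_on_subset[OF assms(1)]) auto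
  then obtain K where K: "K > 0" "\<And>y. y \<in> f ` cball 0 R \<Longrightarrow> norm y \<le> K"
    using compact_imp_bounded bounded_pos by metis
  have "\<bar>f x\<bar> \<le> K" for x
    using K R(2)[of x] by (cases "norm x \<le> R") auto
  with that K(1) show ?thesis by blast
qed

lemma uniformly_continuous_of_compact_support:
  fixes f :: "'a::euclidean_space \<Rightarrow> real"
  assumes "continuous_on UNIV f" "bounded {x. f x \<noteq> 0}" "e > 0"
  obtains d where "d > 0" "\<And>x y. dist x y < d \<Longrightarrow> \<bar>f x - f y\<bar> < e"
proof -
  obtain R where R: "R > 0" "\<And>x. R \<le> norm x \<Longrightarrow> f x = 0" using bounded_support_cases[OF assms(2)] by blast
  \<comment> \<open>The extra radius 1 ensures that two points at distance below 1 either both lie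
    in this ball or are both outside the support.\<close>
  have "uniformly_continuous_on (cball 0 (R + 1)) f"
    by (intro compact_uniformly_continuous continuous_on_subset[OF assms(1)]) auto
  then obtain d where d: "d > 0"
    "\<And>x y. x \<in> cball 0 (R + 1) \<Longrightarrow> y \<in> cball 0 (R + 1) \<Longrightarrow> dist y x < d \<Longrightarrow> dist (f y) (f x) < e"
    using assms(3) unfolding uniformly_continuous_on_def by metis
  have "\<bar>f x - f y\<bar> < e" if "dist x y < min d 1" for x y
  proof (cases "norm x \<le> R + 1 \<and> norm y \<le> R + 1")
    case True
    then show ?thesis using d(2)[of y x] that by (auto simp: dist_real_def)
  next
    case False
    moreover have "norm x \<le> norm y + dist x y" "norm y \<le> norm x + dist x y"
      using norm_triangle_sub[of x y] norm_triangle_sub[of y x] by (auto simp: dist_norm norm_minus_commute)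
    ultimately have "R \<le> norm x" "R \<le> norm y" using that by auto
    then show ?thesis using R(2) assms(3) by simp
  qed
  then show ?thesis using that[of "min d 1"] d(1) by auto
qed

lemma smooth_vanishing_derivative:
  fixes \<phi> :: "'a::euclidean_space \<Rightarrow> real"
  assumes "\<And>x. R < norm x \<Longrightarrow> \<phi> x = 0" "R < norm x"
  shows "frechet_derivative \<phi> (at x) v = 0"
proof -
  have "((\<lambda>_. 0) has_derivative (\<lambda>_. 0)) (at x)" by simp
  moreover have "eventually (\<lambda>y. y \<in> {y. R < norm y}) (nhds x)"
    using assms(2) by (intro eventually_nhds_in_open open_Collect_less continuous_intros) auto
  then have "eventually (\<lambda>y. 0 = \<phi> y) (at x)"
    using assms(1) by (auto simp: eventually_at_filter elim: eventually_mono)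
  ultimately have "(\<phi> has_derivative (\<lambda>_. 0)) (at x)"
    by (rule has_derivative_transform_eventually) (simp_all add: assms)
  then show ?thesis using frechet_derivative_at by metis
qed

lemma test_function_frechet_derivative:
  fixes \<phi> :: "'a::euclidean_space \<Rightarrow> real"
  assumes "test_function \<phi>"
  shows "test_function (\<lambda>x. frechet_derivative \<phi> (at x) v)"
proof -
  obtain R where R: "\<And>x. R \<le> norm x \<Longrightarrow> \<phi> x = 0"
    using bounded_support_cases[of \<phi>] assms unfolding test_function_iff by blast
  have "norm x \<le> R" if "frechet_derivative \<phi> (at x) v \<noteq> 0" for x
    using smooth_vanishing_derivative[of R \<phi> x v] R that by force
  then have "bounded {x. frechet_derivative \<phi> (at x) v \<noteq> 0}" unfolding bounded_iff by auto
  then show ?thesis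
    using assms smooth_frechet_derivative unfolding test_function_iff by auto
qed

lemma test_function_partials:
  assumes "test_function \<phi>"
  shows "test_function (partial_x \<phi>)" "test_function (partial_y \<phi>)"
  using test_function_frechet_derivative[OF assms] unfolding partial_x_def partial_y_def by auto

lemma test_function_cmult: "test_function \<phi> \<Longrightarrow> test_function (\<lambda>x. c * \<phi> x)"
  for \<phi> :: "'a::euclidean_space \<Rightarrow> real"
  unfolding test_function_iff
  by (auto intro!: smooth_mult smooth_const elim: bounded_subset)

lemma bounded_prod_support:
  fixes f g :: "real \<Rightarrow> real"
  assumes "\<And>x. r \<le> \<bar>x\<bar> \<Longrightarrow> f x = 0" "\<And>x. r \<le> \<bar>x\<bar> \<Longrightarrow> g x = 0"
  shows "bounded {z :: real \<times> real. f (fst z) * g (snd z) \<noteq> 0}"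
proof (rule bounded_subset)
  show "bounded ({- r..r} \<times> {- r..r})" by (intro bounded_Times) auto
  show "{z :: real \<times> real. f (fst z) * g (snd z) \<noteq> 0} \<subseteq> {- r..r} \<times> {- r..r}"
    using assms by (force simp: abs_le_iff not_le)
qed

lemma smooth_prod:
  fixes f g :: "real \<Rightarrow> real"
  assumes "smooth f" "smooth g"
  shows "smooth (\<lambda>z :: real \<times> real. f (fst z) * g (snd z))"
  using smooth_mult[OF smooth_affine[OF bounded_linear_fst assms(1), of 0]
      smooth_affine[OF bounded_linear_snd assms(2), of 0]] by simp

lemma test_function_prod:
  fixes f g :: "real \<Rightarrow> real"
  assumes "smooth f" "smooth g" "\<And>x. r \<le> \<bar>x\<bar> \<Longrightarrow> f x = 0" "\<And>x. r \<le> \<bar>x\<bar> \<Longrightarrow> g x = 0"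
  shows "test_function (\<lambda>z :: real \<times> real. f (fst z) * g (snd z))"
  unfolding test_function_iff using smooth_prod[OF assms(1,2)] bounded_prod_support[of r f g, OF assms(3,4)] by blast

lemma partials_prod:
  fixes f g :: "real \<Rightarrow> real"
  assumes "\<And>x. (f has_real_derivative f' x) (at x)" "\<And>x. (g has_real_derivative g' x) (at x)"
  shows "partial_x (\<lambda>z. f (fst z) * g (snd z)) z = f' (fst z) * g (snd z)"
    and "partial_y (\<lambda>z. f (fst z) * g (snd z)) z = f (fst z) * g' (snd z)"
proof -
  have f: "((\<lambda>z. f (fst z)) has_derivative (\<lambda>v. f' (fst z) * fst v)) (at z)" for z :: "real \<times> real"
    using assms(1) by (intro has_derivative_compose[OF has_derivative_fst[OF has_derivative_ident]])
      (simp add: has_field_derivative_def)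
  have g: "((\<lambda>z. g (snd z)) has_derivative (\<lambda>v. g' (snd z) * snd v)) (at z)" for z :: "real \<times> real"
    using assms(2) by (intro has_derivative_compose[OF has_derivative_snd[OF has_derivative_ident]])
      (simp add: has_field_derivative_def)
  show "partial_x (\<lambda>z. f (fst z) * g (snd z)) z = f' (fst z) * g (snd z)"
    and "partial_y (\<lambda>z. f (fst z) * g (snd z)) z = f (fst z) * g' (snd z)"
    using partials_eqI[OF has_derivative_mult[OF f g], of z] by simp_all
qed

text \<open>Strictly a correlation: the kernel is evaluated at \<open>q - p\<close>, so that the
  value at \<open>p\<close> is the average of u(p + q) with weight \<phi>(q), without reflecting the
  kernel. The price is a minus sign whenever a derivative falls on the kernel.\<close>

definition conv :: "('a::euclidean_space \<Rightarrow> real) \<Rightarrow> ('a \<Rightarrow> real) \<Rightarrow> 'a \<Rightarrow> real" where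
  "conv u \<phi> p = (LINT q|lborel. u q * \<phi> (q - p))"

lemma integrable_compact_support:
  fixes f :: "'a::euclidean_space \<Rightarrow> real"
  assumes "continuous_on UNIV f" "bounded {x. f x \<noteq> 0}"
  shows "integrable lborel f"
proof -
  obtain R where R: "\<And>x. R \<le> norm x \<Longrightarrow> f x = 0"
    using bounded_support_cases[OF assms(2)] by blast
  have "integrable lborel (\<lambda>x. indicat_real (cball 0 R) x *\<^sub>R f x)"
    by (rule borel_integrable_compact) (auto intro: continuous_on_subset[OF assms(1)])
  moreover have "(\<lambda>x. indicat_real (cball 0 R) x *\<^sub>R f x) = f"
    using R by (auto simp: indicator_def fun_eq_iff)
  ultimately show ?thesis by simp
qed

lemma integrable_mult_bounded:
  fixes f u :: "'a \<Rightarrow> real"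
  assumes "integrable M f" "u \<in> borel_measurable M" "\<And>x. x \<in> space M \<Longrightarrow> \<bar>u x\<bar> \<le> K"
  shows "integrable M (\<lambda>x. u x * f x)"
proof (rule Bochner_Integration.integrable_bound)
  show "integrable M (\<lambda>x. K * f x)" using assms(1) by simp
  have "\<bar>u x\<bar> * \<bar>f x\<bar> \<le> \<bar>K\<bar> * \<bar>f x\<bar>" if "x \<in> space M" for x
    using assms(3)[OF that] by (intro mult_right_mono) auto
  then show "AE x in M. norm (u x * f x) \<le> norm (K * f x)"
    by (intro AE_I2) (simp add: abs_mult)
qed (use assms in auto)

lemma test_function_shift:
  fixes \<phi> :: "'a::euclidean_space \<Rightarrow> real"
  assumes "test_function \<phi>"
  shows "test_function (\<lambda>q. \<phi> (q - p))"
proof -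
  have "smooth (\<lambda>q. \<phi> (q - p))"
    using smooth_affine[OF bounded_linear_ident, of \<phi> "- p"] assms unfolding test_function_iff by simp
  moreover have "{q. \<phi> (q - p) \<noteq> 0} = (\<lambda>x. p + x) ` {q. \<phi> q \<noteq> 0}"
    by (auto simp: image_iff) (metis add.commute diff_add_cancel)
  ultimately show ?thesis
    using assms bounded_translation[of "{q. \<phi> q \<noteq> 0}" p] unfolding test_function_iff by simp
qed

lemma integrable_test_function: "test_function \<phi> \<Longrightarrow> integrable lborel \<phi>"
  for \<phi> :: "'a::euclidean_space \<Rightarrow> real"
  unfolding test_function_iff by (blast intro: integrable_compact_support smooth_continuous_on)

lemma integrable_conv:
  fixes \<phi> :: "'a::euclidean_space \<Rightarrow> real"
  assumes "test_function \<phi>" "u \<in> borel_measurable borel" "\<And>x. \<bar>u x\<bar> \<le> K"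
  shows "integrable lborel (\<lambda>q. u q * \<phi> (q - p))"
  by (rule integrable_mult_bounded[of _ _ _ K])
     (use assms in \<open>auto intro!: integrable_test_function test_function_shift\<close>)

lemma lborel_integral_shift:
  fixes f :: "'a::euclidean_space \<Rightarrow> real"
  assumes "f \<in> borel_measurable borel"
  shows "(LINT q|lborel. f (p + q)) = (LINT q|lborel. f q)"
proof -
  have "(LINT q|lborel. f q) = (LINT q|distr lborel borel ((+) p). f q)"
    by (simp add: lborel_distr_plus)
  also have "\<dots> = (LINT q|lborel. f (p + q))"
    using assms by (subst integral_distr) auto
  finally show ?thesis by simp
qed

lemma conv_alt:
  assumes "test_function \<phi>" "u \<in> borel_measurable borel"
  shows "conv u \<phi> p = (LINT q|lborel. u (p + q) * \<phi> q)"
proof -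
  have "(\<lambda>q. \<phi> (q - p)) \<in> borel_measurable borel"
    using test_function_shift[OF assms(1)] smooth_borel_measurable unfolding test_function_iff by blast
  then have "(\<lambda>q. u q * \<phi> (q - p)) \<in> borel_measurable borel" using assms(2) by simp
  from lborel_integral_shift[OF this, of p] show ?thesis unfolding conv_def by simp
qed

text \<open>The partial derivatives are uniformly continuous, so the mean value inequality bounds
  the first-order remainder uniformly in the base point. Uniformity is what permits integration of
  the remainder under a convolution.\<close>

lemma test_function_remainder:
  fixes \<phi> :: "real \<times> real \<Rightarrow> real"
  assumes "test_function \<phi>" "e > 0"
  obtains d where "d > 0"
    "\<And>x v. norm v < d \<Longrightarrow> \<bar>\<phi> (x + v) - \<phi> x - frechet_derivative \<phi> (at x) v\<bar> \<le> e * norm v"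
proof -
  have sm: "smooth \<phi>" using assms unfolding test_function_iff by blast
  have px: "continuous_on UNIV (partial_x \<phi>)" "bounded {x. partial_x \<phi> x \<noteq> 0}"
    and py: "continuous_on UNIV (partial_y \<phi>)" "bounded {x. partial_y \<phi> x \<noteq> 0}"
    using test_function_partials[OF assms(1)] unfolding test_function_iff
    by (auto intro: smooth_continuous_on)
  obtain d1 where d1: "d1 > 0" "\<And>x y. dist x y < d1 \<Longrightarrow> \<bar>partial_x \<phi> x - partial_x \<phi> y\<bar> < e / 2"
    using uniformly_continuous_of_compact_support[OF px, of "e / 2"] assms(2) by auto
  obtain d2 where d2: "d2 > 0" "\<And>x y. dist x y < d2 \<Longrightarrow> \<bar>partial_y \<phi> x - partial_y \<phi> y\<bar> < e / 2"
    using uniformly_continuous_of_compact_support[OF py, of "e / 2"] assms(2) by auto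
  define d where "d = min d1 d2"
  define D where "D x v = fst v * partial_x \<phi> x + snd v * partial_y \<phi> x" for x v
  have D: "(\<phi> has_derivative D x) (at x within S)" for x S
    unfolding D_def by (rule has_derivative_at_withinI[OF has_derivative_partials[OF sm]])
  have "\<bar>\<phi> (x + v) - \<phi> x - frechet_derivative \<phi> (at x) v\<bar> \<le> e * norm v" if v: "norm v < d" for x v
  proof -
    have "norm (\<phi> (x + v) - \<phi> x - D x ((x + v) - x)) \<le> norm ((x + v) - x) * e"
    proof (rule differentiable_bound_linearization[where S = "ball x d"])
      fix t :: real assume "t \<in> {0..1}"
      then have "norm (t *\<^sub>R v) \<le> norm v" by (simp add: mult_left_le_one_le)
      then show "x + t *\<^sub>R (x + v - x) \<in> ball x d" using v by (simp add: dist_norm)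
    next
      fix y assume y: "y \<in> ball x d"
      then have *: "\<bar>partial_x \<phi> y - partial_x \<phi> x\<bar> \<le> e / 2" "\<bar>partial_y \<phi> y - partial_y \<phi> x\<bar> \<le> e / 2"
        using d1(2)[of y x] d2(2)[of y x] unfolding d_def by (auto simp: dist_commute)
      show "onorm (D y - D x) \<le> e"
      proof (rule onorm_le)
        fix w :: "real \<times> real"
        have "\<bar>fst w\<bar> \<le> norm w" "\<bar>snd w\<bar> \<le> norm w"
          using norm_fst_le[of "fst w" "snd w"] norm_snd_le[of "snd w" "fst w"] by simp_all
        then have "\<bar>fst w\<bar> * \<bar>partial_x \<phi> y - partial_x \<phi> x\<bar> \<le> norm w * (e / 2)"
          "\<bar>snd w\<bar> * \<bar>partial_y \<phi> y - partial_y \<phi> x\<bar> \<le> norm w * (e / 2)"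
          using * by (intro mult_mono; simp)+
        moreover have "norm ((D y - D x) w) \<le> \<bar>fst w * (partial_x \<phi> y - partial_x \<phi> x)\<bar>
            + \<bar>snd w * (partial_y \<phi> y - partial_y \<phi> x)\<bar>"
          unfolding D_def by (simp add: algebra_simps)
        ultimately show "norm ((D y - D x) w) \<le> e * norm w" by (simp add: abs_mult mult.commute)
      qed
    next
      show "x \<in> ball x d" using d1(1) d2(1) by (simp add: d_def)
    qed (use D in auto)
    then show ?thesis
      unfolding frechet_derivative_partials[OF sm] D_def by (simp add: mult.commute)
  qed
  then show ?thesis using that[of d] d1(1) d2(1) by (simp add: d_def)
qed

text \<open>All regularity comes from the kernel, as \<open>u\<close> is merely bounded and
  measurable. The uniform remainder of \<open>\<phi>\<close> is integrated over a ball that does not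
  depend on the increment.\<close>

lemma conv_has_derivative:
  fixes u :: "real \<times> real \<Rightarrow> real"
  assumes phi: "test_function \<phi>" and u: "u \<in> borel_measurable borel" "\<And>x. \<bar>u x\<bar> \<le> K"
  shows "(conv u \<phi> has_derivative (\<lambda>v. conv u (\<lambda>q. - frechet_derivative \<phi> (at q) v) p)) (at p)"
  unfolding has_derivative_at_alt
proof (intro conjI allI impI)
  have sm: "smooth \<phi>" using phi unfolding test_function_iff by blast
  let ?D = "\<lambda>v. conv u (\<lambda>q. - frechet_derivative \<phi> (at q) v) p"
  have tD: "test_function (\<lambda>q. - frechet_derivative \<phi> (at q) v)" for v
    using test_function_cmult[OF test_function_frechet_derivative[OF phi], of "- 1"] by simp
  have iD: "integrable lborel (\<lambda>q. u q * - frechet_derivative \<phi> (at (q - p)) v)" for v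
    using integrable_conv[OF tD u] by simp
  have i\<phi>: "integrable lborel (\<lambda>q. u q * \<phi> (q - p))" for p
    using integrable_conv[OF phi u] by simp
  have "linear ?D"
  proof (rule linearI)
    fix v w
    have "?D (v + w) = (LINT q|lborel. u q * - frechet_derivative \<phi> (at (q - p)) v
        + u q * - frechet_derivative \<phi> (at (q - p)) w)"
      unfolding conv_def by (intro Bochner_Integration.integral_cong)
        (simp_all add: frechet_derivative_partials[OF sm] algebra_simps)
    also have "\<dots> = ?D v + ?D w"
      unfolding conv_def by (intro Bochner_Integration.integral_add iD)
    finally show "?D (v + w) = ?D v + ?D w" .
  next
    fix c v
    have "?D (c *\<^sub>R v) = (LINT q|lborel. c * (u q * - frechet_derivative \<phi> (at (q - p)) v))"
      unfolding conv_def by (intro Bochner_Integration.integral_cong)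
        (simp_all add: frechet_derivative_partials[OF sm] algebra_simps)
    also have "\<dots> = c *\<^sub>R ?D v"
      unfolding conv_def real_scaleR_def by (rule integral_mult_right_zero)
    finally show "?D (c *\<^sub>R v) = c *\<^sub>R ?D v" .
  qed
  then show "bounded_linear ?D" by (simp add: linear_conv_bounded_linear)
  fix e :: real assume e: "e > 0"
  obtain R where R: "R > 0" "\<And>x. R \<le> norm x \<Longrightarrow> \<phi> x = 0"
    using bounded_support_cases[of \<phi>] phi unfolding test_function_iff by blast
  have K: "0 \<le> K" using u(2)[of 0] by linarith
  define A where "A = measure lborel (cball (p :: real \<times> real) (R + 1))"
  \<comment> \<open>\<open>K\<close> bounds \<open>u\<close> and \<open>A\<close> is the volume over
    which the remainder is integrated; the summand 1 guards against
    \<open>K * A = 0\<close>.\<close>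
  define e' where "e' = e / (K * A + 1)"
  have A: "A \<ge> 0" by (simp add: A_def)
  then have e': "e' > 0" unfolding e'_def using e K by (intro divide_pos_pos add_nonneg_pos) auto
  have "e' * (K * A) \<le> e"
  proof -
    have "0 \<le> K * A" using K A by simp
    then show ?thesis using e unfolding e'_def by (simp add: field_simps)
  qed
  obtain d where d: "d > 0"
    "\<And>x v. norm v < d \<Longrightarrow> \<bar>\<phi> (x + v) - \<phi> x - frechet_derivative \<phi> (at x) v\<bar> \<le> e' * norm v"
    using test_function_remainder[OF phi e'] by blast
  show "\<exists>d>0. \<forall>y. norm (y - p) < d \<longrightarrow> norm (conv u \<phi> y - conv u \<phi> p - ?D (y - p)) \<le> e * norm (y - p)"
  proof (intro exI[of _ "min d 1"] conjI allI impI)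
    fix y assume y: "norm (y - p) < min d 1"
    let ?r = "\<lambda>q. u q * \<phi> (q - y) - u q * \<phi> (q - p) - u q * - frechet_derivative \<phi> (at (q - p)) (y - p)"
    \<comment> \<open>The radius \<open>R\<close> covers the support of the kernel centred at
      \<open>p\<close>, and the extra 1 covers the kernel centred at \<open>y\<close>, since
      \<open>y\<close> is closer than 1 to \<open>p\<close>.\<close>
    have bound: "norm (?r q) \<le> indicat_real (cball p (R + 1)) q * (K * (e' * norm (y - p)))" for q
    proof (cases "q \<in> cball p (R + 1)")
      case True
      have "q - y = (q - p) + (p - y)" by simp
      then have "\<bar>\<phi> (q - y) - \<phi> (q - p) - frechet_derivative \<phi> (at (q - p)) (p - y)\<bar> \<le> e' * norm (p - y)"
        using d(2)[of "p - y" "q - p"] y by (simp add: norm_minus_commute)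
      moreover have "frechet_derivative \<phi> (at (q - p)) (p - y) = - frechet_derivative \<phi> (at (q - p)) (y - p)"
        by (simp add: frechet_derivative_partials[OF sm] algebra_simps)
      ultimately have *: "\<bar>\<phi> (q - y) - \<phi> (q - p) - - frechet_derivative \<phi> (at (q - p)) (y - p)\<bar> \<le> e' * norm (y - p)"
        by (simp add: norm_minus_commute)
      have "?r q = u q * (\<phi> (q - y) - \<phi> (q - p) - - frechet_derivative \<phi> (at (q - p)) (y - p))"
        by (simp add: algebra_simps)
      then have "norm (?r q) \<le> K * (e' * norm (y - p))"
        using mult_mono[OF u(2)[of q] *] K by (simp add: abs_mult)
      then show ?thesis using True by simp
    next
      case False
      then have *: "R + 1 < norm (q - p)" by (simp add: dist_norm norm_minus_commute)
      moreover have "norm (q - p) \<le> norm (q - y) + norm (y - p)"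
        using norm_triangle_ineq[of "q - y" "y - p"] by simp
      ultimately have "R \<le> norm (q - y)" using y by simp
      moreover have "frechet_derivative \<phi> (at (q - p)) (y - p) = 0"
        by (rule smooth_vanishing_derivative[of R]) (use R * in auto)
      ultimately show ?thesis using R False * by simp
    qed
    have ir: "integrable lborel ?r" by (intro Bochner_Integration.integrable_diff i\<phi> iD)
    have fin: "emeasure lborel (cball p (R + 1)) < \<infinity>" by (rule emeasure_compact_finite) simp
    have "conv u \<phi> y - conv u \<phi> p - ?D (y - p) = (LINT q|lborel. ?r q)"
      unfolding conv_def
      by (simp only: Bochner_Integration.integral_diff[OF i\<phi> i\<phi>]
          Bochner_Integration.integral_diff[OF Bochner_Integration.integrable_diff[OF i\<phi> i\<phi>] iD])
    also have "norm \<dots> \<le> (LINT q|lborel. indicat_real (cball p (R + 1)) q * (K * (e' * norm (y - p))))"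
      using ir fin by (intro Bochner_Integration.integral_norm_bound_integral bound integrable_mult_left) auto
    also have "\<dots> = A * (K * (e' * norm (y - p)))" using fin by (simp add: A_def)
    also have "\<dots> = (e' * (K * A)) * norm (y - p)" by (simp add: algebra_simps)
    also have "\<dots> \<le> e * norm (y - p)"
      using \<open>e' * (K * A) \<le> e\<close> by (intro mult_right_mono) auto
    finally show "norm (conv u \<phi> y - conv u \<phi> p - ?D (y - p)) \<le> e * norm (y - p)" .
  qed (use d in auto)
qed

lemma smooth_conv:
  fixes u :: "real \<times> real \<Rightarrow> real"
  assumes phi: "test_function \<phi>" and u: "u \<in> borel_measurable borel" "\<And>x. \<bar>u x\<bar> \<le> K"
  shows "smooth (conv u \<phi>)"
proof (rule smooth_coinduct[of _ "conv u ` Collect test_function"])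
  fix f assume "f \<in> conv u ` Collect test_function"
  then obtain \<phi> where \<phi>: "test_function \<phi>" "f = conv u \<phi>" by auto
  show "\<exists>f'. (\<forall>x. (f has_derivative f' x) (at x)) \<and> (\<forall>v. (\<lambda>x. f' x v) \<in> conv u ` Collect test_function)"
  proof (intro exI[of _ "\<lambda>x v. conv u (\<lambda>q. - frechet_derivative \<phi> (at q) v) x"] conjI allI)
    fix v
    have "test_function (\<lambda>q. - frechet_derivative \<phi> (at q) v)"
      using test_function_cmult[OF test_function_frechet_derivative[OF \<phi>(1)], of "- 1"] by simp
    then show "(\<lambda>x. conv u (\<lambda>q. - frechet_derivative \<phi> (at q) v) x) \<in> conv u ` Collect test_function"
      by auto
  qed (use conv_has_derivative[OF \<phi>(1) u] \<phi>(2) in auto)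
qed (use phi in auto)

lemma conv_partials:
  fixes u :: "real \<times> real \<Rightarrow> real"
  assumes "test_function \<phi>" "u \<in> borel_measurable borel" "\<And>x. \<bar>u x\<bar> \<le> K"
  shows "partial_x (conv u \<phi>) p = conv u (\<lambda>q. - partial_x \<phi> q) p"
    and "partial_y (conv u \<phi>) p = conv u (\<lambda>q. - partial_y \<phi> q) p"
  using partials_eqI[OF conv_has_derivative[OF assms]] unfolding partial_x_def partial_y_def by auto

section \<open>Mollifiers adapted to finite differences at the lattice scale\<close>

locale step_kernel =
  fixes B b :: "real \<Rightarrow> real" and h :: real
  assumes h: "h > 0" and B: "smooth B" and b: "smooth b"
    and DB: "\<And>x. (B has_real_derivative b x) (at x)"
    and b_nonneg: "\<And>x. 0 \<le> b x" and B_left: "\<And>x. x \<le> - h \<Longrightarrow> B x = 0"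
    and B_right: "\<And>x. h \<le> x \<Longrightarrow> B x = 1" and B_mono: "mono B"
    and b_zero: "\<And>x. h \<le> \<bar>x\<bar> \<Longrightarrow> b x = 0"
begin

definition \<rho> :: "real \<times> real \<Rightarrow> real" where
  "\<rho> q = b (fst q) * b (snd q)"

text \<open>This is the mean of \<open>b\<close> over the interval from x - h to x, that is,
  \<open>b\<close> convolved with the uniform density on [0, h]. Its derivative is therefore a
  difference quotient of \<open>b\<close>. The spelling \<open>1 * x + - h\<close> matches the shape
  of \<open>smooth_affine\<close>.\<close>

definition d :: "real \<Rightarrow> real" where
  "d x = 1 / h * (B x - B (1 * x + - h))"

text \<open>The \<open>x\<close>-derivative of this kernel is a difference quotient of \<open>\<rho>\<close>, so that mollification
  with it turns finite differences at scale \<open>h\<close> into derivatives.\<close>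

definition \<kappa> :: "real \<times> real \<Rightarrow> real" where
  "\<kappa> q = d (fst q) * b (snd q)"

lemma smooth_d: "smooth d"
  unfolding d_def
  by (intro smooth_mult smooth_const smooth_diff B smooth_affine[OF bounded_linear_mult_right])

lemma d_bounds: "0 \<le> d x" "d x \<le> 1 / h"
proof -
  have "0 \<le> B x" "B x \<le> 1" for x
    using monoD[OF B_mono, of "min x (- h)" x] monoD[OF B_mono, of x "max x h"]
    by (auto simp: B_left B_right)
  moreover have "B (x - h) \<le> B x" using monoD[OF B_mono, of "x - h" x] h by simp
  ultimately have "0 \<le> B x - B (x - h)" "B x - B (x - h) \<le> 1"
    by (smt (verit))+
  then show "0 \<le> d x" "d x \<le> 1 / h" using h by (simp_all add: d_def divide_simps)
qed

lemma d_zero: "2 * h \<le> \<bar>x\<bar> \<Longrightarrow> d x = 0"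
  using h by (cases "x > 0") (simp_all add: d_def B_left B_right)

lemma d_DERIV: "(d has_real_derivative (b x - b (x - h)) / h) (at x)"
proof -
  have "((\<lambda>x. B (1 * x + - h)) has_real_derivative b (x - h)) (at x)"
  proof -
    have "((\<lambda>x. 1 * x + - h) has_real_derivative 1) (at x)" by (auto intro!: derivative_eq_intros)
    from DERIV_chain2[OF _ this, of B "b (x - h)"] DB[of "x - h"] show ?thesis by simp
  qed
  then have "((\<lambda>x. 1 / h * (B x - B (1 * x + - h))) has_real_derivative 1 / h * (b x - b (x - h))) (at x)"
    by (intro DERIV_cmult DERIV_diff DB)
  then show ?thesis by (simp add: d_def[abs_def])
qed

lemma b_DERIV: "\<exists>b'. \<forall>x. (b has_real_derivative b' x) (at x)"
  using smooth_differentiable[OF b] unfolding real_differentiable_def by metis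

lemma test_\<rho>: "test_function \<rho>"
  unfolding \<rho>_def[abs_def] by (rule test_function_prod[OF b b b_zero b_zero])

lemma test_\<kappa>: "test_function \<kappa>"
  unfolding \<kappa>_def[abs_def]
  by (rule test_function_prod[OF smooth_d b d_zero]) (use h b_zero in auto)

lemma \<rho>_nonneg: "0 \<le> \<rho> q" and \<kappa>_nonneg: "0 \<le> \<kappa> q"
  by (simp_all add: \<rho>_def \<kappa>_def b_nonneg d_bounds)

lemma \<rho>_zero: "2 * h \<le> norm q \<Longrightarrow> \<rho> q = 0"
proof -
  assume "2 * h \<le> norm q"
  moreover have "norm q \<le> \<bar>fst q\<bar> + \<bar>snd q\<bar>"
    using norm_Pair_le[of "fst q" "snd q"] by simp
  ultimately have "h \<le> \<bar>fst q\<bar> \<or> h \<le> \<bar>snd q\<bar>" by linarith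
  then show "\<rho> q = 0" using b_zero by (auto simp: \<rho>_def)
qed

lemma partial_x_\<kappa>: "partial_x \<kappa> q = (\<rho> q - \<rho> (q - (h, 0))) / h"
proof -
  obtain b' where "\<And>x. (b has_real_derivative b' x) (at x)" using b_DERIV by blast
  from partials_prod(1)[OF d_DERIV this, of q] show ?thesis
    unfolding \<kappa>_def[abs_def] by (simp add: \<rho>_def algebra_simps diff_divide_distrib)
qed

lemma integral_b: "(LINT x|lborel. b x) = 1"
proof -
  have "(LINT x|lborel. b x * indicator {- h..h} x) = B h - B (- h)"
    by (rule integral_FTC_Icc_nonneg)
       (use DB b_nonneg h smooth_borel_measurable[OF b] in \<open>auto\<close>)
  moreover have "(\<lambda>x. b x * indicator {- h..h} x) = b"
  proof
    show "b x * indicator {- h..h} x = b x" for x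
      using b_zero[of x] by (cases "h \<le> \<bar>x\<bar>") (auto simp: indicator_def)
  qed
  ultimately show ?thesis using B_left[of "- h"] B_right[of h] by simp
qed

lemma integral_prod_b:
  assumes "test_function (\<lambda>q :: real \<times> real. f (fst q) * b (snd q))"
  shows "(LINT q|lborel. f (fst q) * b (snd q)) = (LINT x|lborel. f x)"
proof -
  have "(LINT x|lborel. LINT y|lborel. f (fst (x, y)) * b (snd (x, y)))
      = (LINT q|(lborel \<Otimes>\<^sub>M lborel). f (fst q) * b (snd q))"
    by (rule lborel_pair.integral_fst') (use integrable_test_function[OF assms] in \<open>simp add: lborel_prod\<close>)
  then show ?thesis by (simp add: integral_b lborel_prod)
qed

lemma integral_\<rho>: "(LINT q|lborel. \<rho> q) = 1"
  using integral_prod_b[of b] test_\<rho> integral_b unfolding \<rho>_def[abs_def] by simp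

text \<open>\<open>d\<close> is at most \<open>1 / h\<close> and lives on an interval of length
  \<open>4 * h\<close>. This crude bound is the origin of the factor 4 in the heights of the
  mollified potentials.\<close>

lemma integral_\<kappa>: "(LINT q|lborel. \<kappa> q) \<le> 4"
proof -
  have "(LINT q|lborel. \<kappa> q) = (LINT x|lborel. d x)"
    using integral_prod_b[of d] test_\<kappa> unfolding \<kappa>_def[abs_def] by simp
  also have "\<dots> \<le> (LINT x|lborel. indicat_real {- (2 * h)..2 * h} x * (1 / h))"
  proof (rule integral_mono)
    have "bounded {x. d x \<noteq> 0}"
      by (rule bounded_subset[of "{- (2 * h)..2 * h}"]) (use d_zero in \<open>force simp: abs_le_iff\<close>)+
    then show "integrable lborel d"
      by (intro integrable_compact_support smooth_continuous_on smooth_d)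
    show "d x \<le> indicat_real {- (2 * h)..2 * h} x * (1 / h)" for x
      using d_bounds[of x] d_zero[of x] by (auto simp: indicator_def)
    show "integrable lborel (\<lambda>x. indicat_real {- (2 * h)..2 * h} x * (1 / h))"
      by (intro integrable_mult_left) (use h in \<open>simp add: integrable_indicator_iff ennreal_less_top\<close>)
  qed
  also have "\<dots> = 4" using h by simp
  finally show ?thesis .
qed

end

lemma DERIV_nonneg_of_right_mono:
  fixes f :: "real \<Rightarrow> real"
  assumes "(f has_real_derivative l) (at 0)" "\<And>t. 0 \<le> t \<Longrightarrow> f 0 \<le> f t"
  shows "0 \<le> l"
proof (rule ccontr)
  assume "\<not> 0 \<le> l"
  then obtain e where "e > 0" "\<forall>t>0. t < e \<longrightarrow> f (0 + t) < f 0"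
    using DERIV_neg_dec_right[OF assms(1)] by auto
  then have "f (e / 2) < f 0" by simp
  then show False using assms(2)[of "e / 2"] \<open>e > 0\<close> by simp
qed

text \<open>In the application \<open>u\<close> is a step function, so its derivative must be
  produced by the kernel: the x-derivative of \<open>\<kappa>\<close> is a difference quotient of
  \<open>\<rho>\<close>, and moving the difference onto \<open>u\<close> leaves a \<rho>-average of
  difference quotients of \<open>u\<close>. Since \<open>\<rho>\<close> has mass one,
  \<open>step\<close> bounds this average by 1.\<close>

lemma (in step_kernel) mollify_x:
  fixes u :: "real \<times> real \<Rightarrow> real"
  assumes u: "u \<in> borel_measurable borel" "\<And>p. 0 \<le> u p" "\<And>p. u p \<le> M"
    and mono: "\<And>p v. \<bar>snd v\<bar> \<le> fst v \<Longrightarrow> u p \<le> u (p + v)"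
    and step: "\<And>p. u (p + (h, 0)) - u p \<le> h"
  shows "smooth (conv u \<kappa>)" "0 \<le> conv u \<kappa> p" "conv u \<kappa> p \<le> 4 * M"
    "\<bar>partial_y (conv u \<kappa>) p\<bar> \<le> partial_x (conv u \<kappa>) p" "partial_x (conv u \<kappa>) p \<le> 1"
    "partial_x (conv u \<kappa>) p = (LINT q|lborel. (u (p + q + (h, 0)) - u (p + q)) / h * \<rho> q)"
    "integrable lborel (\<lambda>q. (u (p + q + (h, 0)) - u (p + q)) / h * \<rho> q)"
proof -
  have M: "0 \<le> M" using u(2,3)[of 0] by linarith
  have uM: "\<bar>u p\<bar> \<le> M" for p using u(2,3)[of p] by simp
  show sm: "smooth (conv u \<kappa>)" by (rule smooth_conv[OF test_\<kappa> u(1) uM])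
  have shift: "(\<lambda>q. u (p + q)) \<in> borel_measurable borel" for p
    using u(1) by (rule measurable_compose[rotated]) simp
  have iu: "integrable lborel (\<lambda>q. u (p + q) * \<phi> q)" if "test_function \<phi>" for \<phi> p
    using integrable_conv[OF that shift[of p], where K = M and p = 0] uM by simp
  show "0 \<le> conv u \<kappa> p"
    unfolding conv_def by (intro Bochner_Integration.integral_nonneg mult_nonneg_nonneg u(2) \<kappa>_nonneg)
  have "conv u \<kappa> p \<le> (LINT q|lborel. M * \<kappa> q)"
    unfolding conv_alt[OF test_\<kappa> u(1)]
    by (intro integral_mono iu test_\<kappa> mult_right_mono u(3) \<kappa>_nonneg integrable_mult_right integrable_test_function)
  also have "\<dots> \<le> M * 4" using integral_\<kappa> M by (simp add: mult_left_mono)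
  finally show "conv u \<kappa> p \<le> 4 * M" by simp
  have t\<rho>: "test_function (\<lambda>q. \<rho> (q - (h, 0)))" by (rule test_function_shift[OF test_\<rho>])
  have "partial_x (conv u \<kappa>) p = conv u (\<lambda>q. - partial_x \<kappa> q) p"
    by (rule conv_partials[OF test_\<kappa> u(1) uM])
  also have "\<dots> = (LINT q|lborel. u (p + q) * ((\<rho> (q - (h, 0)) - \<rho> q) / h))"
    using test_function_cmult[OF test_function_partials(1)[OF test_\<kappa>], of "- 1"]
    by (subst conv_alt[OF _ u(1)]) (simp_all add: partial_x_\<kappa> minus_divide_left)
  also have "\<dots> = (LINT q|lborel. (u (p + q) * \<rho> (q - (h, 0)) - u (p + q) * \<rho> q) / h)"
    by (simp add: algebra_simps)
  also have "\<dots> = ((LINT q|lborel. u (p + q) * \<rho> (q - (h, 0))) - (LINT q|lborel. u (p + q) * \<rho> q)) / h"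
    by (subst Bochner_Integration.integral_diff[OF iu[OF t\<rho>] iu[OF test_\<rho>], symmetric])
       (simp only: integral_divide_zero)
  \<comment> \<open>Translation invariance moves the shift by \<open>(h, 0)\<close> from the kernel
    onto \<open>u\<close>.\<close>
  also have "(LINT q|lborel. u (p + q) * \<rho> (q - (h, 0))) = (LINT q|lborel. u (p + (h, 0) + q) * \<rho> q)"
    using lborel_integral_shift[of "\<lambda>q. u (p + q) * \<rho> (q - (h, 0))" "(h, 0)"]
      borel_measurable_integrable[OF iu[OF t\<rho>]] by (simp add: add.assoc)
  also have "(LINT q|lborel. u (p + (h, 0) + q) * \<rho> q) - (LINT q|lborel. u (p + q) * \<rho> q)
      = (LINT q|lborel. u (p + (h, 0) + q) * \<rho> q - u (p + q) * \<rho> q)"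
    by (rule Bochner_Integration.integral_diff[OF iu iu, OF test_\<rho> test_\<rho>, symmetric])
  also have "\<dots> / h = (LINT q|lborel. (u (p + (h, 0) + q) * \<rho> q - u (p + q) * \<rho> q) / h)"
    by (simp only: integral_divide_zero)
  also have "(\<lambda>q. (u (p + (h, 0) + q) * \<rho> q - u (p + q) * \<rho> q) / h)
      = (\<lambda>q. (u (p + q + (h, 0)) - u (p + q)) / h * \<rho> q)"
    by (simp add: fun_eq_iff algebra_simps diff_divide_distrib)
  finally show px: "partial_x (conv u \<kappa>) p = (LINT q|lborel. (u (p + q + (h, 0)) - u (p + q)) / h * \<rho> q)" .
  have "integrable lborel (\<lambda>q. (u (p + (h, 0) + q) * \<rho> q - u (p + q) * \<rho> q) / h)"
    by (intro Bochner_Integration.integrable_diff integrable_divide_zero iu test_\<rho>)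
  also have "(\<lambda>q. (u (p + (h, 0) + q) * \<rho> q - u (p + q) * \<rho> q) / h)
      = (\<lambda>q. (u (p + q + (h, 0)) - u (p + q)) / h * \<rho> q)"
    by (simp add: fun_eq_iff algebra_simps diff_divide_distrib)
  finally show i: "integrable lborel (\<lambda>q. (u (p + q + (h, 0)) - u (p + q)) / h * \<rho> q)" .
  have "(LINT q|lborel. (u (p + q + (h, 0)) - u (p + q)) / h * \<rho> q) \<le> (LINT q|lborel. \<rho> q)"
  proof (rule integral_mono[OF i integrable_test_function[OF test_\<rho>]])
    show "(u (p + q + (h, 0)) - u (p + q)) / h * \<rho> q \<le> \<rho> q" for q
    proof -
      have "(u (p + q + (h, 0)) - u (p + q)) / h \<le> 1" using step[of "p + q"] h by simp
      from mult_right_mono[OF this \<rho>_nonneg[of q]] show ?thesis by simp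
    qed
  qed
  then show "partial_x (conv u \<kappa>) p \<le> 1" using px integral_\<rho> by simp
  \<comment> \<open>In every direction (1, s) inside the cone \<open>u\<close> does not decrease,
    hence neither do its averages. The two extreme directions s = 1 and s = -1 together give the
    bound on the y-derivative.\<close>
  have dir: "0 \<le> partial_x (conv u \<kappa>) p + s * partial_y (conv u \<kappa>) p" if s: "\<bar>s\<bar> \<le> 1" for s
  proof (rule DERIV_nonneg_of_right_mono)
    have line: "((\<lambda>t. p + t *\<^sub>R (1, s)) has_derivative (\<lambda>t. t *\<^sub>R (1, s))) (at 0)"
      by (auto intro!: derivative_eq_intros)
    have "(conv u \<kappa> has_derivative
        (\<lambda>v. fst v * partial_x (conv u \<kappa>) p + snd v * partial_y (conv u \<kappa>) p)) (at (p + 0 *\<^sub>R (1, s)))"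
      unfolding scaleR_zero_left add_0_right by (rule has_derivative_partials[OF sm])
    from has_derivative_compose[OF line this]
    have "((\<lambda>t. conv u \<kappa> (p + t *\<^sub>R (1, s))) has_derivative
        (\<lambda>t. fst (t *\<^sub>R (1, s)) * partial_x (conv u \<kappa>) p + snd (t *\<^sub>R (1 :: real, s)) * partial_y (conv u \<kappa>) p)) (at 0)"
      .
    then show "((\<lambda>t. conv u \<kappa> (p + t *\<^sub>R (1, s))) has_real_derivative
        (partial_x (conv u \<kappa>) p + s * partial_y (conv u \<kappa>) p)) (at 0)"
      unfolding has_field_derivative_def by (rule has_derivative_eq_rhs) (auto simp: algebra_simps)
    fix t :: real assume t: "0 \<le> t"
    have "u (p + q) \<le> u (p + t *\<^sub>R (1, s) + q)" for q
    proof -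
      have "\<bar>snd (t *\<^sub>R (1 :: real, s))\<bar> \<le> fst (t *\<^sub>R (1, s))"
        using t s by (simp add: abs_mult mult_left_le)
      from mono[OF this, of "p + q"] show ?thesis by (simp only: ac_simps)
    qed
    then have "conv u \<kappa> p \<le> conv u \<kappa> (p + t *\<^sub>R (1, s))"
      unfolding conv_alt[OF test_\<kappa> u(1)]
      by (intro integral_mono iu test_\<kappa> mult_right_mono \<kappa>_nonneg)
    then show "conv u \<kappa> (p + 0 *\<^sub>R (1, s)) \<le> conv u \<kappa> (p + t *\<^sub>R (1, s))"
      unfolding scaleR_zero_left add_0_right .
  qed
  show "\<bar>partial_y (conv u \<kappa>) p\<bar> \<le> partial_x (conv u \<kappa>) p"
    using dir[of 1] dir[of "- 1"] by simp
qed

lemma partials_swap: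
  assumes "smooth (f :: real \<times> real \<Rightarrow> real)"
  shows "smooth (\<lambda>p. f (prod.swap p))"
    "partial_x (\<lambda>p. f (prod.swap p)) p = partial_y f (prod.swap p)"
    "partial_y (\<lambda>p. f (prod.swap p)) p = partial_x f (prod.swap p)"
proof -
  have L: "bounded_linear (prod.swap :: real \<times> real \<Rightarrow> real \<times> real)"
    unfolding prod.swap_def by (intro bounded_linear_Pair bounded_linear_fst bounded_linear_snd)
  show "smooth (\<lambda>p. f (prod.swap p))" using smooth_affine[OF L assms, of 0] by simp
  have "((\<lambda>p. f (prod.swap p)) has_derivative (\<lambda>v. fst (prod.swap v) * partial_x f (prod.swap p)
      + snd (prod.swap v) * partial_y f (prod.swap p))) (at p)"
    by (rule has_derivative_compose[OF bounded_linear_imp_has_derivative[OF L] has_derivative_partials[OF assms]])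
  from partials_eqI[OF this] show "partial_x (\<lambda>p. f (prod.swap p)) p = partial_y f (prod.swap p)"
    "partial_y (\<lambda>p. f (prod.swap p)) p = partial_x f (prod.swap p)" by simp_all
qed

lemma lborel_swap:
  fixes f :: "real \<times> real \<Rightarrow> real"
  assumes "f \<in> borel_measurable borel"
  shows "(LINT q|lborel. f (prod.swap q)) = (LINT q|lborel. f q)"
  using lborel_pair.integral_product_swap[of f] assms
  by (simp add: lborel_prod borel_prod case_prod_unfold prod.swap_def)

text \<open>The coordinate swap reduces this to the previous case. As \<open>\<rho>\<close> is
  symmetric under the swap, both mollified derivatives are averages with the same weight, so their
  lower bounds can later be added under one integral.\<close>

lemma (in step_kernel) mollify_y:
  fixes v :: "real \<times> real \<Rightarrow> real"
  assumes v: "v \<in> borel_measurable borel" "\<And>p. 0 \<le> v p" "\<And>p. v p \<le> M"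
    and mono: "\<And>p w. \<bar>fst w\<bar> \<le> snd w \<Longrightarrow> v p \<le> v (p + w)"
    and step: "\<And>p. v (p + (0, h)) - v p \<le> h"
  obtains k where "smooth k" "\<And>p. 0 \<le> k p" "\<And>p. k p \<le> 4 * M"
    "\<And>p. \<bar>partial_x k p\<bar> \<le> partial_y k p" "\<And>p. partial_y k p \<le> 1"
    "\<And>p. partial_y k p = (LINT q|lborel. (v (p + q + (0, h)) - v (p + q)) / h * \<rho> q)"
    "\<And>p. integrable lborel (\<lambda>q. (v (p + q + (0, h)) - v (p + q)) / h * \<rho> q)"
proof -
  define u where "u p = v (prod.swap p)" for p
  have sw: "prod.swap (p + q) = prod.swap p + prod.swap q" for p q :: "real \<times> real"
    by (simp add: prod_eq_iff)
  have swap_meas: "prod.swap \<in> borel \<rightarrow>\<^sub>M (borel :: (real \<times> real) measure)"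
    unfolding prod.swap_def by (intro borel_measurable_Pair borel_measurable_continuous_onI continuous_intros)
  have u: "u \<in> borel_measurable borel" "\<And>p. 0 \<le> u p" "\<And>p. u p \<le> M"
    "\<And>p w. \<bar>snd w\<bar> \<le> fst w \<Longrightarrow> u p \<le> u (p + w)" "\<And>p. u (p + (h, 0)) - u p \<le> h"
    unfolding u_def using measurable_compose[OF swap_meas v(1)] v(2,3) mono[of "prod.swap _"] step[of "prod.swap _"]
    by (simp_all add: sw)
  note g = mollify_x[OF u]
  define k where "k p = conv u \<kappa> (prod.swap p)" for p
  have vq: "(\<lambda>q. v (p + q)) \<in> borel_measurable borel" for p
    by (auto intro!: measurable_compose[OF _ v(1)])
  have iv: "integrable lborel (\<lambda>q. v (p + q) * \<rho> q)" for p
    using integrable_conv[OF test_\<rho> vq[of p], where K = M and p = 0] v(2,3) by simp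
  have i: "integrable lborel (\<lambda>q. (v (p + q + (0, h)) - v (p + q)) / h * \<rho> q)" for p
  proof -
    have "integrable lborel (\<lambda>q. (v (p + (0, h) + q) * \<rho> q - v (p + q) * \<rho> q) / h)"
      by (intro Bochner_Integration.integrable_diff integrable_divide_zero iv)
    also have "(\<lambda>q. (v (p + (0, h) + q) * \<rho> q - v (p + q) * \<rho> q) / h)
        = (\<lambda>q. (v (p + q + (0, h)) - v (p + q)) / h * \<rho> q)"
      by (simp add: fun_eq_iff algebra_simps diff_divide_distrib)
    finally show ?thesis .
  qed
  have e: "(LINT q|lborel. (u (prod.swap p + q + (h, 0)) - u (prod.swap p + q)) / h * \<rho> q)
      = (LINT q|lborel. (v (p + q + (0, h)) - v (p + q)) / h * \<rho> q)" for p
  proof -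
    have "(\<lambda>q. (u (prod.swap p + q + (h, 0)) - u (prod.swap p + q)) / h * \<rho> q)
      = (\<lambda>q. (\<lambda>q. (v (p + q + (0, h)) - v (p + q)) / h * \<rho> q) (prod.swap q))"
      unfolding u_def by (simp add: sw \<rho>_def mult.commute)
    then show ?thesis
      using lborel_swap[of "\<lambda>q. (v (p + q + (0, h)) - v (p + q)) / h * \<rho> q"]
        borel_measurable_integrable[OF i[of p]] by simp
  qed
  show ?thesis
  proof (rule that[of k])
    show "smooth k" unfolding k_def using partials_swap(1)[OF g(1)] .
    show "0 \<le> k p" "k p \<le> 4 * M" for p unfolding k_def using g(2,3) by auto
    have pk: "partial_x k p = partial_y (conv u \<kappa>) (prod.swap p)"
      "partial_y k p = partial_x (conv u \<kappa>) (prod.swap p)" for p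
      unfolding k_def using partials_swap(2,3)[OF g(1), of p] by auto
    show "\<bar>partial_x k p\<bar> \<le> partial_y k p" "partial_y k p \<le> 1" for p
      unfolding pk using g(4,5) by auto
    show "partial_y k p = (LINT q|lborel. (v (p + q + (0, h)) - v (p + q)) / h * \<rho> q)" for p
      unfolding pk by (rule trans[OF g(6) e])
  qed (rule i)
qed

section \<open>The dual certificate\<close>

lemma measurable_lattice_function:
  fixes U :: "int \<Rightarrow> int \<Rightarrow> real"
  shows "(\<lambda>p :: real \<times> real. h * U \<lfloor>(fst p + snd p) / h\<rfloor> \<lfloor>(fst p - snd p) / h\<rfloor>) \<in> borel_measurable borel"
proof -
  have fl: "(\<lambda>p :: real \<times> real. \<lfloor>(fst p + snd p) / h\<rfloor>) \<in> borel \<rightarrow>\<^sub>M count_space UNIV"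
    "(\<lambda>p :: real \<times> real. \<lfloor>(fst p - snd p) / h\<rfloor>) \<in> borel \<rightarrow>\<^sub>M count_space UNIV"
    unfolding borel_prod[symmetric] by measurable
  have "(\<lambda>p :: real \<times> real. U \<lfloor>(fst p + snd p) / h\<rfloor> \<lfloor>(fst p - snd p) / h\<rfloor>) \<in> borel_measurable borel"
    by (rule measurable_compose_countable[OF _ fl(1)], rule measurable_compose[OF fl(2)]) simp
  then show ?thesis by simp
qed

text \<open>The indices of the lattice square containing \<open>p\<close>. In the plane a cell is a
  square with diagonal \<open>h\<close>, turned by 45 degrees, so horizontal and vertical shifts by
  \<open>h\<close> are diagonal steps between cells.\<close>

definition cell :: "real \<Rightarrow> real \<times> real \<Rightarrow> int \<times> int" where
  "cell h p = (\<lfloor>(fst p + snd p) / h\<rfloor>, \<lfloor>(fst p - snd p) / h\<rfloor>)"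

definition cell_center :: "real \<Rightarrow> int \<times> int \<Rightarrow> real \<times> real" where
  "cell_center h c = (h * (fst c + snd c + 1) / 2, h * (fst c - snd c) / 2)"

lemma norm_prod_le:
  fixes p :: "real \<times> real"
  shows "norm p \<le> \<bar>fst p\<bar> + \<bar>snd p\<bar>" "\<bar>fst p\<bar> \<le> norm p" "\<bar>snd p\<bar> \<le> norm p"
  using norm_Pair_le[of "fst p" "snd p"] norm_fst_le[of "fst p" "snd p"] norm_snd_le[of "snd p" "fst p"]
  by simp_all

lemma dist_cell_center:
  assumes "h > 0"
  shows "dist p (cell_center h (cell h p)) \<le> h"
proof -
  define i j where "i = \<lfloor>(fst p + snd p) / h\<rfloor>" and "j = \<lfloor>(fst p - snd p) / h\<rfloor>"
  have "of_int i \<le> (fst p + snd p) / h" "(fst p + snd p) / h < of_int i + 1"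
    "of_int j \<le> (fst p - snd p) / h" "(fst p - snd p) / h < of_int j + 1"
    unfolding i_def j_def by linarith+
  then have b: "h * of_int i \<le> fst p + snd p" "fst p + snd p < h * of_int i + h"
    "h * of_int j \<le> fst p - snd p" "fst p - snd p < h * of_int j + h"
    using assms by (simp_all add: field_simps)
  have "cell h p = (i, j)" by (simp add: cell_def i_def j_def)
  then have c: "cell_center h (cell h p) = ((h * of_int i + h * of_int j + h) / 2, (h * of_int i - h * of_int j) / 2)"
    by (simp add: cell_center_def algebra_simps)
  have "\<bar>fst p - (h * of_int i + h * of_int j + h) / 2\<bar> + \<bar>snd p - (h * of_int i - h * of_int j) / 2\<bar> \<le> h"
    using b by (auto simp: abs_if field_simps)
  then show ?thesis
    using norm_prod_le(1)[of "p - cell_center h (cell h p)"] unfolding dist_norm c by simp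
qed

text \<open>Inside this square x + y and x - y deviate from their values at the center by at most
  \<open>h / 4\<close>, which is less than half the width of a cell.\<close>

lemma cell_of_center:
  assumes h: "h > 0" and p: "p \<in> cbox (cell_center h c - (h / 8, h / 8)) (cell_center h c + (h / 8, h / 8))"
  shows "cell h p = c"
proof -
  obtain i j where c: "c = (i, j)" by (cases c)
  obtain x y where xy: "p = (x, y)" by (cases p)
  have b: "h * (i + j + 1) / 2 - h / 8 \<le> x" "x \<le> h * (i + j + 1) / 2 + h / 8"
    "h * (i - j) / 2 - h / 8 \<le> y" "y \<le> h * (i - j) / 2 + h / 8"
    using p unfolding c xy cell_center_def by (auto simp: cbox_Pair_eq)
  have "\<lfloor>(x + y) / h\<rfloor> = i"
    using b h by (intro floor_unique) (simp_all add: field_simps)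
  moreover have "\<lfloor>(x - y) / h\<rfloor> = j"
    using b h by (intro floor_unique) (simp_all add: field_simps)
  ultimately show ?thesis by (simp add: c xy cell_def)
qed

lemma finite_cells_with_bounded_center:
  assumes "h > 0"
  shows "finite {c. norm (cell_center h c) < R}"
proof (rule finite_subset)
  define n :: int where "n = \<lceil>2 * R / h\<rceil> + 1"
  show "finite ({- n..n} \<times> {- n..n})" by simp
  show "{c. norm (cell_center h c) < R} \<subseteq> {- n..n} \<times> {- n..n}"
  proof
    fix c assume "c \<in> {c. norm (cell_center h c) < R}"
    obtain i j where c: "c = (i, j)" by (cases c)
    define X Y where "X = h * (i + j + 1) / 2" and "Y = h * (i - j) / 2"
    have "\<bar>X\<bar> < R" "\<bar>Y\<bar> < R"
      using norm_prod_le(2,3)[of "cell_center h c"] \<open>c \<in> _\<close>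
      by (auto simp: cell_center_def c X_def Y_def)
    then have "\<bar>X + Y\<bar> < 2 * R" "\<bar>X - Y\<bar> < 2 * R" by linarith+
    moreover have "X + Y = h * (i + 1 / 2)" "X - Y = h * (j + 1 / 2)"
      by (simp_all add: X_def Y_def field_simps)
    ultimately have "h * \<bar>i + 1 / 2\<bar> < 2 * R" "h * \<bar>j + 1 / 2\<bar> < 2 * R"
      using assms by (simp_all add: abs_mult)
    then have "\<bar>i + 1 / 2\<bar> < 2 * R / h" "\<bar>j + 1 / 2\<bar> < 2 * R / h"
      using assms by (simp_all only: pos_less_divide_eq mult.commute)
    then show "c \<in> {- n..n} \<times> {- n..n}" unfolding c n_def by (auto; linarith)
  qed
qed

text \<open>Each cell contains a square of side \<open>h / 4\<close> around its center, which is enough to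
  compare the weights with the integral.\<close>

lemma sum_cells_le_integral:
  assumes h: "h > 0" and F: "finite F" and int: "integrable lborel (\<lambda>p. (chi p)\<^sup>2)"
    and w: "\<And>c p. c \<in> F \<Longrightarrow> dist p (cell_center h c) \<le> h \<Longrightarrow> (w c)\<^sup>2 \<le> (chi p)\<^sup>2"
  shows "(\<Sum>c\<in>F. (w c)\<^sup>2) * (h\<^sup>2 / 16) \<le> (LINT p|lborel. (chi p)\<^sup>2)"
proof -
  define Q where "Q c = cbox (cell_center h c - (h / 8, h / 8)) (cell_center h c + (h / 8, h / 8))" for c
  have mQ: "measure lborel (Q c) = h\<^sup>2 / 16" for c
    using h by (simp add: Q_def cell_center_def content_Pair power2_eq_square)
  have iQ: "integrable lborel (\<lambda>p. (w c)\<^sup>2 * indicat_real (Q c) p)" for c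
  proof -
    have "emeasure lborel (Q c) < \<infinity>"
      unfolding Q_def by (rule emeasure_compact_finite[OF compact_cbox])
    then show ?thesis
      by (intro integrable_mult_right integrable_real_indicator) (simp_all add: Q_def)
  qed
  have "(\<Sum>c\<in>F. (w c)\<^sup>2) * (h\<^sup>2 / 16) = (\<Sum>c\<in>F. (LINT p|lborel. (w c)\<^sup>2 * indicat_real (Q c) p))"
    by (simp add: mQ sum_distrib_right)
  also have "\<dots> = (LINT p|lborel. (\<Sum>c\<in>F. (w c)\<^sup>2 * indicat_real (Q c) p))"
    by (rule Bochner_Integration.integral_sum[OF iQ, symmetric])
  also have "\<dots> \<le> (LINT p|lborel. (chi p)\<^sup>2)"
  proof (rule integral_mono[OF _ int])
    show "integrable lborel (\<lambda>p. \<Sum>c\<in>F. (w c)\<^sup>2 * indicat_real (Q c) p)"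
      by (intro Bochner_Integration.integrable_sum iQ)
    fix p
    \<comment> \<open>A point belongs to a single cell, so at most one summand on the right is
      nonzero; this replaces a proof that the squares are disjoint.\<close>
    have "(\<Sum>c\<in>F. (w c)\<^sup>2 * indicat_real (Q c) p) \<le> (\<Sum>c\<in>F. if cell h p = c then (chi p)\<^sup>2 else 0)"
    proof (rule sum_mono)
      fix c assume c: "c \<in> F"
      show "(w c)\<^sup>2 * indicat_real (Q c) p \<le> (if cell h p = c then (chi p)\<^sup>2 else 0)"
        using cell_of_center[OF h, of p c] w[OF c, of p] dist_cell_center[OF h, of p]
        by (auto simp: indicator_def Q_def)
    qed
    also have "\<dots> \<le> (chi p)\<^sup>2" using F by simp
    finally show "(\<Sum>c\<in>F. (w c)\<^sup>2 * indicat_real (Q c) p) \<le> (chi p)\<^sup>2" .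
  qed
  finally show ?thesis .
qed

text \<open>A shift by \<open>(h, 0)\<close> changes the cell index by (1, 1) and a shift by
  \<open>(0, h)\<close> changes it by (1, -1). The diagonal increments of the lattice potentials are
  thus exactly the difference quotients that the mollifiers turn into \<open>partial_x g\<close> and
  \<open>partial_y k\<close>.\<close>

lemma dual_certificate:
  fixes chi :: "real \<times> real \<Rightarrow> real"
  assumes cont: "continuous_on UNIV chi" and supp: "bounded {z. chi z \<noteq> 0}"
    and chi01: "\<And>z. 0 \<le> chi z" "\<And>z. chi z \<le> 1"
    and e: "\<epsilon> > 0" and M: "M > 0" and Q: "Q > 0" "(LINT z|lborel. (chi z)\<^sup>2) \<le> Q"
  obtains g k where "smooth g" "smooth k" "\<And>p. 0 \<le> g p" "\<And>p. g p \<le> 4 * M"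
    "\<And>p. 0 \<le> k p" "\<And>p. k p \<le> 128 * Q / M"
    "\<And>p. \<bar>partial_y g p\<bar> \<le> partial_x g p" "\<And>p. partial_x g p \<le> 1"
    "\<And>p. \<bar>partial_x k p\<bar> \<le> partial_y k p" "\<And>p. partial_y k p \<le> 1"
    "\<And>p. chi p - \<epsilon> \<le> partial_x g p + partial_y k p"
proof -
  obtain r where r: "r > 0" "\<And>x y. dist x y < r \<Longrightarrow> \<bar>chi x - chi y\<bar> < \<epsilon> / 2"
    using uniformly_continuous_of_compact_support[OF cont supp, of "\<epsilon> / 2"] e by auto
  obtain R where R: "\<And>x. R \<le> norm x \<Longrightarrow> chi x = 0" using bounded_support_cases[OF supp] by blast
  \<comment> \<open>A point \<open>p\<close> is compared with the center of the cell of
    \<open>p + q\<close>, where the kernel restricts \<open>q\<close> to norm below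
    \<open>2 * h\<close> and the center is within \<open>h\<close>: altogether less than
    \<open>r\<close>.\<close>
  define h where "h = r / 4"
  have h: "h > 0" using r by (simp add: h_def)
  \<comment> \<open>Lowering the sampled value by half the permitted error keeps the weight below
    \<open>chi\<close> on the whole cell, as the comparison with the integral requires, and it still
    exceeds \<open>chi - \<epsilon>\<close> within distance \<open>r\<close>.\<close>
  define w where "w c = max 0 (chi (cell_center h c) - \<epsilon> / 2)" for c
  define F where "F = {c. norm (cell_center h c) < R}"
  have F: "finite F" unfolding F_def by (rule finite_cells_with_bounded_center[OF h])
  have wF: "w c = 0" if "c \<notin> F" for c
    using R[of "cell_center h c"] that e by (simp add: w_def F_def)
  have w01: "0 \<le> w c" "w c \<le> 1" for c
    using chi01[of "cell_center h c"] e by (auto simp: w_def)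
  have w_le: "w c \<le> chi p" if "dist p (cell_center h c) \<le> h" for c p
    using r(2)[of p "cell_center h c"] that h chi01(1)[of p] by (auto simp: w_def h_def abs_if split: if_splits)
  have w_ge: "chi p - \<epsilon> \<le> w c" if "dist p (cell_center h c) < r" for c p
  proof -
    have "chi p - \<epsilon> \<le> chi (cell_center h c) - \<epsilon> / 2" using r(2)[OF that] by linarith
    then show ?thesis unfolding w_def by simp
  qed
  have "integrable lborel (\<lambda>p. chi p * chi p)"
    by (rule integrable_mult_bounded[of _ _ _ 1])
       (use integrable_compact_support[OF cont supp] chi01 in \<open>auto simp: abs_le_iff intro: order_trans[OF _ chi01(1)]\<close>)
  then have int2: "integrable lborel (\<lambda>p. (chi p)\<^sup>2)" by (simp add: power2_eq_square)
  have "(\<Sum>c\<in>F. (w c)\<^sup>2) * (h\<^sup>2 / 16) \<le> (LINT p|lborel. (chi p)\<^sup>2)"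
    by (rule sum_cells_le_integral[OF h F int2]) (intro power_mono w_le w01)
  then have sumw: "(\<Sum>c\<in>F. (w c)\<^sup>2) \<le> 16 * Q / h\<^sup>2"
    using Q(2) h by (simp add: field_simps)
  \<comment> \<open>With this choice the bounds \<open>2 * L\<close> and
    \<open>(16 * Q / h\<^sup>2) / L\<close> become \<open>M\<close> and \<open>32 * Q / M\<close>
    after multiplication by \<open>h\<close>; the mesh cancels. The factor 16 reflects the squares
    of area \<open>h\<^sup>2 / 16\<close> inside the cells.\<close>
  define L where "L = M / (2 * h)"
  have L: "L > 0" using M h by (simp add: L_def)
  obtain U V :: "int \<Rightarrow> int \<Rightarrow> real" where UV: "\<forall>i j. 0 \<le> U i j \<and> U i j \<le> 2 * L"
    "\<forall>i j. 0 \<le> V i j \<and> V i j \<le> (16 * Q / h\<^sup>2) / L"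
    "\<forall>i j i' j'. i \<le> i' \<longrightarrow> j \<le> j' \<longrightarrow> U i j \<le> U i' j'"
    "\<forall>i j i' j'. i \<le> i' \<longrightarrow> j' \<le> j \<longrightarrow> V i j \<le> V i' j'"
    "\<forall>i j. U (i + 1) (j + 1) - U i j \<le> 1" "\<forall>i j. V (i + 1) (j - 1) - V i j \<le> 1"
    "\<forall>i j. w (i, j) \<le> (U (i + 1) (j + 1) - U i j) + (V (i + 1) (j - 1) - V i j)"
    using lattice_potentials[of F w L "16 * Q / h\<^sup>2"] F w01 wF L Q(1) h sumw by auto
  define u where "u p = h * U \<lfloor>(fst p + snd p) / h\<rfloor> \<lfloor>(fst p - snd p) / h\<rfloor>" for p :: "real \<times> real"
  define v where "v p = h * V \<lfloor>(fst p + snd p) / h\<rfloor> \<lfloor>(fst p - snd p) / h\<rfloor>" for p :: "real \<times> real"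
  have u_meas: "u \<in> borel_measurable borel" and v_meas: "v \<in> borel_measurable borel"
    unfolding u_def[abs_def] v_def[abs_def] by (rule measurable_lattice_function)+
  have u0: "0 \<le> u p" and v0: "0 \<le> v p" for p
    using UV(1,2) h by (simp_all add: u_def v_def)
  have uM: "u p \<le> M" for p
  proof -
    have "u p \<le> h * (2 * L)" unfolding u_def using UV(1) h by (intro mult_left_mono) auto
    then show ?thesis using h by (simp add: L_def)
  qed
  have vM: "v p \<le> 32 * Q / M" for p
  proof -
    have "v p \<le> h * ((16 * Q / h\<^sup>2) / L)" unfolding v_def using UV(2) h by (intro mult_left_mono) auto
    also have "\<dots> = 32 * Q / M" using h M by (simp add: L_def field_simps power2_eq_square)
    finally show ?thesis .
  qed
  have u_mono: "u p \<le> u (p + d)" if "\<bar>snd d\<bar> \<le> fst d" for p d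
    unfolding u_def using that h UV(3)
    by (intro mult_left_mono UV(3)[rule_format] floor_mono divide_right_mono) auto
  have v_mono: "v p \<le> v (p + d)" if "\<bar>fst d\<bar> \<le> snd d" for p d
    unfolding v_def using that h UV(4)
    by (intro mult_left_mono UV(4)[rule_format] floor_mono divide_right_mono) auto
  have fl: "\<lfloor>(x + h) / h\<rfloor> = \<lfloor>x / h\<rfloor> + 1" "\<lfloor>(x - h) / h\<rfloor> = \<lfloor>x / h\<rfloor> - 1" for x
    using h by (simp_all add: add_divide_distrib diff_divide_distrib)
  have u_shift: "u (p + (h, 0)) = h * U (fst (cell h p) + 1) (snd (cell h p) + 1)" for p
    using fl(1)[of "fst p + snd p"] fl(1)[of "fst p - snd p"] by (simp add: u_def cell_def algebra_simps)
  have v_shift: "v (p + (0, h)) = h * V (fst (cell h p) + 1) (snd (cell h p) - 1)" for p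
  proof -
    have "fst p + (snd p + h) = (fst p + snd p) + h" "fst p - (snd p + h) = (fst p - snd p) - h"
      by simp_all
    then show ?thesis
      by (simp only: v_def cell_def fst_add snd_add fst_conv snd_conv add_0_right fl)
  qed
  have uv_cell: "u p = h * U (fst (cell h p)) (snd (cell h p))" "v p = h * V (fst (cell h p)) (snd (cell h p))" for p
    by (simp_all add: u_def v_def cell_def)
  have u_step: "u (p + (h, 0)) - u p \<le> h" for p
    unfolding u_shift uv_cell(1)[of p] using UV(5)[rule_format, of "fst (cell h p)" "snd (cell h p)"] h
    by (simp flip: right_diff_distrib)
  have v_step: "v (p + (0, h)) - v p \<le> h" for p
    unfolding v_shift uv_cell(2)[of p] using UV(6)[rule_format, of "fst (cell h p)" "snd (cell h p)"] h
    by (simp flip: right_diff_distrib)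
  have jump: "w (cell h p) \<le> (u (p + (h, 0)) - u p) / h + (v (p + (0, h)) - v p) / h" for p
    unfolding u_shift v_shift uv_cell(1)[of p] uv_cell(2)[of p] using UV(7)[rule_format, of "fst (cell h p)" "snd (cell h p)"] h
    by (simp add: diff_divide_distrib)
  obtain B b where Bb: "smooth B" "smooth b" "\<And>x. (B has_real_derivative b x) (at x)"
    "\<And>x. 0 \<le> b x" "\<And>x. x \<le> - h \<Longrightarrow> B x = 0" "\<And>x. h \<le> x \<Longrightarrow> B x = 1" "mono B"
    "\<And>x. h \<le> \<bar>x\<bar> \<Longrightarrow> b x = 0"
    using smooth_step[OF h] by blast
  interpret step_kernel B b h
    by unfold_locales (use h Bb in auto)
  note g = mollify_x[of u, OF u_meas u0 uM u_mono u_step]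
  obtain k where k: "smooth k" "\<And>p. 0 \<le> k p" "\<And>p. k p \<le> 4 * (32 * Q / M)"
    "\<And>p. \<bar>partial_x k p\<bar> \<le> partial_y k p" "\<And>p. partial_y k p \<le> 1"
    "\<And>p. partial_y k p = (LINT q|lborel. (v (p + q + (0, h)) - v (p + q)) / h * \<rho> q)"
    "\<And>p. integrable lborel (\<lambda>q. (v (p + q + (0, h)) - v (p + q)) / h * \<rho> q)"
    using mollify_y[of v, OF v_meas v0 vM v_mono v_step] by blast
  have low: "chi p - \<epsilon> \<le> partial_x (conv u \<kappa>) p + partial_y k p" for p
  proof -
    \<comment> \<open>As \<open>\<rho>\<close> has mass one, the constant is written as a
      \<rho>-average and compared with the averaged increments under the integral.\<close>
    have "chi p - \<epsilon> = (LINT q|lborel. (chi p - \<epsilon>) * \<rho> q)" by (simp add: integral_\<rho>)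
    also have "\<dots> \<le> (LINT q|lborel. (u (p + q + (h, 0)) - u (p + q)) / h * \<rho> q
        + (v (p + q + (0, h)) - v (p + q)) / h * \<rho> q)"
    proof (rule integral_mono)
      show "integrable lborel (\<lambda>q. (chi p - \<epsilon>) * \<rho> q)"
        by (intro integrable_mult_right integrable_test_function test_\<rho>)
      show "integrable lborel (\<lambda>q. (u (p + q + (h, 0)) - u (p + q)) / h * \<rho> q
          + (v (p + q + (0, h)) - v (p + q)) / h * \<rho> q)"
        by (intro Bochner_Integration.integrable_add g(7) k(7))
      fix q
      show "(chi p - \<epsilon>) * \<rho> q \<le> (u (p + q + (h, 0)) - u (p + q)) / h * \<rho> q
          + (v (p + q + (0, h)) - v (p + q)) / h * \<rho> q"
      proof (cases "2 * h \<le> norm q")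
        case False
        have "dist p (cell_center h (cell h (p + q))) \<le> dist p (p + q) + dist (p + q) (cell_center h (cell h (p + q)))"
          by (rule dist_triangle)
        also have "\<dots> < r" 
        proof -
          have "dist p (p + q) < 2 * h" using False by (simp add: dist_norm)
          then show ?thesis using dist_cell_center[OF h, of "p + q"] h h_def by linarith
        qed
        finally have "chi p - \<epsilon> \<le> w (cell h (p + q))" by (rule w_ge)
        also note jump[of "p + q"]
        finally have "(chi p - \<epsilon>) * \<rho> q \<le> ((u (p + q + (h, 0)) - u (p + q)) / h
            + (v (p + q + (0, h)) - v (p + q)) / h) * \<rho> q"
          by (rule mult_right_mono[OF _ \<rho>_nonneg])
        then show ?thesis by (simp only: distrib_right)
      qed (simp add: \<rho>_zero)
    qed
    also have "\<dots> = partial_x (conv u \<kappa>) p + partial_y k p"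
      by (rule trans[OF Bochner_Integration.integral_add[OF g(7) k(7)]
            arg_cong2[where f = plus, OF g(6)[symmetric] k(6)[symmetric]]])
    finally show ?thesis .
  qed
  have k_le: "k p \<le> 128 * Q / M" for p using k(3)[of p] by simp
  show ?thesis
    by (rule that[OF g(1) k(1) g(2) g(3) k(2) k_le g(4) g(5) k(4) k(5) low])
qed

section \<open>Testing a field against a certificate\<close>

text \<open>The field \<open>\<sigma>\<mu>\<close> has divergence \<open>d\<nu>\<close>. Both parts of the theorem are instances: \<open>\<mu>\<close> and \<open>\<nu>\<close> are
  Lebesgue measure for Sobolev fields, and variation measures, with \<open>\<sigma>\<close> and \<open>d\<close> polar, otherwise.\<close>

definition has_div_pairing ::
    "(real \<times> real) measure \<Rightarrow> (real \<times> real \<Rightarrow> real \<times> real) \<Rightarrow> (real \<times> real) measure \<Rightarrow>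
      (real \<times> real \<Rightarrow> real) \<Rightarrow> bool" where
  "has_div_pairing \<mu> \<sigma> \<nu> d \<longleftrightarrow>
     (\<forall>f :: real \<times> real \<Rightarrow> real. f \<in> borel_measurable borel \<longrightarrow>
        f \<in> borel_measurable \<mu> \<and> f \<in> borel_measurable \<nu>) \<and>
     integrable \<mu> (\<lambda>z. fst (\<sigma> z)) \<and> integrable \<mu> (\<lambda>z. snd (\<sigma> z)) \<and> integrable \<nu> d \<and>
     (\<forall>\<phi>. test_function \<phi> \<longrightarrow>
        (LINT z|\<mu>. fst (\<sigma> z) * partial_x \<phi> z + snd (\<sigma> z) * partial_y \<phi> z)
          = - (LINT z|\<nu>. d z * \<phi> z))"

text \<open>The cutoff is dilated until every fixed point is mapped close to the origin; the value
  there and continuity are then all that the limit sees.\<close>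

lemma test_cutoff:
  obtains \<theta> :: "real \<times> real \<Rightarrow> real" where "test_function \<theta>" "\<theta> 0 = 1"
proof -
  obtain B b :: "real \<Rightarrow> real" where "smooth B" "smooth b" "\<And>x. (B has_real_derivative b x) (at x)"
    "\<And>x. 0 \<le> b x" "\<And>x. x \<le> - 1 \<Longrightarrow> B x = 0" "\<And>x. 1 \<le> x \<Longrightarrow> B x = 1" "mono B"
    "\<And>x. 1 \<le> \<bar>x\<bar> \<Longrightarrow> b x = 0"
    using smooth_step[OF zero_less_one] by blast
  note B = this(1,5,6)
  define t where "t x = B (1 * x + 2) * B (- 1 * x + 2)" for x
  have "smooth t" unfolding t_def
    by (intro smooth_mult smooth_affine[OF bounded_linear_mult_right] B)
  moreover have "t x = 0" if "3 \<le> \<bar>x\<bar>" for x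
    using that B(2)[of "x + 2"] B(2)[of "- x + 2"] by (auto simp: t_def abs_if split: if_splits)
  ultimately have "test_function (\<lambda>z. t (fst z) * t (snd z))"
    using test_function_prod[of t t 3] by blast
  moreover have "t 0 = 1" using B(3)[of 2] by (simp add: t_def)
  ultimately show ?thesis using that[of "\<lambda>z. t (fst z) * t (snd z)"] by simp
qed

lemma test_function_scale:
  fixes \<theta> :: "real \<times> real \<Rightarrow> real"
  assumes "test_function \<theta>" "c > 0"
  shows "test_function (\<lambda>z. \<theta> (c *\<^sub>R z))"
    "partial_x (\<lambda>z. \<theta> (c *\<^sub>R z)) z = c * partial_x \<theta> (c *\<^sub>R z)"
    "partial_y (\<lambda>z. \<theta> (c *\<^sub>R z)) z = c * partial_y \<theta> (c *\<^sub>R z)"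
proof -
  have sm: "smooth \<theta>" using assms(1) unfolding test_function_iff by blast
  have L: "bounded_linear (\<lambda>z :: real \<times> real. c *\<^sub>R z)" by (rule bounded_linear_scaleR_right)
  obtain R where R: "\<And>x. R \<le> norm x \<Longrightarrow> \<theta> x = 0"
    using bounded_support_cases[of \<theta>] assms(1) unfolding test_function_iff by blast
  have "norm z \<le> R / c" if "\<theta> (c *\<^sub>R z) \<noteq> 0" for z
  proof -
    have "\<not> R \<le> norm (c *\<^sub>R z)" using R that by blast
    then show ?thesis using assms(2) by (simp add: field_simps)
  qed
  then have "bounded {z. \<theta> (c *\<^sub>R z) \<noteq> 0}" by (intro boundedI[of _ "R / c"]) blast
  then show "test_function (\<lambda>z. \<theta> (c *\<^sub>R z))"
    unfolding test_function_iff using smooth_affine[OF L sm, of 0] by simp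
  have "((\<lambda>z. \<theta> (c *\<^sub>R z)) has_derivative (\<lambda>v. fst (c *\<^sub>R v) * partial_x \<theta> (c *\<^sub>R z)
      + snd (c *\<^sub>R v) * partial_y \<theta> (c *\<^sub>R z))) (at z)"
    by (rule has_derivative_compose[OF bounded_linear_imp_has_derivative[OF L] has_derivative_partials[OF sm]])
  from partials_eqI[OF this] show "partial_x (\<lambda>z. \<theta> (c *\<^sub>R z)) z = c * partial_x \<theta> (c *\<^sub>R z)"
    "partial_y (\<lambda>z. \<theta> (c *\<^sub>R z)) z = c * partial_y \<theta> (c *\<^sub>R z)" by simp_all
qed

lemma test_function_bounded:
  fixes \<phi> :: "'a::euclidean_space \<Rightarrow> real"
  assumes "test_function \<phi>"
  obtains K where "K > 0" "\<And>x. \<bar>\<phi> x\<bar> \<le> K"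
  using bounded_of_compact_support[of \<phi>] assms smooth_continuous_on unfolding test_function_iff by blast

lemma partials_mult:
  assumes "smooth f" "smooth g"
  shows "partial_x (\<lambda>z. f z * g z) z = f z * partial_x g z + partial_x f z * g z"
    "partial_y (\<lambda>z. f z * g z) z = f z * partial_y g z + partial_y f z * g z"
  using partials_eqI[OF has_derivative_mult[OF has_derivative_partials[OF assms(1)]
      has_derivative_partials[OF assms(2)]], of z] by simp_all

text \<open>The certificates do not vanish at infinity. Multiplied by the dilated cutoffs
  \<open>\<theta> (c n *\<^sub>R z)\<close> they become test functions; derivatives falling on the
  cutoff carry a factor \<open>c n\<close> and disappear, while integrability of the field and of
  its divergence allows dominated convergence in the remaining terms.\<close>

lemma has_div_pairing_smooth:
  assumes pair: "has_div_pairing \<mu> \<sigma> \<nu> d" and g: "smooth g" "\<And>z. \<bar>g z\<bar> \<le> M"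
    and gx: "\<And>z. \<bar>partial_x g z\<bar> \<le> 1" and gy: "\<And>z. \<bar>partial_y g z\<bar> \<le> 1"
  shows "(LINT z|\<mu>. fst (\<sigma> z) * partial_x g z + snd (\<sigma> z) * partial_y g z) = - (LINT z|\<nu>. d z * g z)"
proof -
  have meas: "f \<in> borel_measurable \<mu>" "f \<in> borel_measurable \<nu>"
    if "f \<in> borel_measurable borel" for f :: "real \<times> real \<Rightarrow> real"
    using pair that unfolding has_div_pairing_def by blast+
  have smeas: "f \<in> borel_measurable \<mu>" "f \<in> borel_measurable \<nu>"
    if "smooth f" for f :: "real \<times> real \<Rightarrow> real"
    using meas smooth_borel_measurable[OF that] by blast+
  have ix: "integrable \<mu> (\<lambda>z. fst (\<sigma> z))" and iy: "integrable \<mu> (\<lambda>z. snd (\<sigma> z))" and id: "integrable \<nu> d"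
    and div: "\<And>\<phi>. test_function \<phi> \<Longrightarrow> (LINT z|\<mu>. fst (\<sigma> z) * partial_x \<phi> z + snd (\<sigma> z) * partial_y \<phi> z)
          = - (LINT z|\<nu>. d z * \<phi> z)"
    using pair unfolding has_div_pairing_def by blast+
  obtain \<theta> :: "real \<times> real \<Rightarrow> real" where \<theta>: "test_function \<theta>" "\<theta> 0 = 1" by (rule test_cutoff)
  have sm\<theta>: "smooth \<theta>" using \<theta> unfolding test_function_iff by blast
  obtain K where K: "K > 0" "\<And>z. \<bar>\<theta> z\<bar> \<le> K" using test_function_bounded[OF \<theta>(1)] by blast
  obtain Kx where Kx: "Kx > 0" "\<And>z. \<bar>partial_x \<theta> z\<bar> \<le> Kx"
    using test_function_bounded[OF test_function_partials(1)[OF \<theta>(1)]] by blast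
  obtain Ky where Ky: "Ky > 0" "\<And>z. \<bar>partial_y \<theta> z\<bar> \<le> Ky"
    using test_function_bounded[OF test_function_partials(2)[OF \<theta>(1)]] by blast
  have M: "0 \<le> M" using g(2)[of 0] by linarith
  define c where "c n = inverse (real (Suc n))" for n
  have c: "0 < c n" "c n \<le> 1" for n by (simp_all add: c_def field_simps)
  have clim: "c \<longlonglongrightarrow> 0" unfolding c_def by (rule LIMSEQ_inverse_real_of_nat)
  define \<theta>' where "\<theta>' n z = \<theta> (c n *\<^sub>R z)" for n z
  have t': "test_function (\<theta>' n)" "smooth (\<theta>' n)" for n
    using test_function_scale(1)[OF \<theta>(1) c(1)] unfolding \<theta>'_def test_function_iff by auto
  have p': "partial_x (\<theta>' n) z = c n * partial_x \<theta> (c n *\<^sub>R z)"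
    "partial_y (\<theta>' n) z = c n * partial_y \<theta> (c n *\<^sub>R z)" for n z
    using test_function_scale(2,3)[OF \<theta>(1) c(1)] unfolding \<theta>'_def by auto
  define \<phi> where "\<phi> n z = g z * \<theta>' n z" for n z
  have t\<phi>: "test_function (\<phi> n)" for n
  proof -
    have "bounded {z. \<theta>' n z \<noteq> 0}" using t'(1)[of n] unfolding test_function_iff by blast
    then have "bounded {z. \<phi> n z \<noteq> 0}" by (rule bounded_subset) (auto simp: \<phi>_def)
    moreover have "smooth (\<phi> n)" unfolding \<phi>_def by (rule smooth_mult[OF g(1) t'(2)])
    ultimately show ?thesis unfolding test_function_iff by blast
  qed
  have px: "partial_x (\<phi> n) z = g z * (c n * partial_x \<theta> (c n *\<^sub>R z)) + partial_x g z * \<theta>' n z"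
    and py: "partial_y (\<phi> n) z = g z * (c n * partial_y \<theta> (c n *\<^sub>R z)) + partial_y g z * \<theta>' n z" for n z
    unfolding \<phi>_def partials_mult[OF g(1) t'(2)] p' by auto
  have \<theta>lim: "(\<lambda>n. \<theta>' n z) \<longlonglongrightarrow> 1" for z
  proof -
    have "(\<lambda>n. c n *\<^sub>R z) \<longlonglongrightarrow> 0 *\<^sub>R z" by (intro tendsto_intros clim)
    moreover have "isCont \<theta> 0"
      using smooth_differentiable[OF sm\<theta>] differentiable_imp_continuous_within by blast
    ultimately have "(\<lambda>n. \<theta> (c n *\<^sub>R z)) \<longlonglongrightarrow> \<theta> 0"
      using isCont_tendsto_compose[of 0 \<theta>] by simp
    then show ?thesis by (simp add: \<theta>'_def \<theta>)
  qed
  \<comment> \<open>This covers the terms in which a derivative hits the cutoff: \<open>f\<close>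
    will be a partial derivative of \<open>\<theta>\<close>.\<close>
  have lim0: "(\<lambda>n. g z * (c n * f (c n *\<^sub>R z))) \<longlonglongrightarrow> 0" if "\<And>z. \<bar>f z\<bar> \<le> C" for f :: "real \<times> real \<Rightarrow> real" and C z
  proof (rule Lim_null_comparison)
    show "\<forall>\<^sub>F n in sequentially. norm (g z * (c n * f (c n *\<^sub>R z))) \<le> \<bar>g z\<bar> * (c n * C)"
      using c(1) that by (intro always_eventually allI) (simp add: abs_mult mult_left_mono abs_of_pos)
    have "(\<lambda>n. \<bar>g z\<bar> * (c n * C)) \<longlonglongrightarrow> \<bar>g z\<bar> * (0 * C)" by (intro tendsto_intros clim)
    then show "(\<lambda>n. \<bar>g z\<bar> * (c n * C)) \<longlonglongrightarrow> 0" by simp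
  qed
  have pxlim: "(\<lambda>n. partial_x (\<phi> n) z) \<longlonglongrightarrow> partial_x g z"
    and pylim: "(\<lambda>n. partial_y (\<phi> n) z) \<longlonglongrightarrow> partial_y g z"
    and \<phi>lim: "(\<lambda>n. \<phi> n z) \<longlonglongrightarrow> g z" for z
    using tendsto_add[OF lim0[OF Kx(2), of z] tendsto_mult_left[OF \<theta>lim[of z], of "partial_x g z"]]
      tendsto_add[OF lim0[OF Ky(2), of z] tendsto_mult_left[OF \<theta>lim[of z], of "partial_y g z"]]
      tendsto_mult_left[OF \<theta>lim[of z], of "g z"]
    by (simp_all add: px py \<phi>_def)
  have bd: "\<bar>g z * (c n * a) + b * \<theta>' n z\<bar> \<le> M * A + K" if "\<bar>a\<bar> \<le> A" "\<bar>b\<bar> \<le> 1" for a b A n z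
  proof -
    have "\<bar>g z * (c n * a)\<bar> \<le> M * (1 * A)"
      unfolding abs_mult using g(2)[of z] c[of n] that M by (intro mult_mono) auto
    moreover have "\<bar>b * \<theta>' n z\<bar> \<le> 1 * K"
      unfolding abs_mult \<theta>'_def using K that by (intro mult_mono) auto
    ultimately show ?thesis by simp
  qed
  have bx: "\<bar>partial_x (\<phi> n) z\<bar> \<le> M * Kx + K" and by': "\<bar>partial_y (\<phi> n) z\<bar> \<le> M * Ky + K" for n z
    unfolding px py by (intro bd Kx Ky gx gy)+
  have L: "(\<lambda>n. LINT z|\<mu>. fst (\<sigma> z) * partial_x (\<phi> n) z + snd (\<sigma> z) * partial_y (\<phi> n) z)
      \<longlonglongrightarrow> (LINT z|\<mu>. fst (\<sigma> z) * partial_x g z + snd (\<sigma> z) * partial_y g z)"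
  \<comment> \<open>The gradients of the truncated functions are bounded uniformly in
    \<open>n\<close>, so multiples of the components of the field form the majorant.\<close>
  proof (rule integral_dominated_convergence[where w = "\<lambda>z. \<bar>fst (\<sigma> z)\<bar> * (M * Kx + K) + \<bar>snd (\<sigma> z)\<bar> * (M * Ky + K)"])
    have [measurable]: "(\<lambda>z. fst (\<sigma> z)) \<in> borel_measurable \<mu>" "(\<lambda>z. snd (\<sigma> z)) \<in> borel_measurable \<mu>"
      using ix iy by auto
    have [measurable]: "partial_x g \<in> borel_measurable \<mu>" "partial_y g \<in> borel_measurable \<mu>"
      using smeas smooth_partial g(1) by blast+
    have [measurable]: "partial_x (\<phi> n) \<in> borel_measurable \<mu>" "partial_y (\<phi> n) \<in> borel_measurable \<mu>" for n
      using smeas test_function_partials[OF t\<phi>[of n]] unfolding test_function_iff by blast+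
    show "(\<lambda>z. fst (\<sigma> z) * partial_x g z + snd (\<sigma> z) * partial_y g z) \<in> borel_measurable \<mu>"
      "(\<lambda>z. fst (\<sigma> z) * partial_x (\<phi> n) z + snd (\<sigma> z) * partial_y (\<phi> n) z) \<in> borel_measurable \<mu>" for n
      by measurable
    show "integrable \<mu> (\<lambda>z. \<bar>fst (\<sigma> z)\<bar> * (M * Kx + K) + \<bar>snd (\<sigma> z)\<bar> * (M * Ky + K))"
      using ix iy by auto
    show "AE z in \<mu>. (\<lambda>n. fst (\<sigma> z) * partial_x (\<phi> n) z + snd (\<sigma> z) * partial_y (\<phi> n) z)
        \<longlonglongrightarrow> fst (\<sigma> z) * partial_x g z + snd (\<sigma> z) * partial_y g z"
      by (intro AE_I2 tendsto_intros pxlim pylim)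
    show "AE z in \<mu>. norm (fst (\<sigma> z) * partial_x (\<phi> n) z + snd (\<sigma> z) * partial_y (\<phi> n) z)
        \<le> \<bar>fst (\<sigma> z)\<bar> * (M * Kx + K) + \<bar>snd (\<sigma> z)\<bar> * (M * Ky + K)" for n
    proof (rule AE_I2)
      fix z
      have "norm (fst (\<sigma> z) * partial_x (\<phi> n) z + snd (\<sigma> z) * partial_y (\<phi> n) z)
          \<le> \<bar>fst (\<sigma> z)\<bar> * \<bar>partial_x (\<phi> n) z\<bar> + \<bar>snd (\<sigma> z)\<bar> * \<bar>partial_y (\<phi> n) z\<bar>"
        using abs_triangle_ineq by (simp flip: abs_mult)
      also have "\<dots> \<le> \<bar>fst (\<sigma> z)\<bar> * (M * Kx + K) + \<bar>snd (\<sigma> z)\<bar> * (M * Ky + K)"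
        by (intro add_mono mult_left_mono bx by') auto
      finally show "norm (fst (\<sigma> z) * partial_x (\<phi> n) z + snd (\<sigma> z) * partial_y (\<phi> n) z)
          \<le> \<bar>fst (\<sigma> z)\<bar> * (M * Kx + K) + \<bar>snd (\<sigma> z)\<bar> * (M * Ky + K)" .
    qed
  qed
  have "(\<lambda>n. LINT z|\<nu>. d z * \<phi> n z) \<longlonglongrightarrow> (LINT z|\<nu>. d z * g z)"
  proof (rule integral_dominated_convergence[where w = "\<lambda>z. \<bar>d z\<bar> * (M * K)"])
    have [measurable]: "d \<in> borel_measurable \<nu>" "g \<in> borel_measurable \<nu>" "\<phi> n \<in> borel_measurable \<nu>" for n
      using id smeas g(1) t\<phi>[of n] unfolding test_function_iff by auto
    show "(\<lambda>z. d z * g z) \<in> borel_measurable \<nu>" "(\<lambda>z. d z * \<phi> n z) \<in> borel_measurable \<nu>" for n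
      by measurable
    show "integrable \<nu> (\<lambda>z. \<bar>d z\<bar> * (M * K))" using id by auto
    show "AE z in \<nu>. (\<lambda>n. d z * \<phi> n z) \<longlonglongrightarrow> d z * g z"
      by (intro AE_I2 tendsto_intros \<phi>lim)
    show "AE z in \<nu>. norm (d z * \<phi> n z) \<le> \<bar>d z\<bar> * (M * K)" for n
    proof (rule AE_I2)
      fix z
      have "\<bar>\<phi> n z\<bar> \<le> M * K"
        unfolding \<phi>_def abs_mult \<theta>'_def using g(2)[of z] K M by (intro mult_mono) auto
      then show "norm (d z * \<phi> n z) \<le> \<bar>d z\<bar> * (M * K)"
        by (simp add: abs_mult mult_left_mono)
    qed
  qed
  then have R: "(\<lambda>n. - (LINT z|\<nu>. d z * \<phi> n z)) \<longlonglongrightarrow> - (LINT z|\<nu>. d z * g z)"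
    by (rule tendsto_minus)
  show ?thesis
    using L R unfolding div[OF t\<phi>] by (rule LIMSEQ_unique)
qed

text \<open>For s = (a, b), the bound on \<open>q\<close> gives a p + b q \<ge> (a - |b|) p. If a
  \<ge> |b| the right side is \<open>p * xP s\<close>. Otherwise a - |b| is negative and p \<le> 1
  makes the right side at least a - |b|, which is \<open>- xN s\<close>.\<close>

lemma cone_inequality:
  fixes s :: "real \<times> real"
  assumes "\<bar>q\<bar> \<le> p" "p \<le> 1"
  shows "p * xP s - xN s \<le> fst s * p + snd s * q" "p * yP s - yN s \<le> fst s * q + snd s * p"
proof -
  have *: "p * max (a - \<bar>b\<bar>) 0 - max (- (a - \<bar>b\<bar>)) 0 \<le> a * p + b * q" for a b :: real
  proof -
    have bq: "- (\<bar>b\<bar> * p) \<le> b * q"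
    proof -
      have "\<bar>b * q\<bar> \<le> \<bar>b\<bar> * p" unfolding abs_mult using assms by (intro mult_left_mono) auto
      then show ?thesis by linarith
    qed
    show ?thesis
    proof (cases "\<bar>b\<bar> \<le> a")
      case True
      then show ?thesis using bq by (simp add: algebra_simps)
    next
      case False
      then have "(\<bar>b\<bar> - a) * p \<le> (\<bar>b\<bar> - a) * 1" using assms by (intro mult_left_mono) auto
      then show ?thesis using bq False by (simp add: algebra_simps)
    qed
  qed
  show "p * xP s - xN s \<le> fst s * p + snd s * q" "p * yP s - yN s \<le> fst s * q + snd s * p"
    using *[of "fst s" "snd s"] *[of "snd s" "fst s"] unfolding xP_def xN_def yP_def yN_def by auto
qed

lemma has_div_pairing_integrable:
  assumes pair: "has_div_pairing \<mu> \<sigma> \<nu> d"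
  shows "integrable \<mu> (\<lambda>z. xP (\<sigma> z))" "integrable \<mu> (\<lambda>z. xN (\<sigma> z))"
    "integrable \<mu> (\<lambda>z. yP (\<sigma> z))" "integrable \<mu> (\<lambda>z. yN (\<sigma> z))"
proof -
  have i: "integrable \<mu> (\<lambda>z. fst (\<sigma> z))" "integrable \<mu> (\<lambda>z. snd (\<sigma> z))"
    using pair unfolding has_div_pairing_def by blast+
  have "integrable \<mu> (\<lambda>z. max (a z - \<bar>b z\<bar>) 0)" "integrable \<mu> (\<lambda>z. max (- (a z - \<bar>b z\<bar>)) 0)"
    if "integrable \<mu> a" "integrable \<mu> b" for a b :: "real \<times> real \<Rightarrow> real"
    by (intro integrable_max integrable_minus Bochner_Integration.integrable_diff integrable_abs
        integrable_zero that)+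
  note this[OF i] this[OF i(2,1)]
  then show "integrable \<mu> (\<lambda>z. xP (\<sigma> z))" "integrable \<mu> (\<lambda>z. xN (\<sigma> z))"
    "integrable \<mu> (\<lambda>z. yP (\<sigma> z))" "integrable \<mu> (\<lambda>z. yN (\<sigma> z))"
    unfolding xP_def xN_def yP_def yN_def
    by auto
qed

text \<open>The cone inequality is integrated, and the divergence identity turns its right side into
  the integral of \<open>- (d z * g z)\<close>. Only the range 0 to \<open>M\<close> of
  \<open>g\<close> then matters.\<close>

lemma flux_bounds:
  assumes pair: "has_div_pairing \<mu> \<sigma> \<nu> d" and g: "smooth g" "\<And>z. 0 \<le> g z" "\<And>z. g z \<le> M"
  shows "(\<And>z. \<bar>partial_y g z\<bar> \<le> partial_x g z) \<Longrightarrow> (\<And>z. partial_x g z \<le> 1) \<Longrightarrow>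
      (LINT z|\<mu>. partial_x g z * xP (\<sigma> z)) \<le> (LINT z|\<mu>. xN (\<sigma> z)) + M * (LINT z|\<nu>. \<bar>d z\<bar>)"
    and "(\<And>z. \<bar>partial_x g z\<bar> \<le> partial_y g z) \<Longrightarrow> (\<And>z. partial_y g z \<le> 1) \<Longrightarrow>
      (LINT z|\<mu>. partial_y g z * yP (\<sigma> z)) \<le> (LINT z|\<mu>. yN (\<sigma> z)) + M * (LINT z|\<nu>. \<bar>d z\<bar>)"
proof -
  have ix: "integrable \<mu> (\<lambda>z. fst (\<sigma> z))" and iy: "integrable \<mu> (\<lambda>z. snd (\<sigma> z))" and id: "integrable \<nu> d"
    and meas: "\<And>f :: real \<times> real \<Rightarrow> real. f \<in> borel_measurable borel \<Longrightarrow> f \<in> borel_measurable \<mu> \<and> f \<in> borel_measurable \<nu>"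
    using pair unfolding has_div_pairing_def by blast+
  note iP = has_div_pairing_integrable[OF pair]
  have gM: "\<bar>g z\<bar> \<le> M" for z using g(2,3)[of z] by simp
  have D: "- (LINT z|\<nu>. d z * g z) \<le> M * (LINT z|\<nu>. \<bar>d z\<bar>)"
  proof -
    have idg: "integrable \<nu> (\<lambda>z. g z * d z)"
      using meas[OF smooth_borel_measurable[OF g(1)]] by (intro integrable_mult_bounded[OF id _ gM]) auto
    have "- (LINT z|\<nu>. d z * g z) = (LINT z|\<nu>. - (g z * d z))" by (simp add: mult.commute)
    also have "\<dots> \<le> (LINT z|\<nu>. M * \<bar>d z\<bar>)"
    proof (rule integral_mono)
      show "- (g z * d z) \<le> M * \<bar>d z\<bar>" for z
      proof -
        have "\<bar>g z * d z\<bar> \<le> M * \<bar>d z\<bar>" unfolding abs_mult using gM by (intro mult_right_mono) auto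
        then show ?thesis by linarith
      qed
    qed (use idg id in auto)
    finally show ?thesis by simp
  qed
  have pm: "partial_x g \<in> borel_measurable \<mu>" "partial_y g \<in> borel_measurable \<mu>"
    using meas smooth_borel_measurable smooth_partial[OF g(1)] by blast+
  have main: "(LINT z|\<mu>. f z * P z) \<le> (LINT z|\<mu>. N z) + M * (LINT z|\<nu>. \<bar>d z\<bar>)"
    if f: "f \<in> borel_measurable \<mu>" "\<And>z. \<bar>f z\<bar> \<le> 1" and iP: "integrable \<mu> P" and iN: "integrable \<mu> N"
      and b: "\<And>z. \<bar>partial_x g z\<bar> \<le> 1" "\<And>z. \<bar>partial_y g z\<bar> \<le> 1"
      and le: "\<And>z. f z * P z - N z \<le> fst (\<sigma> z) * partial_x g z + snd (\<sigma> z) * partial_y g z"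
    for f P N :: "real \<times> real \<Rightarrow> real"
  proof -
    have i1: "integrable \<mu> (\<lambda>z. f z * P z)" by (rule integrable_mult_bounded[OF iP f])
    have i2: "integrable \<mu> (\<lambda>z. fst (\<sigma> z) * partial_x g z + snd (\<sigma> z) * partial_y g z)"
      using integrable_mult_bounded[OF ix pm(1) b(1)] integrable_mult_bounded[OF iy pm(2) b(2)]
      by (auto simp: mult.commute)
    have "(LINT z|\<mu>. f z * P z) - (LINT z|\<mu>. N z) = (LINT z|\<mu>. f z * P z - N z)"
      by (rule Bochner_Integration.integral_diff[OF i1 iN, symmetric])
    also have "\<dots> \<le> (LINT z|\<mu>. fst (\<sigma> z) * partial_x g z + snd (\<sigma> z) * partial_y g z)"
      by (intro integral_mono Bochner_Integration.integrable_diff i1 iN i2 le)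
    also have "\<dots> = - (LINT z|\<nu>. d z * g z)"
      by (rule has_div_pairing_smooth[OF pair g(1) gM b])
    finally show ?thesis using D by linarith
  qed
  show "(LINT z|\<mu>. partial_x g z * xP (\<sigma> z)) \<le> (LINT z|\<mu>. xN (\<sigma> z)) + M * (LINT z|\<nu>. \<bar>d z\<bar>)"
    if "\<And>z. \<bar>partial_y g z\<bar> \<le> partial_x g z" "\<And>z. partial_x g z \<le> 1"
  proof (rule main[OF pm(1) _ iP(1,2)])
    show "\<bar>partial_x g z\<bar> \<le> 1" "\<bar>partial_x g z\<bar> \<le> 1" "\<bar>partial_y g z\<bar> \<le> 1" for z
      using that[of z] by linarith+
    show "partial_x g z * xP (\<sigma> z) - xN (\<sigma> z) \<le> fst (\<sigma> z) * partial_x g z + snd (\<sigma> z) * partial_y g z" for z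
      by (rule cone_inequality(1)[OF that])
  qed
  show "(LINT z|\<mu>. partial_y g z * yP (\<sigma> z)) \<le> (LINT z|\<mu>. yN (\<sigma> z)) + M * (LINT z|\<nu>. \<bar>d z\<bar>)"
    if "\<And>z. \<bar>partial_x g z\<bar> \<le> partial_y g z" "\<And>z. partial_y g z \<le> 1"
  proof (rule main[OF pm(2) _ iP(3,4)])
    show "\<bar>partial_y g z\<bar> \<le> 1" "\<bar>partial_x g z\<bar> \<le> 1" "\<bar>partial_y g z\<bar> \<le> 1" for z
      using that[of z] by linarith+
    show "partial_y g z * yP (\<sigma> z) - yN (\<sigma> z) \<le> fst (\<sigma> z) * partial_x g z + snd (\<sigma> z) * partial_y g z" for z
      by (rule cone_inequality(2)[OF that])
  qed
qed

section \<open>Continuous approximation of the weight\<close>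

text \<open>Regularity encloses \<open>A\<close> between a compact \<open>K\<close> and an open
  \<open>U\<close> with \<open>U - K\<close> of small measure. A Urysohn function for this pair
  differs from the indicator by at most 1, and only on \<open>U - K\<close>.\<close>

lemma indicator_continuous_approx:
  fixes \<mu> :: "'a::euclidean_space measure"
  assumes [simp]: "sets \<mu> = sets borel" and fin: "finite_measure \<mu>" and A: "A \<in> sets borel" and e: "e > 0"
  obtains g where "continuous_on UNIV g" "\<And>x. 0 \<le> g x" "\<And>x. g x \<le> (1 :: real)"
    "(LINT x|\<mu>. \<bar>indicat_real A x - g x\<bar>) < e"
proof -
  interpret finite_measure \<mu> by (rule fin)
  have sp: "space \<mu> = UNIV" using sets_eq_imp_space_eq[OF assms(1)] by simp
  have nt: "emeasure \<mu> (space \<mu>) \<noteq> \<infinity>" by simp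
  have lt: "emeasure \<mu> A < emeasure \<mu> A + ennreal (e / 3)"
    using e by (simp add: emeasure_eq_measure ennreal_less_iff flip: ennreal_plus)
  obtain U where U: "A \<subseteq> U" "open U" "emeasure \<mu> U < emeasure \<mu> A + ennreal (e / 3)"
    using lt unfolding outer_regular[OF assms(1) nt A] Inf_less_iff by auto
  obtain K where K: "K \<subseteq> A" "compact K" "measure \<mu> A - e / 3 \<le> measure \<mu> K"
  \<comment> \<open>In the first case the target \<open>measure \<mu> A - e / 3\<close> is not
    positive and would be truncated by \<open>ennreal\<close>; the empty set serves
    directly.\<close>
  proof (cases "measure \<mu> A \<le> e / 3")
    case True
    then show ?thesis using that[of "{}"] by simp
  next
    case False
    then have "ennreal (measure \<mu> A - e / 3) < emeasure \<mu> A"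
      using e by (simp add: emeasure_eq_measure ennreal_less_iff)
    then have "ennreal (measure \<mu> A - e / 3) < Sup (emeasure \<mu> ` {K. K \<subseteq> A \<and> compact K})"
      using inner_regular[OF assms(1) nt A] by simp
    then obtain K where "K \<subseteq> A" "compact K" "ennreal (measure \<mu> A - e / 3) < emeasure \<mu> K"
      unfolding less_Sup_iff by blast
    then show ?thesis
      using that[of K] False by (simp add: emeasure_eq_measure ennreal_less_iff)
  qed
  have UK_sets [simp]: "U \<in> sets borel" "K \<in> sets borel"
    using U(2) borel_compact[OF K(2)] by simp_all
  have "measure \<mu> U < measure \<mu> A + e / 3"
    using U(3) e by (simp add: emeasure_eq_measure ennreal_less_iff flip: ennreal_plus)
  moreover have "measure \<mu> (U - K) = measure \<mu> U - measure \<mu> K"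
    using U K by (intro finite_measure_Diff) auto
  ultimately have UK: "measure \<mu> (U - K) < e" using e K(3) by linarith
  obtain g :: "'a \<Rightarrow> real" where g: "continuous_on UNIV g" "\<And>x. x \<in> UNIV \<Longrightarrow> g x \<in> closed_segment 1 0"
    "\<And>x. x \<in> K \<Longrightarrow> g x = 1" "\<And>x. x \<in> - U \<Longrightarrow> g x = 0"
    by (rule Urysohn_local[of UNIV K "- U" 1 0])
       (use U K in \<open>auto simp: compact_imp_closed closed_Compl\<close>)
  have g01: "0 \<le> g x" "g x \<le> 1" for x
    using g(2)[of x] by (auto simp: closed_segment_eq_real_ivl)
  have gm: "g \<in> borel_measurable \<mu>"
    using borel_measurable_continuous_onI[OF g(1)] by (simp cong: measurable_cong_sets)
  have "(LINT x|\<mu>. \<bar>indicat_real A x - g x\<bar>) \<le> (LINT x|\<mu>. indicat_real (U - K) x)"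
  proof (rule integral_mono)
    show "integrable \<mu> (\<lambda>x. \<bar>indicat_real A x - g x\<bar>)"
    proof -
      have "integrable \<mu> g" using g01 gm by (intro integrable_const_bound[of _ 1]) auto
      moreover have "integrable \<mu> (indicat_real A)"
        using A by (simp add: integrable_indicator_iff emeasure_eq_measure)
      ultimately show ?thesis by (intro integrable_abs Bochner_Integration.integrable_diff)
    qed
    show "integrable \<mu> (indicat_real (U - K))"
      using sets.Diff[OF UK_sets] by (simp add: integrable_indicator_iff emeasure_eq_measure sp)
    show "\<bar>indicat_real A x - g x\<bar> \<le> indicat_real (U - K) x" for x
      using g01[of x] g(3,4)[of x] U(1) K(1) by (auto simp: indicator_def)
  qed
  also have "\<dots> < e" using UK sp by simp
  finally show ?thesis using that g(1) g01 by blast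
qed

lemma L1_continuous_approx:
  fixes \<mu> :: "'a::euclidean_space measure" and f :: "'a \<Rightarrow> real"
  assumes [simp]: "sets \<mu> = sets borel" and fin: "finite_measure \<mu>" and f: "integrable \<mu> f"
  shows "\<forall>e>0. \<exists>g. continuous_on UNIV g \<and> integrable \<mu> g \<and> (LINT x|\<mu>. \<bar>f x - g x\<bar>) < e"
  using f
proof (induction rule: integrable_induct)
  case (base A c)
  interpret finite_measure \<mu> by (rule fin)
  show ?case
  proof (intro allI impI)
    fix e :: real assume e: "e > 0"
    define e' where "e' = e / (\<bar>c\<bar> + 1)"
    have e': "e' > 0" using e by (simp add: e'_def divide_pos_pos)
    obtain g where g: "continuous_on UNIV g" "\<And>x. 0 \<le> g x" "\<And>x. g x \<le> (1 :: real)"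
      "(LINT x|\<mu>. \<bar>indicat_real A x - g x\<bar>) < e'"
      using indicator_continuous_approx[OF assms(1) fin _ e', of A] base(1) by auto
    have gm: "g \<in> borel_measurable \<mu>"
      using borel_measurable_continuous_onI[OF g(1)] by (simp cong: measurable_cong_sets)
    have "(LINT x|\<mu>. \<bar>indicat_real A x *\<^sub>R c - c * g x\<bar>) = (LINT x|\<mu>. \<bar>c\<bar> * \<bar>indicat_real A x - g x\<bar>)"
      by (simp add: abs_mult[symmetric] algebra_simps)
    also have "\<dots> = \<bar>c\<bar> * (LINT x|\<mu>. \<bar>indicat_real A x - g x\<bar>)" by simp
    also have "\<dots> \<le> \<bar>c\<bar> * e'" using g(4) by (intro mult_left_mono) auto
    also have "\<dots> < e" using e by (simp add: e'_def field_simps)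
    finally have "(LINT x|\<mu>. \<bar>indicat_real A x *\<^sub>R c - c * g x\<bar>) < e" .
    moreover have "integrable \<mu> g"
      using g(2,3) gm by (intro integrable_const_bound[of _ 1]) auto
    ultimately show "\<exists>g. continuous_on UNIV g \<and> integrable \<mu> g \<and> (LINT x|\<mu>. \<bar>indicat_real A x *\<^sub>R c - g x\<bar>) < e"
      using g(1) by (intro exI[of _ "\<lambda>x. c * g x"]) (auto intro: continuous_on_mult_left)
  qed
next
  case (add f1 f2)
  show ?case
  proof (intro allI impI)
    fix e :: real assume e: "e > 0"
    obtain g1 where g1: "continuous_on UNIV g1" "integrable \<mu> g1" "(LINT x|\<mu>. \<bar>f1 x - g1 x\<bar>) < e / 2"
      using add.IH(1) e half_gt_zero by blast
    obtain g2 where g2: "continuous_on UNIV g2" "integrable \<mu> g2" "(LINT x|\<mu>. \<bar>f2 x - g2 x\<bar>) < e / 2"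
      using add.IH(2) e half_gt_zero by blast
    have i1: "integrable \<mu> (\<lambda>x. \<bar>f1 x - g1 x\<bar>)" and i2: "integrable \<mu> (\<lambda>x. \<bar>f2 x - g2 x\<bar>)"
      using add.hyps g1(2) g2(2) by auto
    have "(LINT x|\<mu>. \<bar>f1 x + f2 x - (g1 x + g2 x)\<bar>) \<le> (LINT x|\<mu>. \<bar>f1 x - g1 x\<bar> + \<bar>f2 x - g2 x\<bar>)"
      using add.hyps g1(2) g2(2) by (intro integral_mono) auto
    also have "\<dots> < e" using Bochner_Integration.integral_add[OF i1 i2] g1(3) g2(3) by simp
    finally show "\<exists>g. continuous_on UNIV g \<and> integrable \<mu> g \<and> (LINT x|\<mu>. \<bar>f1 x + f2 x - g x\<bar>) < e"
      using g1 g2 by (intro exI[of _ "\<lambda>x. g1 x + g2 x"]) (auto intro: continuous_on_add)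
  qed
next
  case (lim f s)
  show ?case
  proof (intro allI impI)
    fix e :: real assume e: "e > 0"
    have "(\<lambda>i. LINT x|\<mu>. \<bar>f x - s i x\<bar>) \<longlonglongrightarrow> (LINT x|\<mu>. 0)"
    proof (rule integral_dominated_convergence[where w = "\<lambda>x. 3 * \<bar>f x\<bar>"])
      show "AE x in \<mu>. (\<lambda>i. \<bar>f x - s i x\<bar>) \<longlonglongrightarrow> 0"
      proof (rule AE_I2)
        fix x assume "x \<in> space \<mu>"
        then have "(\<lambda>i. \<bar>f x - s i x\<bar>) \<longlonglongrightarrow> \<bar>f x - f x\<bar>"
          by (intro tendsto_intros lim.hyps(2))
        then show "(\<lambda>i. \<bar>f x - s i x\<bar>) \<longlonglongrightarrow> 0" by simp
      qed
      show "AE x in \<mu>. norm \<bar>f x - s i x\<bar> \<le> 3 * \<bar>f x\<bar>" for i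
      proof (rule AE_I2)
        fix x assume "x \<in> space \<mu>"
        then have "\<bar>s i x\<bar> \<le> 2 * \<bar>f x\<bar>" using lim.hyps(3) by simp
        then show "norm \<bar>f x - s i x\<bar> \<le> 3 * \<bar>f x\<bar>" by simp
      qed
    qed (use lim.hyps in auto)
    then have "\<forall>\<^sub>F i in sequentially. (LINT x|\<mu>. \<bar>f x - s i x\<bar>) < e / 2"
      using e by (intro order_tendstoD(2)[of _ 0]) auto
    then obtain i where i: "(LINT x|\<mu>. \<bar>f x - s i x\<bar>) < e / 2"
      by (auto simp: eventually_sequentially)
    obtain g where g: "continuous_on UNIV g" "integrable \<mu> g" "(LINT x|\<mu>. \<bar>s i x - g x\<bar>) < e / 2"
      using lim.IH[of i] e half_gt_zero by blast
    have i1: "integrable \<mu> (\<lambda>x. \<bar>f x - s i x\<bar>)" and i2: "integrable \<mu> (\<lambda>x. \<bar>s i x - g x\<bar>)"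
      using lim.hyps g(2) by auto
    have "(LINT x|\<mu>. \<bar>f x - g x\<bar>) \<le> (LINT x|\<mu>. \<bar>f x - s i x\<bar> + \<bar>s i x - g x\<bar>)"
      using lim.hyps g(2) by (intro integral_mono) auto
    also have "\<dots> < e" using Bochner_Integration.integral_add[OF i1 i2] i g(3) by simp
    finally show "\<exists>g. continuous_on UNIV g \<and> integrable \<mu> g \<and> (LINT x|\<mu>. \<bar>f x - g x\<bar>) < e"
      using g by blast
  qed
qed

text \<open>Approximation with respect to the sum is approximation with respect to both summands at
  once.\<close>

lemma sum_of_measures:
  fixes M N :: "'a::topological_space measure"
  assumes [simp]: "sets M = sets borel" "sets N = sets borel"
  obtains L where "sets L = sets borel" "\<And>A. A \<in> sets borel \<Longrightarrow> emeasure L A = emeasure M A + emeasure N A"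
proof
  define L where "L = measure_of UNIV (sets borel) (\<lambda>A. emeasure M A + emeasure N A)"
  show sL: "sets L = sets borel" unfolding L_def by (simp add: sets.sets_measure_of_eq[of borel, simplified])
  fix A :: "'a set" assume A: "A \<in> sets borel"
  have "countably_additive (sets borel) (\<lambda>A. emeasure M A + emeasure N A)"
  proof (rule countably_additiveI)
    fix A :: "nat \<Rightarrow> 'a set" assume "range A \<subseteq> sets borel" "disjoint_family A"
    then show "(\<Sum>i. emeasure M (A i) + emeasure N (A i)) = emeasure M (\<Union>i. A i) + emeasure N (\<Union>i. A i)"
      by (subst suminf_add[symmetric]) (auto intro!: arg_cong2[where f = plus] suminf_emeasure)
  qed
  then show "emeasure L A = emeasure M A + emeasure N A"
    using A sets.sigma_algebra_axioms[of "borel :: 'a measure"] unfolding L_def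
    by (intro emeasure_measure_of_sigma) (auto simp: positive_def)
qed

text \<open>The measure \<open>m\<close> may be singular to Lebesgue measure, so one function has to
  be good for both. It is found in the L1 space of \<open>m\<close> plus Lebesgue measure on a ball.
  As both functions take values in [0, 1], their squares differ by at most twice their distance, and
  L1 closeness controls the integral of the square.\<close>

lemma continuous_weight_approx:
  fixes chi :: "'a::euclidean_space \<Rightarrow> real"
  assumes m [simp]: "sets m = sets borel" and fin: "finite_measure m"
    and chi: "chi \<in> borel_measurable borel" "\<And>z. 0 \<le> chi z" "\<And>z. chi z \<le> 1"
    and supp: "bounded {z. chi z \<noteq> 0}" and e: "e > 0"
  obtains psi where "continuous_on UNIV psi" "bounded {z. psi z \<noteq> 0}" "\<And>z. 0 \<le> psi z" "\<And>z. psi z \<le> (1 :: real)"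
    "(LINT z|lborel. (psi z)\<^sup>2) \<le> (LINT z|lborel. (chi z)\<^sup>2) + e" "(LINT z|m. chi z) \<le> (LINT z|m. psi z) + e"
proof -
  interpret m: finite_measure m by (rule fin)
  obtain R where R: "R > 0" "\<And>x. R \<le> norm x \<Longrightarrow> chi x = 0"
    using bounded_support_cases[OF supp] by blast
  \<comment> \<open>The margin of width 1 around the support is where the cutoff below decreases
    from 1 to 0.\<close>
  define D :: "'a set" where "D = cball 0 (R + 1)"
  have D [measurable]: "D \<in> sets borel" by (simp add: D_def)
  have Dfin: "emeasure lborel D < \<infinity>" unfolding D_def by (rule emeasure_compact_finite[OF compact_cball])
  define l where "l = density lborel (indicator D)"
  have l [simp]: "sets l = sets borel" by (simp add: l_def)
  have el: "emeasure l A = emeasure lborel (D \<inter> A)" if "A \<in> sets borel" for A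
    using that by (simp add: l_def emeasure_density nn_integral_indicator indicator_inter_arith[symmetric])
  obtain L where L: "sets L = sets borel" "\<And>A. A \<in> sets borel \<Longrightarrow> emeasure L A = emeasure m A + emeasure l A"
    using sum_of_measures[OF m l] by blast
  have spaces: "space L = UNIV" "space m = UNIV" "space l = UNIV"
    using sets_eq_imp_space_eq[OF L(1)] sets_eq_imp_space_eq[OF m] by (simp_all add: l_def)
  interpret L: finite_measure L
  proof (rule finite_measureI)
    have "emeasure m UNIV < \<infinity>" 
      unfolding infinity_ennreal_def less_top[symmetric] by (rule m.emeasure_finite)
    then show "emeasure L (space L) \<noteq> \<infinity>" using Dfin by (simp add: spaces L(2) el)
  qed
  have le: "m \<le> L" "l \<le> L"
    using L by (auto simp: le_measure)
  have int_le: "(LINT z|N. f z) \<le> (LINT z|L. f z)" "integrable N f"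
    if N: "N = m \<or> N = l" and f: "f \<in> borel_measurable borel" "\<And>z. 0 \<le> f z" "integrable L f" for N and f :: "'a \<Rightarrow> real"
  proof -
    have sN: "sets N = sets L" "N \<le> L" using N L(1) m l le by metis+
    have fm: "f \<in> borel_measurable N" "f \<in> borel_measurable L"
      using f(1) measurable_cong_sets[of N borel] measurable_cong_sets[of L borel] sN(1) L(1) by simp_all
    have nn: "(\<integral>\<^sup>+z. ennreal (f z) \<partial>N) \<le> (\<integral>\<^sup>+z. ennreal (f z) \<partial>L)"
      by (rule nn_integral_mono_measure[OF sN])
    have finL: "(\<integral>\<^sup>+z. ennreal (f z) \<partial>L) < \<infinity>"
      using f(2,3) by (simp add: integrable_iff_bounded)
    show "integrable N f"
      using fm(1) nn finL f(2) by (simp add: integrable_iff_bounded order_le_less_trans)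
    show "(LINT z|N. f z) \<le> (LINT z|L. f z)"
      using nn finL f(2) fm by (simp add: integral_eq_nn_integral enn2real_mono)
  qed
  have chiL: "chi \<in> borel_measurable L" using chi(1) L(1) by (simp cong: measurable_cong_sets)
  then have ichi: "integrable L chi"
    using chi by (intro L.integrable_const_bound[of _ 1]) auto
  \<comment> \<open>The half pays for the factor 2 in the comparison of the squares.\<close>
  obtain g where g: "continuous_on UNIV g" "integrable L g" "(LINT x|L. \<bar>chi x - g x\<bar>) < e / 2"
    using L1_continuous_approx[OF L(1) L.finite_measure_axioms ichi] e half_gt_zero by blast
  define cut where "cut z = max 0 (min 1 (R + 1 - norm z))" for z :: 'a
  define psi where "psi z = min 1 (max 0 (g z)) * cut z" for z
  have cut01: "0 \<le> cut z" "cut z \<le> 1" for z by (auto simp: cut_def)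
  have psi: "continuous_on UNIV psi" unfolding psi_def cut_def
    by (intro continuous_intros g(1))
  have psi01: "0 \<le> psi z" "psi z \<le> 1" for z
    unfolding psi_def using cut01[of z] by (auto intro: mult_le_one)
  have psi_out: "psi z = 0" if "z \<notin> D" for z using that by (simp add: psi_def cut_def D_def)
  have chi_out: "chi z = 0" if "z \<notin> D" for z using that R(2)[of z] by (simp add: D_def)
  \<comment> \<open>Clamping to [0, 1] moves \<open>g\<close> no further from \<open>chi\<close>,
    whose values lie there; the cutoff differs from 1 only where \<open>chi\<close> is zero, and
    there it moves the value towards zero.\<close>
  have diff: "\<bar>chi z - psi z\<bar> \<le> \<bar>chi z - g z\<bar>" for z
  proof (cases "norm z \<le> R")
    case True
    then have "psi z = min 1 (max 0 (g z))" by (simp add: psi_def cut_def)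
    then show ?thesis using chi(2,3)[of z] by (auto simp: min_def max_def)
  next
    case False
    then have "chi z = 0" using R(2) by simp
    moreover have "psi z \<le> min 1 (max 0 (g z))"
      unfolding psi_def using cut01[of z] by (intro mult_right_le_one_le) auto
    ultimately show ?thesis using psi01(1)[of z] by (auto simp: min_def max_def split: if_splits)
  qed
  have psi_m: "psi \<in> borel_measurable borel" by (rule borel_measurable_continuous_onI[OF psi])
  have dm: "(\<lambda>z. \<bar>chi z - psi z\<bar>) \<in> borel_measurable borel" using psi_m chi(1) by simp
  have dL: "integrable L (\<lambda>z. \<bar>chi z - psi z\<bar>)" "(LINT z|L. \<bar>chi z - psi z\<bar>) < e / 2"
  proof -
    have gi: "integrable L (\<lambda>z. \<bar>chi z - g z\<bar>)" using ichi g(2) by auto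
    show i: "integrable L (\<lambda>z. \<bar>chi z - psi z\<bar>)"
      by (rule Bochner_Integration.integrable_bound[OF gi]) (use dm L(1) diff in \<open>auto cong: measurable_cong_sets\<close>)
    have "(LINT z|L. \<bar>chi z - psi z\<bar>) \<le> (LINT z|L. \<bar>chi z - g z\<bar>)"
      by (rule integral_mono[OF i gi diff])
    then show "(LINT z|L. \<bar>chi z - psi z\<bar>) < e / 2" using g(3) by linarith
  qed
  have b: "\<bar>chi z - psi z\<bar> \<ge> 0" for z by simp
  have im: "integrable m chi" "integrable m psi"
    using chi psi_m psi01 by (auto intro!: m.integrable_const_bound[of _ 1] cong: measurable_cong_sets)
  have "(LINT z|m. chi z) - (LINT z|m. psi z) = (LINT z|m. chi z - psi z)"
    by (rule Bochner_Integration.integral_diff[OF im, symmetric])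
  also have "\<dots> \<le> (LINT z|m. \<bar>chi z - psi z\<bar>)"
    using im by (intro integral_mono) auto
  also have "\<dots> \<le> e" using int_le(1)[OF _ dm b dL(1), of m] dL(2) e by simp
  finally have 1: "(LINT z|m. chi z) \<le> (LINT z|m. psi z) + e" by simp
  have sq: "integrable lborel (\<lambda>z. (f z)\<^sup>2)"
    if f: "f \<in> borel_measurable borel" "\<And>z. 0 \<le> f z" "\<And>z. f z \<le> 1" "\<And>z. z \<notin> D \<Longrightarrow> f z = 0" for f :: "'a \<Rightarrow> real"
  proof (rule Bochner_Integration.integrable_bound)
    show "integrable lborel (indicat_real D)" using Dfin by (simp add: integrable_indicator_iff)
    show "(\<lambda>z. (f z)\<^sup>2) \<in> borel_measurable lborel" using f(1) by simp
    show "AE z in lborel. norm ((f z)\<^sup>2) \<le> norm (indicat_real D z)"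
      using f(2-4) by (intro AE_I2) (auto simp: indicator_def power_le_one)
  qed
  note sqc = sq[OF chi chi_out] and sqp = sq[OF psi_m psi01 psi_out]
  have il: "integrable lborel (\<lambda>z. 2 * \<bar>chi z - psi z\<bar>)" "(LINT z|lborel. 2 * \<bar>chi z - psi z\<bar>) \<le> e"
  proof -
    have "(\<lambda>z. indicat_real D z *\<^sub>R \<bar>chi z - psi z\<bar>) = (\<lambda>z. \<bar>chi z - psi z\<bar>)"
      using psi_out chi_out by (auto simp: indicator_def fun_eq_iff)
    moreover have "l = density lborel (\<lambda>z. ennreal (indicat_real D z))"
      by (simp add: l_def ennreal_indicator)
    moreover have "(\<lambda>z. \<bar>chi z - psi z\<bar>) \<in> borel_measurable lborel" using dm by simp
    ultimately have "integrable lborel (\<lambda>z. \<bar>chi z - psi z\<bar>) \<longleftrightarrow> integrable l (\<lambda>z. \<bar>chi z - psi z\<bar>)"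
      "(LINT z|lborel. \<bar>chi z - psi z\<bar>) = (LINT z|l. \<bar>chi z - psi z\<bar>)"
      using integrable_density[of "\<lambda>z. \<bar>chi z - psi z\<bar>" lborel "indicat_real D"]
        integral_density[of "\<lambda>z. \<bar>chi z - psi z\<bar>" lborel "indicat_real D"] by simp_all
    then show "integrable lborel (\<lambda>z. 2 * \<bar>chi z - psi z\<bar>)" "(LINT z|lborel. 2 * \<bar>chi z - psi z\<bar>) \<le> e"
      using int_le[OF _ dm b dL(1), of l] dL(2) e by simp_all
  qed
  have "(LINT z|lborel. (psi z)\<^sup>2) - (LINT z|lborel. (chi z)\<^sup>2) = (LINT z|lborel. (psi z)\<^sup>2 - (chi z)\<^sup>2)"
    by (rule Bochner_Integration.integral_diff[OF sqp sqc, symmetric])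
  also have "\<dots> \<le> (LINT z|lborel. 2 * \<bar>chi z - psi z\<bar>)"
  proof (rule integral_mono[OF Bochner_Integration.integrable_diff[OF sqp sqc] il(1)])
    fix z
    have "(psi z)\<^sup>2 - (chi z)\<^sup>2 = (psi z + chi z) * (psi z - chi z)"
      by (simp add: power2_eq_square algebra_simps)
    also have "\<dots> \<le> (psi z + chi z) * \<bar>chi z - psi z\<bar>"
      using psi01 chi by (intro mult_left_mono add_nonneg_nonneg) auto
    also have "\<dots> \<le> 2 * \<bar>chi z - psi z\<bar>"
      using psi01(2)[of z] chi(3)[of z] by (intro mult_right_mono) auto
    finally show "(psi z)\<^sup>2 - (chi z)\<^sup>2 \<le> 2 * \<bar>chi z - psi z\<bar>" .
  qed
  also have "\<dots> \<le> e" by (rule il(2))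
  finally have 2: "(LINT z|lborel. (psi z)\<^sup>2) \<le> (LINT z|lborel. (chi z)\<^sup>2) + e" by simp
  have "bounded {z. psi z \<noteq> 0}"
  proof (rule bounded_subset)
    show "bounded D" by (simp add: D_def)
    show "{z. psi z \<noteq> 0} \<subseteq> D" using psi_out by blast
  qed
  with 1 2 psi psi01 that show ?thesis by blast
qed

section \<open>The estimate for dominated measures\<close>

text \<open>\<open>m\<close> stands for the minimum of the two positive parts and enters only
  through integrals dominated by either of them. Integrating the lower bound of the certificate
  against \<open>m\<close>, the x-derivative is charged to the first field and the y-derivative to
  the second.\<close>

lemma transversal_flux_estimate:
  fixes chi :: "real \<times> real \<Rightarrow> real"
  assumes pS: "has_div_pairing \<mu> \<sigma> \<nu> d" and pT: "has_div_pairing \<mu>' \<tau> \<nu>' d'"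
    and m: "sets m = sets borel" "finite_measure m"
    and domS: "\<And>f :: real \<times> real \<Rightarrow> real. f \<in> borel_measurable borel \<Longrightarrow> (\<And>z. 0 \<le> f z) \<Longrightarrow> (\<And>z. f z \<le> 1) \<Longrightarrow>
        (LINT z|m. f z) \<le> (LINT z|\<mu>. f z * xP (\<sigma> z))"
    and domT: "\<And>f :: real \<times> real \<Rightarrow> real. f \<in> borel_measurable borel \<Longrightarrow> (\<And>z. 0 \<le> f z) \<Longrightarrow> (\<And>z. f z \<le> 1) \<Longrightarrow>
        (LINT z|m. f z) \<le> (LINT z|\<mu>'. f z * yP (\<tau> z))"
    and chi: "chi \<in> borel_measurable borel" "\<And>z. 0 \<le> chi z" "\<And>z. chi z \<le> 1" "bounded {z. chi z \<noteq> 0}"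
    and S: "(LINT z|\<nu>. \<bar>d z\<bar>) \<le> S" and T: "(LINT z|\<nu>'. \<bar>d' z\<bar>) \<le> T"
  shows "(LINT z|m. chi z) \<le> 48 * sqrt (LINT z|lborel. (chi z)\<^sup>2) * sqrt S * sqrt T
    + ((LINT z|\<mu>. xN (\<sigma> z)) + (LINT z|\<mu>'. yN (\<tau> z)))"
proof -
  interpret m: finite_measure m by (rule m(2))
  have mm: "f \<in> borel_measurable m" if "f \<in> borel_measurable borel" for f :: "real \<times> real \<Rightarrow> real"
    using that m(1) by (simp cong: measurable_cong_sets)
  define N where "N = (LINT z|\<mu>. xN (\<sigma> z)) + (LINT z|\<mu>'. yN (\<tau> z))"
  define X where "X = (LINT z|lborel. (chi z)\<^sup>2)"
  define W where "W = measure m (space m)"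
  have X0: "0 \<le> X" unfolding X_def by simp
  have S0: "0 \<le> S" and T0: "0 \<le> T"
    using S T Bochner_Integration.integral_nonneg[of \<nu> "\<lambda>z. \<bar>d z\<bar>"]
      Bochner_Integration.integral_nonneg[of \<nu>' "\<lambda>z. \<bar>d' z\<bar>"] by linarith+
  \<comment> \<open>Adding \<open>e\<close> to the data makes every divisor positive even if a
    divergence or \<open>chi\<close> vanishes. The error \<open>e * W\<close> is the defect of the
    certificate integrated over the finite measure \<open>m\<close>, and the other \<open>e\<close>
    comes from the approximation of \<open>chi\<close>.\<close>
  have approx: "(LINT z|m. chi z) \<le> 48 * sqrt (X + 2 * e) * sqrt (S + e) * sqrt (T + e) + N + (e * W + e)"
    if e: "e > 0" for e
  proof -
    obtain psi where psi: "continuous_on UNIV psi" "bounded {z. psi z \<noteq> 0}"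
      "\<And>z. 0 \<le> psi z" "\<And>z. psi z \<le> (1 :: real)"
      "(LINT z|lborel. (psi z)\<^sup>2) \<le> (LINT z|lborel. (chi z)\<^sup>2) + e"
      "(LINT z|m. chi z) \<le> (LINT z|m. psi z) + e"
      using continuous_weight_approx[OF m chi e] by blast
    \<comment> \<open>One \<open>e\<close> absorbs the change of the L2 norm under approximation,
      the other makes \<open>Q\<close> strictly positive.\<close>
    define Q where "Q = X + 2 * e"
    have Q: "Q > 0" "(LINT z|lborel. (psi z)\<^sup>2) \<le> Q" using e X0 psi(5) unfolding Q_def X_def by linarith+
    define r where "r = sqrt Q * sqrt (S + e) * sqrt (T + e)"
    have SeTe: "S + e > 0" "T + e > 0" using S0 T0 e by auto
    \<comment> \<open>The sum to be made small is
      \<open>4 * M * (S + e) + 128 * Q / M * (T + e)\<close>, whose minimiser is a constant multiple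
      of \<open>r / (S + e)\<close>. The multiple 4 gives \<open>16 * r\<close> and
      \<open>32 * r\<close> without irrational constants.\<close>
    define M where "M = 4 * r / (S + e)"
    have r: "r > 0" unfolding r_def using Q(1) SeTe by simp
    have M: "M > 0" unfolding M_def using r SeTe by simp
    have rr: "r * r = Q * (S + e) * (T + e)"
    proof -
      have "r * r = (sqrt Q * sqrt Q) * (sqrt (S + e) * sqrt (S + e)) * (sqrt (T + e) * sqrt (T + e))"
        by (simp only: r_def ac_simps)
      then show ?thesis using Q(1) SeTe by simp
    qed
    obtain g k where gk: "smooth g" "smooth k" "\<And>p. 0 \<le> g p" "\<And>p. g p \<le> 4 * M"
      "\<And>p. 0 \<le> k p" "\<And>p. k p \<le> 128 * Q / M"
      "\<And>p. \<bar>partial_y g p\<bar> \<le> partial_x g p" "\<And>p. partial_x g p \<le> 1"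
      "\<And>p. \<bar>partial_x k p\<bar> \<le> partial_y k p" "\<And>p. partial_y k p \<le> 1"
      "\<And>p. psi p - e \<le> partial_x g p + partial_y k p"
      using dual_certificate[OF psi(1-4) e M Q] by blast
    have gx: "0 \<le> partial_x g p" and ky: "0 \<le> partial_y k p" for p
      using gk(7,9)[of p] abs_ge_zero order_trans by blast+
    have gm: "partial_x g \<in> borel_measurable borel" "partial_y k \<in> borel_measurable borel"
      using smooth_borel_measurable smooth_partial gk(1,2) by blast+
    have ig: "integrable m (partial_x g)" "integrable m (partial_y k)"
      using gx ky gk(8,10) mm[OF gm(1)] mm[OF gm(2)] by (auto intro!: m.integrable_const_bound[of _ 1])
    have "(LINT z|m. psi z) \<le> (LINT z|m. partial_x g z + partial_y k z + e)"
    proof (rule integral_mono)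
      show "integrable m psi"
        using psi(3,4) mm[OF borel_measurable_continuous_onI[OF psi(1)]]
        by (auto intro!: m.integrable_const_bound[of _ 1])
      show "integrable m (\<lambda>z. partial_x g z + partial_y k z + e)" using ig by simp
      show "psi z \<le> partial_x g z + partial_y k z + e" for z using gk(11)[of z] by linarith
    qed
    also have "\<dots> = (LINT z|m. partial_x g z) + (LINT z|m. partial_y k z) + e * W"
      using ig by (simp add: W_def mult.commute)
    also have "(LINT z|m. partial_x g z) \<le> (LINT z|\<mu>. xN (\<sigma> z)) + 4 * M * (S + e)"
    proof -
      have "(LINT z|m. partial_x g z) \<le> (LINT z|\<mu>. partial_x g z * xP (\<sigma> z))"
        by (rule domS[OF gm(1) gx gk(8)])
      also have "\<dots> \<le> (LINT z|\<mu>. xN (\<sigma> z)) + 4 * M * (LINT z|\<nu>. \<bar>d z\<bar>)"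
        by (rule flux_bounds(1)[OF pS gk(1,3,4,7,8)])
      also have "4 * M * (LINT z|\<nu>. \<bar>d z\<bar>) \<le> 4 * M * (S + e)"
        using S e M by (intro mult_left_mono) auto
      finally show ?thesis by simp
    qed
    also have "(LINT z|m. partial_y k z) \<le> (LINT z|\<mu>'. yN (\<tau> z)) + 128 * Q / M * (T + e)"
    proof -
      have "(LINT z|m. partial_y k z) \<le> (LINT z|\<mu>'. partial_y k z * yP (\<tau> z))"
        by (rule domT[OF gm(2) ky gk(10)])
      also have "\<dots> \<le> (LINT z|\<mu>'. yN (\<tau> z)) + 128 * Q / M * (LINT z|\<nu>'. \<bar>d' z\<bar>)"
        by (rule flux_bounds(2)[OF pT gk(2,5,6,9,10)])
      also have "128 * Q / M * (LINT z|\<nu>'. \<bar>d' z\<bar>) \<le> 128 * Q / M * (T + e)"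
        using T e M Q(1) by (intro mult_left_mono) auto
      finally show ?thesis by simp
    qed
    also have "4 * M * (S + e) = 16 * r" unfolding M_def using SeTe by simp
    also have "128 * Q / M * (T + e) = 32 * r"
    proof -
      have "128 * Q / M * (T + e) = 32 * (Q * (S + e) * (T + e)) / r"
        unfolding M_def using SeTe r by (simp add: field_simps)
      also have "\<dots> = 32 * r" unfolding rr[symmetric] using r by simp
      finally show ?thesis .
    qed
    finally have "(LINT z|m. psi z) \<le> 48 * r + N + e * W" unfolding N_def by simp
    then show ?thesis using psi(6) unfolding r_def Q_def by simp
  qed
  have "((\<lambda>e. 48 * sqrt (X + 2 * e) * sqrt (S + e) * sqrt (T + e) + N + (e * W + e)) \<longlongrightarrow>
      48 * sqrt (X + 2 * 0) * sqrt (S + 0) * sqrt (T + 0) + N + (0 * W + 0)) (at_right 0)"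
    by (intro tendsto_intros)
  then have "(LINT z|m. chi z) \<le> 48 * sqrt (X + 2 * 0) * sqrt (S + 0) * sqrt (T + 0) + N + (0 * W + 0)"
    by (rule tendsto_lowerbound) (use approx in \<open>auto intro: eventually_at_right_less[THEN eventually_mono]\<close>)
  then show ?thesis by (simp add: X_def N_def)
qed

section \<open>The variation measure and the polar decomposition\<close>

lemma finite_vector_measure_sums:
  assumes "finite_vector_measure \<nu>" "range A \<subseteq> sets borel" "disjoint_family A"
  shows "(\<lambda>i. \<nu> (A i)) sums \<nu> (\<Union>i. A i)"
  using assms unfolding finite_vector_measure_def by blast

text \<open>The constant sequence of empty sets is disjoint, and a constant series converges only if
  its term is zero.\<close>

lemma vector_measure_empty:
  assumes "\<And>A :: nat \<Rightarrow> 'a::topological_space set. range A \<subseteq> sets borel \<Longrightarrow> disjoint_family A \<Longrightarrow>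
    (\<lambda>i. \<nu> (A i)) sums (\<nu> (\<Union>i. A i) :: 'b::real_normed_vector)"
  shows "\<nu> {} = 0"
proof -
  have "(\<lambda>i :: nat. \<nu> {}) sums \<nu> (\<Union>i :: nat. {})"
    using assms[of "\<lambda>_. {}"] by (simp add: disjoint_family_on_def)
  then have "summable (\<lambda>i :: nat. \<nu> {})" by (rule sums_summable)
  then show ?thesis by (simp add: summable_const_iff)
qed

lemma ennreal_norm_sums_le:
  fixes f :: "nat \<Rightarrow> 'b::real_normed_vector"
  assumes "f sums s"
  shows "ennreal (norm s) \<le> (\<Sum>i. ennreal (norm (f i)))"
proof (rule LIMSEQ_le_const2)
  show "(\<lambda>n. ennreal (norm (\<Sum>i<n. f i))) \<longlonglongrightarrow> ennreal (norm s)"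
    using assms unfolding sums_def by (intro tendsto_ennrealI tendsto_norm)
  have "ennreal (norm (\<Sum>i<n. f i)) \<le> (\<Sum>i. ennreal (norm (f i)))" for n
  proof -
    have "ennreal (norm (\<Sum>i<n. f i)) \<le> ennreal (\<Sum>i<n. norm (f i))"
      by (intro ennreal_leI norm_sum)
    also have "\<dots> = (\<Sum>i<n. ennreal (norm (f i)))" by (simp add: sum_ennreal)
    also have "\<dots> \<le> (\<Sum>i. ennreal (norm (f i)))" by (intro sum_le_suminf) auto
    finally show ?thesis .
  qed
  then show "\<exists>N. \<forall>n\<ge>N. ennreal (norm (\<Sum>i<n. f i)) \<le> (\<Sum>i. ennreal (norm (f i)))" by blast
qed

lemma ennreal_suminf_swap:
  fixes f :: "nat \<Rightarrow> nat \<Rightarrow> ennreal"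
  shows "(\<Sum>i. \<Sum>j. f i j) = (\<Sum>j. \<Sum>i. f i j)"
  using nn_integral_suminf[of "\<lambda>j i. f i j" "count_space UNIV"]
  by (simp add: nn_integral_count_space_nat)

definition partitions :: "'a::topological_space set \<Rightarrow> (nat \<Rightarrow> 'a set) set" where
  "partitions E = {A. range A \<subseteq> sets borel \<and> disjoint_family A \<and> (\<Union>i. A i) = E}"

lemma variation_alt: "variation \<nu> E = (SUP A\<in>partitions E. \<Sum>i. ennreal (norm (\<nu> (A i))))"
  by (simp add: variation_def partitions_def)

lemma binaryset_partition:
  assumes "A \<in> sets borel" "B \<in> sets borel" "A \<inter> B = {}"
  shows "binaryset A B \<in> partitions (A \<union> B)"
  using assms unfolding partitions_def
  by (auto simp: range_binaryset_eq UN_binaryset_eq disjoint_family_on_def binaryset_def)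

section \<open>The variation of a countably additive set function is a measure\<close>

context
  fixes \<nu> :: "'a::topological_space set \<Rightarrow> 'b::real_normed_vector"
  assumes sums: "\<And>A :: nat \<Rightarrow> 'a set. range A \<subseteq> sets borel \<Longrightarrow> disjoint_family A \<Longrightarrow>
    (\<lambda>i. \<nu> (A i)) sums \<nu> (\<Union>i. A i)"
begin

lemma norm_le_variation:
  assumes "E \<in> sets borel"
  shows "ennreal (norm (\<nu> E)) \<le> variation \<nu> E"
proof -
  have "ennreal (norm (\<nu> E)) = (\<Sum>i\<in>{0}. ennreal (norm (\<nu> (binaryset E {} i))))"
    by (simp add: binaryset_def)
  also have "\<dots> \<le> (\<Sum>i. ennreal (norm (\<nu> (binaryset E {} i))))"
    by (intro sum_le_suminf) auto
  also have "\<dots> \<le> variation \<nu> E"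
    unfolding variation_alt using binaryset_partition[of E "{}"] assms by (intro SUP_upper) auto
  finally show ?thesis .
qed

lemma variation_empty: "variation \<nu> {} = 0"
proof -
  have "variation \<nu> {} \<le> 0"
    unfolding variation_alt
    by (rule SUP_least) (auto simp: partitions_def vector_measure_empty[OF sums])
  then show ?thesis by simp
qed

text \<open>A partition of \<open>A\<close> and a partition of \<open>B\<close>, interleaved at even
  and odd indices, partition the union; the two suprema are then taken one after the other.\<close>

lemma variation_superadditive:
  assumes AB: "A \<in> sets borel" "B \<in> sets borel" "A \<inter> B = {}"
  shows "variation \<nu> A + variation \<nu> B \<le> variation \<nu> (A \<union> B)"
proof -
  have *: "(\<Sum>i. ennreal (norm (\<nu> (P i)))) + (\<Sum>i. ennreal (norm (\<nu> (Q i)))) \<le> variation \<nu> (A \<union> B)"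
    if P: "P \<in> partitions A" and Q: "Q \<in> partitions B" for P Q
  proof -
    have U: "(\<Union>i. P i) = A" "(\<Union>i. Q i) = B" and dis: "disjoint_family P" "disjoint_family Q"
      using P Q unfolding partitions_def by blast+
    have sub: "P i \<subseteq> A" "Q i \<subseteq> B" for i using U by blast+
    define R where "R n = (if even n then P (n div 2) else Q (n div 2))" for n
    have "range R \<subseteq> sets borel" using P Q by (auto simp: R_def partitions_def)
    moreover have "(\<Union>i. R i) = A \<union> B"
    proof -
      have "P i = R (2 * i)" "Q i = R (2 * i + 1)" for i by (simp_all add: R_def)
      then have "(\<Union>i. P i) \<union> (\<Union>i. Q i) \<subseteq> (\<Union>i. R i)" by blast
      moreover have "(\<Union>i. R i) \<subseteq> (\<Union>i. P i) \<union> (\<Union>i. Q i)" by (auto simp: R_def split: if_splits)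
      ultimately show ?thesis unfolding U by (rule subset_antisym[rotated])
    qed
    moreover have "disjoint_family R"
      unfolding disjoint_family_on_def
    proof (intro ballI impI)
      fix m n :: nat assume mn: "m \<noteq> n"
      have PQ: "P i \<inter> Q j = {}" "Q j \<inter> P i = {}" for i j
        using sub(1)[of i] sub(2)[of j] AB(3) by blast+
      have div: "m div 2 \<noteq> n div 2" if "even m = even n"
        using that mn by presburger
      have dP: "P i \<inter> P j = {}" "Q i \<inter> Q j = {}" if "i \<noteq> j" for i j
        using dis that by (simp_all add: disjoint_family_on_def)
      show "R m \<inter> R n = {}"
        using PQ div dP by (cases "even m"; cases "even n") (simp_all add: R_def)
    qed
    ultimately have R: "R \<in> partitions (A \<union> B)" by (simp add: partitions_def)
    have "(\<Sum>i. ennreal (norm (\<nu> (P i)))) + (\<Sum>i. ennreal (norm (\<nu> (Q i))))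
        = (\<Sum>i. ennreal (norm (\<nu> (P i))) + ennreal (norm (\<nu> (Q i))))"
      by (intro suminf_add) auto
    also have "\<dots> \<le> (\<Sum>i. ennreal (norm (\<nu> (R i))))"
    proof (rule suminf_le_const)
      fix n
      have "(\<Sum>i<n. ennreal (norm (\<nu> (P i))) + ennreal (norm (\<nu> (Q i)))) = (\<Sum>i<2 * n. ennreal (norm (\<nu> (R i))))"
        by (induction n) (simp_all add: R_def add.assoc)
      also have "\<dots> \<le> (\<Sum>i. ennreal (norm (\<nu> (R i))))" by (intro sum_le_suminf) auto
      finally show "(\<Sum>i<n. ennreal (norm (\<nu> (P i))) + ennreal (norm (\<nu> (Q i)))) \<le> (\<Sum>i. ennreal (norm (\<nu> (R i))))" .
    qed auto
    also have "\<dots> \<le> variation \<nu> (A \<union> B)" unfolding variation_alt using R by (rule SUP_upper)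
    finally show ?thesis .
  qed
  have ne: "partitions E \<noteq> {}" if "E \<in> sets borel" for E :: "'a set"
    using binaryset_partition[of E "{}"] that by auto
  show ?thesis
    unfolding variation_alt[of \<nu> A] variation_alt[of \<nu> B]
    by (subst ennreal_SUP_add_left[OF ne[OF AB(1)], symmetric], rule SUP_least,
        subst ennreal_SUP_add_right[OF ne[OF AB(2)]], rule SUP_least) (rule *)
qed

lemma variation_mono:
  assumes "A \<in> sets borel" "B \<in> sets borel" "A \<subseteq> B"
  shows "variation \<nu> A \<le> variation \<nu> B"
proof -
  have "variation \<nu> A \<le> variation \<nu> A + variation \<nu> (B - A)" by simp
  also have "\<dots> \<le> variation \<nu> (A \<union> (B - A))" using assms by (intro variation_superadditive) auto
  finally show ?thesis using assms(3) by (simp add: Un_absorb1)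
qed

text \<open>Superadditivity and monotonicity bound all partial sums by the variation of the union.
  Conversely, a partition of the union is cut along the sets \<open>E i\<close>; the triangle
  inequality and an exchange of summations regroup it into partitions of the individual
  sets.\<close>

lemma variation_suminf:
  assumes E: "range E \<subseteq> sets borel" "disjoint_family E"
  shows "(\<Sum>i. variation \<nu> (E i)) = variation \<nu> (\<Union>i. E i)"
proof (rule antisym)
  show "(\<Sum>i. variation \<nu> (E i)) \<le> variation \<nu> (\<Union>i. E i)"
  proof (rule suminf_le_const)
    fix n :: nat
    have "(\<Sum>i<n. variation \<nu> (E i)) \<le> variation \<nu> (\<Union>i<n. E i)"
    proof (induction n)
      case 0
      then show ?case by (simp add: variation_empty)
    next
      case (Suc n)
      have "(\<Sum>i<Suc n. variation \<nu> (E i)) \<le> variation \<nu> (\<Union>i<n. E i) + variation \<nu> (E n)"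
        using Suc by (simp add: add_right_mono)
      also have "\<dots> \<le> variation \<nu> ((\<Union>i<n. E i) \<union> E n)"
      proof (rule variation_superadditive)
        show "(\<Union>i<n. E i) \<inter> E n = {}"
        proof -
          have "E i \<inter> E n = {}" if "i < n" for i
            using E(2) that by (simp add: disjoint_family_on_def)
          then show ?thesis by blast
        qed
      qed (use E(1) in auto)
      also have "(\<Union>i<n. E i) \<union> E n = (\<Union>i<Suc n. E i)" by (auto simp: less_Suc_eq)
      finally show ?case .
    qed
    also have "\<dots> \<le> variation \<nu> (\<Union>i. E i)" using E(1) by (intro variation_mono) auto
    finally show "(\<Sum>i<n. variation \<nu> (E i)) \<le> variation \<nu> (\<Union>i. E i)" .
  qed auto
  show "variation \<nu> (\<Union>i. E i) \<le> (\<Sum>i. variation \<nu> (E i))"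
    unfolding variation_alt[of \<nu> "\<Union>i. E i"]
  proof (rule SUP_least)
    fix A assume A: "A \<in> partitions (\<Union>i. E i)"
    have part: "(\<lambda>j. A j \<inter> E i) \<in> partitions (E i)" for i
    proof -
      have "range (\<lambda>j. A j \<inter> E i) \<subseteq> sets borel" using A E(1) by (auto simp: partitions_def)
      moreover have "disjoint_family (\<lambda>j. A j \<inter> E i)"
        using A unfolding partitions_def disjoint_family_on_def by blast
      moreover have "(\<Union>j. A j \<inter> E i) = E i" using A unfolding partitions_def by blast
      ultimately show ?thesis by (simp add: partitions_def)
    qed
    have "(\<Sum>j. ennreal (norm (\<nu> (A j)))) \<le> (\<Sum>j. \<Sum>i. ennreal (norm (\<nu> (A j \<inter> E i))))"
    proof (rule suminf_le)
      fix j
      have eq: "(\<Union>i. A j \<inter> E i) = A j" using A unfolding partitions_def by blast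
      have "(\<lambda>i. \<nu> (A j \<inter> E i)) sums \<nu> (\<Union>i. A j \<inter> E i)"
      proof (rule sums)
        show "range (\<lambda>i. A j \<inter> E i) \<subseteq> sets borel" using A E(1) by (auto simp: partitions_def)
        show "disjoint_family (\<lambda>i. A j \<inter> E i)" using E(2) unfolding disjoint_family_on_def by blast
      qed
      then show "ennreal (norm (\<nu> (A j))) \<le> (\<Sum>i. ennreal (norm (\<nu> (A j \<inter> E i))))"
        unfolding eq by (rule ennreal_norm_sums_le)
    qed auto
    also have "\<dots> = (\<Sum>i. \<Sum>j. ennreal (norm (\<nu> (A j \<inter> E i))))" by (rule ennreal_suminf_swap)
    also have "\<dots> \<le> (\<Sum>i. variation \<nu> (E i))"
    proof (rule suminf_le)
      show "(\<Sum>j. ennreal (norm (\<nu> (A j \<inter> E i)))) \<le> variation \<nu> (E i)" for i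
        unfolding variation_alt by (rule SUP_upper[OF part])
    qed auto
    finally show "(\<Sum>j. ennreal (norm (\<nu> (A j)))) \<le> (\<Sum>i. variation \<nu> (E i))" .
  qed
qed

lemma sets_variation_measure: "sets (variation_measure \<nu>) = sets borel"
  and space_variation_measure: "space (variation_measure \<nu>) = UNIV"
  unfolding variation_measure_def
  using sets.sigma_sets_eq[of "borel :: 'a measure"] by (simp_all add: space_measure_of_conv sets_measure_of_conv)

lemma emeasure_variation_measure:
  assumes "A \<in> sets borel"
  shows "emeasure (variation_measure \<nu>) A = variation \<nu> A"
  unfolding variation_measure_def
proof (rule emeasure_measure_of_sigma)
  show "sigma_algebra UNIV (sets (borel :: 'a measure))"
    using sets.sigma_algebra_axioms[of "borel :: 'a measure"] by simp
  show "positive (sets borel) (variation \<nu>)" by (simp add: positive_def variation_empty)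
  show "countably_additive (sets borel) (variation \<nu>)"
    by (intro countably_additiveI variation_suminf)
qed (rule assms)

end

lemma variation_measure_facts:
  fixes \<nu> :: "'a::topological_space set \<Rightarrow> 'b::real_normed_vector"
  assumes "finite_vector_measure \<nu>"
  shows "sets (variation_measure \<nu>) = sets borel" "space (variation_measure \<nu>) = UNIV"
    "finite_measure (variation_measure \<nu>)"
    "\<And>A. A \<in> sets borel \<Longrightarrow> emeasure (variation_measure \<nu>) A = variation \<nu> A"
    "\<And>A. A \<in> sets borel \<Longrightarrow> norm (\<nu> A) \<le> measure (variation_measure \<nu>) A"
proof -
  note s = finite_vector_measure_sums[OF assms]
  show *: "sets (variation_measure \<nu>) = sets borel" "space (variation_measure \<nu>) = UNIV"
    by (rule sets_variation_measure[OF s] space_variation_measure[OF s]; assumption)+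
  show em: "emeasure (variation_measure \<nu>) A = variation \<nu> A" if "A \<in> sets borel" for A
    by (rule emeasure_variation_measure[OF s that])
  have "variation \<nu> UNIV < \<infinity>" using assms unfolding finite_vector_measure_def by blast
  then show fin: "finite_measure (variation_measure \<nu>)"
    by (intro finite_measureI) (simp add: *(2) em)
  show "norm (\<nu> A) \<le> measure (variation_measure \<nu>) A" if "A \<in> sets borel" for A
  proof -
    have "ennreal (norm (\<nu> A)) \<le> ennreal (measure (variation_measure \<nu>) A)"
      using norm_le_variation[OF s that] em[OF that] finite_measure.emeasure_eq_measure[OF fin] by metis
    then show ?thesis by simp
  qed
qed

text \<open>Applying Radon-Nikodym to the nonnegative measure \<open>V + \<nu>\<close> avoids the Hahn decomposition.\<close>

lemma real_measure_density:
  fixes \<nu> :: "'a::topological_space set \<Rightarrow> real"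
  assumes V: "sets V = sets borel" "finite_measure V"
    and sums: "\<And>A :: nat \<Rightarrow> 'a set. range A \<subseteq> sets borel \<Longrightarrow> disjoint_family A \<Longrightarrow>
      (\<lambda>i. \<nu> (A i)) sums \<nu> (\<Union>i. A i)"
    and dom: "\<And>A. A \<in> sets borel \<Longrightarrow> \<bar>\<nu> A\<bar> \<le> measure V A"
  obtains f where "f \<in> borel_measurable borel" "integrable V f"
    "\<And>A. A \<in> sets borel \<Longrightarrow> \<nu> A = (LINT z:A|V. f z)"
proof -
  interpret V: finite_measure V by (rule V(2))
  have sp: "space V = UNIV" using sets_eq_imp_space_eq[OF V(1)] by simp
  note mV = measurable_cong_sets[OF V(1) refl]
  define N where "N = measure_of UNIV (sets borel) (\<lambda>A. ennreal (measure V A + \<nu> A))"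
  have sN: "sets N = sets borel"
    unfolding N_def using sets.sigma_sets_eq[of "borel :: 'a measure"] by (simp add: sets_measure_of_conv)
  have spN: "space N = UNIV" unfolding N_def by (simp add: space_measure_of_conv)
  have nonneg: "0 \<le> measure V A + \<nu> A" if "A \<in> sets borel" for A
    using dom[OF that] by linarith
  have eN: "emeasure N A = ennreal (measure V A + \<nu> A)" if "A \<in> sets borel" for A
    unfolding N_def
  proof (rule emeasure_measure_of_sigma[OF _ _ _ that])
    show "sigma_algebra UNIV (sets (borel :: 'a measure))"
      using sets.sigma_algebra_axioms[of "borel :: 'a measure"] by simp
    show "positive (sets borel) (\<lambda>A. ennreal (measure V A + \<nu> A))"
      by (simp add: positive_def vector_measure_empty[OF sums])
    show "countably_additive (sets borel) (\<lambda>A. ennreal (measure V A + \<nu> A))"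
    proof (rule countably_additiveI)
      fix A :: "nat \<Rightarrow> 'a set"
      assume A: "range A \<subseteq> sets borel" "disjoint_family A"
      have "(\<lambda>i. measure V (A i) + \<nu> (A i)) sums (measure V (\<Union>i. A i) + \<nu> (\<Union>i. A i))"
        using A V(1) by (intro sums_add sums V.finite_measure_UNION) auto
      then show "(\<Sum>i. ennreal (measure V (A i) + \<nu> (A i))) = ennreal (measure V (\<Union>i. A i) + \<nu> (\<Union>i. A i))"
        using A(1) by (intro suminf_ennreal_eq nonneg) auto
    qed
  qed
  have finN: "finite_measure N" by (intro finite_measureI) (simp add: spN eN)
  have ac: "absolutely_continuous V N"
    unfolding absolutely_continuous_def
  proof
    fix A assume "A \<in> null_sets V"
    then have "A \<in> sets borel" "measure V A = 0" using V(1) by (auto simp: null_sets_def measure_def)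
    moreover from this have "\<nu> A = 0" using dom[of A] by simp
    ultimately show "A \<in> null_sets N" by (simp add: null_sets_def sN eN)
  qed
  have sNV: "sets N = sets V" using sN V(1) by simp
  obtain D where D: "D \<in> borel_measurable V" "AE x in V. RN_deriv V N x = ennreal (D x)" "\<And>x. 0 \<le> D x"
    using V.real_RN_deriv[OF finN ac sNV] by metis
  have NA: "(\<integral>\<^sup>+x. ennreal (D x) * indicator A x \<partial>V) = ennreal (measure V A + \<nu> A)" if A: "A \<in> sets borel" for A
  proof -
    have "(\<integral>\<^sup>+x. ennreal (D x) * indicator A x \<partial>V) = (\<integral>\<^sup>+x. RN_deriv V N x * indicator A x \<partial>V)"
      using D(2) by (intro nn_integral_cong_AE) (auto elim: eventually_mono)
    also have "\<dots> = emeasure (density V (RN_deriv V N)) A"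
      using A V(1) by (subst emeasure_density) auto
    also have "\<dots> = emeasure N A" by (simp add: V.density_RN_deriv[OF ac sNV])
    finally show ?thesis using eN[OF A] by simp
  qed
  have iD: "integrable V D"
    using NA[of UNIV] D(1,3) by (simp add: integrable_iff_bounded)
  have DA: "(LINT z:A|V. D z) = measure V A + \<nu> A" if A: "A \<in> sets borel" for A
  proof -
    have "(LINT z:A|V. D z) = enn2real (\<integral>\<^sup>+x. ennreal (indicat_real A x * D x) \<partial>V)"
      unfolding set_lebesgue_integral_def using D(1,3) A V(1) by (subst integral_eq_nn_integral) auto
    also have "(\<lambda>x. ennreal (indicat_real A x * D x)) = (\<lambda>x. ennreal (D x) * indicator A x)"
      by (auto simp: indicator_def)
    finally show ?thesis using NA[OF A] nonneg[OF A] by simp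
  qed
  show ?thesis
  \<comment> \<open>\<open>D\<close> is the density of \<open>V + \<nu>\<close>, from which the
    constant density of \<open>V\<close> is subtracted.\<close>
  proof (rule that[of "\<lambda>z. D z - 1"])
    show "(\<lambda>z. D z - 1) \<in> borel_measurable borel"
      using D(1) unfolding mV by (intro borel_measurable_diff borel_measurable_const)
    show "integrable V (\<lambda>z. D z - 1)" using iD by simp
    fix A :: "'a set" assume A: "A \<in> sets borel"
    have sD: "set_integrable V A D" "set_integrable V A (\<lambda>_. 1)"
      using A V(1) iD integrable_mult_indicator[of A V D] integrable_mult_indicator[of A V "\<lambda>_. 1 :: real"]
      unfolding set_integrable_def by simp_all
    have "(LINT z:A|V. D z - 1) = (LINT z:A|V. D z) - (LINT z:A|V. 1)"
      by (rule set_integral_diff(2)[OF sD])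
    also have "(LINT z:A|V. 1) = measure V A"
      using A V(1) by (simp add: set_lebesgue_integral_def sp)
    finally show "\<nu> A = (LINT z:A|V. D z - 1)" using DA[OF A] by simp
  qed
qed

section \<open>The polar decomposition of a vector measure\<close>

lemma norm_le_1_of_inner_le:
  fixes x :: "'b::euclidean_space"
  assumes D: "closure D = UNIV" and le: "\<And>q. q \<in> D \<Longrightarrow> x \<bullet> q \<le> norm q"
  shows "norm x \<le> 1"
proof -
  have "closed {q. x \<bullet> q \<le> norm q}" by (intro closed_Collect_le continuous_intros)
  then have "closure D \<subseteq> {q. x \<bullet> q \<le> norm q}" using le by (intro closure_minimal) auto
  then have "x \<bullet> x \<le> norm x" using D by auto
  then have "norm x * norm x \<le> norm x * 1" by (simp add: dot_square_norm power2_eq_square)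
  then show ?thesis by (cases "x = 0") auto
qed

text \<open>Radon-Nikodym, applied to each coordinate against the variation, yields a density
  \<open>\<tau>\<close>. Its norm is at most 1 almost everywhere because the values of
  \<open>\<nu>\<close> are bounded by the variation, and it cannot be smaller on a set of positive
  measure because the variation is a supremum over partitions.\<close>

lemma polar_exists:
  fixes \<nu> :: "'a::topological_space set \<Rightarrow> 'b::euclidean_space"
  assumes fvm: "finite_vector_measure \<nu>"
  shows "\<exists>\<sigma>. is_polar \<nu> \<sigma>"
proof -
  define V where "V = variation_measure \<nu>"
  note facts = variation_measure_facts[OF fvm, folded V_def]
  interpret V: finite_measure V by (rule facts(3))
  note mV = measurable_cong_sets[OF facts(1) refl]
  have "\<exists>f. f \<in> borel_measurable borel \<and> integrable V f \<and>
      (\<forall>A\<in>sets borel. \<nu> A \<bullet> b = (LINT z:A|V. f z))" if b: "b \<in> Basis" for b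
  proof -
    obtain f where "f \<in> borel_measurable borel" "integrable V f"
      "\<And>A. A \<in> sets borel \<Longrightarrow> \<nu> A \<bullet> b = (LINT z:A|V. f z)"
    proof (rule real_measure_density[OF facts(1,3), of "\<lambda>A. \<nu> A \<bullet> b"])
      fix A :: "nat \<Rightarrow> 'a set"
      assume A: "range A \<subseteq> sets borel" "disjoint_family A"
      show "(\<lambda>i. \<nu> (A i) \<bullet> b) sums (\<nu> (\<Union>i. A i) \<bullet> b)"
        by (rule bounded_linear.sums[OF bounded_linear_inner_left finite_vector_measure_sums[OF fvm A]])
    next
      fix A :: "'a set" assume A: "A \<in> sets borel"
      show "\<bar>\<nu> A \<bullet> b\<bar> \<le> measure V A"
        using Basis_le_norm[OF b, of "\<nu> A"] facts(5)[OF A] by linarith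
    qed blast
    then show ?thesis by blast
  qed
  then obtain f where f: "\<And>b. b \<in> Basis \<Longrightarrow> f b \<in> borel_measurable borel"
    "\<And>b. b \<in> Basis \<Longrightarrow> integrable V (f b)"
    "\<And>b A. b \<in> Basis \<Longrightarrow> A \<in> sets borel \<Longrightarrow> \<nu> A \<bullet> b = (LINT z:A|V. f b z)"
    by metis
  define \<tau> where "\<tau> z = (\<Sum>b\<in>Basis. f b z *\<^sub>R b)" for z
  have \<tau>m: "\<tau> \<in> borel_measurable borel"
    unfolding \<tau>_def using f(1) by (intro borel_measurable_sum borel_measurable_scaleR) auto
  have i\<tau>: "integrable V \<tau>"
    unfolding \<tau>_def using f(2) by (intro Bochner_Integration.integrable_sum integrable_scaleR_left) auto
  have si: "integrable V (\<lambda>z. indicat_real A z *\<^sub>R \<tau> z)" if "A \<in> sets borel" for A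
    using that i\<tau> facts(1) by (intro integrable_mult_indicator) auto
  have rep: "\<nu> A = (LINT z:A|V. \<tau> z)" if A: "A \<in> sets borel" for A
  proof (rule euclidean_eqI)
    fix b :: 'b assume b: "b \<in> Basis"
    have "(LINT z:A|V. \<tau> z) \<bullet> b = (LINT z|V. (indicat_real A z *\<^sub>R \<tau> z) \<bullet> b)"
      unfolding set_lebesgue_integral_def using si[OF A] by (intro integral_inner_left[symmetric]) auto
    also have "(\<lambda>z. (indicat_real A z *\<^sub>R \<tau> z) \<bullet> b) = (\<lambda>z. indicat_real A z *\<^sub>R f b z)"
      using b by (auto simp: \<tau>_def inner_sum_left_Basis)
    finally show "\<nu> A \<bullet> b = (LINT z:A|V. \<tau> z) \<bullet> b"
      using f(3)[OF b A] by (simp add: set_lebesgue_integral_def)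
  qed
  have AEq: "AE z in V. \<tau> z \<bullet> q \<le> norm q" for q
  proof -
    \<comment> \<open>If \<open>A\<close> had positive measure, integrating over it would make
      \<open>\<nu> A \<bullet> q\<close> exceed \<open>measure V A * norm q\<close>, against the
      Cauchy-Schwarz inequality.\<close>
    define A where "A = {z. norm q < \<tau> z \<bullet> q}"
    have "(\<lambda>z. \<tau> z \<bullet> q) \<in> borel_measurable borel" using \<tau>m by simp
    then have "{z \<in> space borel. norm q < \<tau> z \<bullet> q} \<in> sets borel" by (rule borel_measurable_less[OF borel_measurable_const])
    then have A: "A \<in> sets borel" by (simp add: A_def)
    define g where "g z = indicat_real A z * (\<tau> z \<bullet> q - norm q)" for z
    have i1: "integrable V (\<lambda>z. (indicat_real A z *\<^sub>R \<tau> z) \<bullet> q)"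
      using si[OF A] by (rule integrable_inner_left[rotated]) 
    have i2: "integrable V (\<lambda>z. indicat_real A z * norm q)"
      using A facts(1) by (intro integrable_mult_left) (simp add: integrable_indicator_iff facts(2) V.emeasure_eq_measure)
    have geq: "g = (\<lambda>z. (indicat_real A z *\<^sub>R \<tau> z) \<bullet> q - indicat_real A z * norm q)"
      by (auto simp: g_def algebra_simps)
    have ig: "integrable V g" unfolding geq by (rule Bochner_Integration.integrable_diff[OF i1 i2])
    have g0: "0 \<le> g z" for z by (simp add: g_def A_def indicator_def)
    have "(LINT z|V. g z) = (LINT z|V. (indicat_real A z *\<^sub>R \<tau> z) \<bullet> q) - (LINT z|V. indicat_real A z * norm q)"
      unfolding geq by (rule Bochner_Integration.integral_diff[OF i1 i2])
    also have "(LINT z|V. (indicat_real A z *\<^sub>R \<tau> z) \<bullet> q) = \<nu> A \<bullet> q"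
      unfolding rep[OF A] set_lebesgue_integral_def using si[OF A] by (intro integral_inner_left) auto
    also have "(LINT z|V. indicat_real A z * norm q) = measure V A * norm q"
      using A by (simp add: facts(2))
    also have "\<nu> A \<bullet> q - measure V A * norm q \<le> 0"
      using norm_cauchy_schwarz[of "\<nu> A" q] mult_right_mono[OF facts(5)[OF A] norm_ge_zero[of q]] by linarith
    finally have "(LINT z|V. g z) = 0"
      by (intro antisym Bochner_Integration.integral_nonneg g0)
    then have "AE z in V. g z = 0"
      using integral_nonneg_eq_0_iff_AE[OF ig] g0 by simp
    then show ?thesis by (rule AE_mp) (auto simp: g_def A_def indicator_def)
  qed
  obtain D :: "'b set" where D: "countable D" "closure D = UNIV"
  proof -
    obtain D :: "'b set" where "countable D" "\<And>X. open X \<Longrightarrow> X \<noteq> {} \<Longrightarrow> \<exists>d\<in>D. d \<in> X"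
      using countable_dense_exists by metis
    then show ?thesis
      using that[of D] by (fastforce simp: closure_iff_nhds_not_empty)
  qed
  \<comment> \<open>Countability of \<open>D\<close> provides one null set for all its elements;
    density then reaches the choice of \<open>q\<close> equal to the density vector itself.\<close>
  have "AE z in V. \<forall>q\<in>D. \<tau> z \<bullet> q \<le> norm q"
    using D(1) AEq by (simp add: AE_ball_countable)
  then have le1: "AE z in V. norm (\<tau> z) \<le> 1"
    by (rule AE_mp) (auto intro!: AE_I2 norm_le_1_of_inner_le[OF D(2)])
  have inorm: "integrable V (\<lambda>z. norm (\<tau> z))" using i\<tau> by simp
  \<comment> \<open>Each partition sum of norms is at most the integral of
    \<open>norm (\<tau> z)\<close>, hence so is the total mass. Together with the upper bound 1 this
    forces equality almost everywhere.\<close>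
  have "emeasure V UNIV \<le> (\<integral>\<^sup>+z. ennreal (norm (\<tau> z)) \<partial>V)"
    unfolding facts(4)[of UNIV, simplified] variation_alt
  proof (rule SUP_least)
    fix A :: "nat \<Rightarrow> 'a set" assume "A \<in> partitions UNIV"
    then have A: "range A \<subseteq> sets borel" "disjoint_family A" "(\<Union>i. A i) = UNIV"
      by (auto simp: partitions_def)
    let ?N = "density V (\<lambda>z. ennreal (norm (\<tau> z)))"
    have "ennreal (norm (\<nu> (A i))) \<le> emeasure ?N (A i)" for i
    proof -
      have Ai: "A i \<in> sets borel" using A(1) by auto
      have "ennreal (norm (\<nu> (A i))) \<le> (\<integral>\<^sup>+z. ennreal (norm (indicat_real (A i) z *\<^sub>R \<tau> z)) \<partial>V)"
        unfolding rep[OF Ai] set_lebesgue_integral_def by (rule integral_norm_bound_ennreal[OF si[OF Ai]])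
      also have "\<dots> = emeasure ?N (A i)"
        using Ai \<tau>m facts(1) mV by (subst emeasure_density) (auto intro!: nn_integral_cong simp: indicator_def)
      finally show ?thesis .
    qed
    then have "(\<Sum>i. ennreal (norm (\<nu> (A i)))) \<le> (\<Sum>i. emeasure ?N (A i))"
      by (intro suminf_le) auto
    also have "\<dots> = emeasure ?N (\<Union>i. A i)"
      using A facts(1) by (intro suminf_emeasure) auto
    also have "\<dots> = (\<integral>\<^sup>+z. ennreal (norm (\<tau> z)) \<partial>V)"
      unfolding A(3) using \<tau>m mV facts(1,2) by (subst emeasure_density) auto
    finally show "(\<Sum>i. ennreal (norm (\<nu> (A i)))) \<le> (\<integral>\<^sup>+z. ennreal (norm (\<tau> z)) \<partial>V)" .
  qed
  also have "\<dots> = ennreal (LINT z|V. norm (\<tau> z))"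
    by (rule nn_integral_eq_integral[OF inorm]) simp
  finally have "measure V UNIV \<le> (LINT z|V. norm (\<tau> z))"
    by (simp add: V.emeasure_eq_measure)
  then have "(LINT z|V. 1 - norm (\<tau> z)) \<le> 0"
    using inorm by (simp add: facts(2))
  moreover have AE0: "AE z in V. 0 \<le> 1 - norm (\<tau> z)" using le1 by (rule AE_mp) simp
  ultimately have "(LINT z|V. 1 - norm (\<tau> z)) = 0"
    using integral_nonneg_AE[OF AE0] by simp
  then have "AE z in V. 1 - norm (\<tau> z) = 0"
    using integral_nonneg_eq_0_iff_AE[OF _ AE0] inorm by simp
  then have eq1: "AE z in V. norm (\<tau> z) = 1" by (rule AE_mp) simp
  obtain b0 :: 'b where b0: "b0 \<in> Basis" using nonempty_Basis by blast
  \<comment> \<open>\<open>is_polar\<close> demands norm 1 at every point, so a unit vector is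
    inserted on the exceptional null set.\<close>
  define \<sigma> where "\<sigma> z = (if norm (\<tau> z) = 1 then \<tau> z else b0)" for z
  have "is_polar \<nu> \<sigma>"
    unfolding is_polar_def V_def[symmetric]
  proof (intro conjI ballI allI)
    show \<sigma>m: "\<sigma> \<in> borel_measurable borel"
      unfolding \<sigma>_def using \<tau>m by measurable
    show "norm (\<sigma> z) = 1" for z using b0 by (simp add: \<sigma>_def)
    fix A :: "'a set" assume A: "A \<in> sets borel"
    have "(LINT z:A|V. \<tau> z) = (LINT z:A|V. \<sigma> z)"
      unfolding set_lebesgue_integral_def
    proof (rule integral_cong_AE)
      show "AE z in V. indicat_real A z *\<^sub>R \<tau> z = indicat_real A z *\<^sub>R \<sigma> z"
        using eq1 by (rule AE_mp) (simp add: \<sigma>_def)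
    qed (use A \<tau>m \<sigma>m mV facts(1) in auto)
    then show "\<nu> A = (LINT z:A|V. \<sigma> z)" using rep[OF A] by simp
  qed
  then show ?thesis by blast
qed

lemma is_polar_polar:
  fixes \<nu> :: "'a::topological_space set \<Rightarrow> 'b::euclidean_space"
  assumes "finite_vector_measure \<nu>"
  shows "is_polar \<nu> (polar \<nu>)"
  unfolding polar_def using polar_exists[OF assms] by (rule someI_ex)

section \<open>Comparison of integrals, and the minimum of two nonnegative measures\<close>

lemma measure_density_set_integral:
  fixes f :: "'a \<Rightarrow> real"
  assumes f: "integrable V f" "\<And>z. 0 \<le> f z" and A: "A \<in> sets V"
  shows "measure (density V (\<lambda>z. ennreal (f z))) A = (LINT z:A|V. f z)"
proof -
  have "(LINT z:A|V. f z) = enn2real (\<integral>\<^sup>+z. ennreal (indicat_real A z * f z) \<partial>V)"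
    unfolding set_lebesgue_integral_def real_scaleR_def
    using f A by (intro integral_eq_nn_integral) auto
  also have "(\<lambda>z. ennreal (indicat_real A z * f z)) = (\<lambda>z. ennreal (f z) * indicator A z)"
    by (auto simp: indicator_def)
  also have "(\<integral>\<^sup>+z. ennreal (f z) * indicator A z \<partial>V) = emeasure (density V (\<lambda>z. ennreal (f z))) A"
    using f A by (subst emeasure_density) auto
  finally show ?thesis by (simp add: measure_def)
qed

lemma finite_measure_density_integrable:
  fixes f :: "'a \<Rightarrow> real"
  assumes "integrable V f" "\<And>z. 0 \<le> f z"
  shows "finite_measure (density V (\<lambda>z. ennreal (f z)))"
  using assms by (intro finite_measureI) (simp add: emeasure_density integrable_iff_bounded less_top)

text \<open>The hypothesis on sets says that \<open>m\<close> lies below the measure with density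
  \<open>p\<close>, so integrals of nonnegative functions compare; finiteness transfers this to
  real-valued integrals.\<close>

lemma integral_le_of_measure_le:
  fixes f p :: "'a::topological_space \<Rightarrow> real"
  assumes m: "sets m = sets borel" "finite_measure m" and V: "sets V = sets borel"
    and p: "integrable V p" "\<And>z. 0 \<le> p z"
    and dom: "\<And>A. A \<in> sets borel \<Longrightarrow> measure m A \<le> (LINT z:A|V. p z)"
    and f: "f \<in> borel_measurable borel" "\<And>z. 0 \<le> f z" "\<And>z. f z \<le> 1"
  shows "(LINT z|m. f z) \<le> (LINT z|V. f z * p z)"
proof -
  let ?N = "density V (\<lambda>z. ennreal (p z))"
  interpret m: finite_measure m by (rule m(2))
  interpret N: finite_measure ?N by (rule finite_measure_density_integrable[OF p])
  note mm = measurable_cong_sets[OF m(1) refl] and mV = measurable_cong_sets[OF V refl]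
  have le: "m \<le> ?N"
    using m(1) V dom measure_density_set_integral[OF p]
    by (subst le_measure) (auto simp: m.emeasure_eq_measure N.emeasure_eq_measure intro!: ennreal_leI)
  have fm: "f \<in> borel_measurable m" and fV: "f \<in> borel_measurable V"
    using f(1) unfolding mm mV by auto
  have fN: "f \<in> borel_measurable ?N" using fV by simp
  have bound: "(\<integral>\<^sup>+z. ennreal (f z) \<partial>?N) < \<infinity>"
  proof -
    have "integrable ?N f"
      using f fN by (intro N.integrable_const_bound[of _ 1]) auto
    then show ?thesis using f(2) by (simp add: integrable_iff_bounded)
  qed
  have "(LINT z|m. f z) = enn2real (\<integral>\<^sup>+z. ennreal (f z) \<partial>m)"
    using fm f(2) by (intro integral_eq_nn_integral) auto
  also have "\<dots> \<le> enn2real (\<integral>\<^sup>+z. ennreal (f z) \<partial>?N)"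
  proof (rule enn2real_mono)
    show "(\<integral>\<^sup>+z. ennreal (f z) \<partial>m) \<le> (\<integral>\<^sup>+z. ennreal (f z) \<partial>?N)"
      using m(1) V le by (intro nn_integral_mono_measure) auto
  qed (use bound in simp)
  also have "\<dots> = (LINT z|?N. f z)"
    using fN f(2) by (intro integral_eq_nn_integral[symmetric]) auto
  also have "\<dots> = (LINT z|V. p z * f z)"
    using fV p by (subst integral_density) auto
  finally show ?thesis by (simp add: mult.commute)
qed

lemma polar_borel_measurable:
  fixes \<nu> :: "'a::topological_space set \<Rightarrow> 'b::euclidean_space"
  assumes "finite_vector_measure \<nu>" and g: "g \<in> borel_measurable borel"
  shows "(\<lambda>z. g (polar \<nu> z)) \<in> borel_measurable (variation_measure \<nu>)"
proof -
  have "polar \<nu> \<in> borel_measurable borel"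
    using is_polar_polar[OF assms(1)] unfolding is_polar_def by blast
  then have "(\<lambda>z. g (polar \<nu> z)) \<in> borel_measurable borel" by (rule measurable_compose[OF _ g])
  then show ?thesis
    by (simp only: measurable_cong_sets[OF variation_measure_facts(1)[OF assms(1)] refl])
qed

lemma norm_polar:
  fixes \<nu> :: "'a::topological_space set \<Rightarrow> 'b::euclidean_space"
  assumes "finite_vector_measure \<nu>"
  shows "norm (polar \<nu> z) = 1"
  using is_polar_polar[OF assms] unfolding is_polar_def by blast

lemma integrable_polar:
  fixes \<nu> :: "'a::topological_space set \<Rightarrow> 'b::euclidean_space" and g :: "'b \<Rightarrow> real"
  assumes fvm: "finite_vector_measure \<nu>" and g: "g \<in> borel_measurable borel" "\<And>v. \<bar>g v\<bar> \<le> norm v"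
  shows "integrable (variation_measure \<nu>) (\<lambda>z. g (polar \<nu> z))"
proof -
  interpret finite_measure "variation_measure \<nu>" by (rule variation_measure_facts(3)[OF fvm])
  have "\<bar>g (polar \<nu> z)\<bar> \<le> 1" for z using g(2)[of "polar \<nu> z"] norm_polar[OF fvm, of z] by simp
  then show ?thesis
    using polar_borel_measurable[OF fvm g(1)] by (intro integrable_const_bound[of _ 1]) auto
qed

lemma variation_eq_of_nonneg:
  fixes \<mu> :: "'a::topological_space set \<Rightarrow> real"
  assumes sums: "\<And>A :: nat \<Rightarrow> 'a set. range A \<subseteq> sets borel \<Longrightarrow> disjoint_family A \<Longrightarrow>
      (\<lambda>i. \<mu> (A i)) sums \<mu> (\<Union>i. A i)"
    and nonneg: "\<And>A. A \<in> sets borel \<Longrightarrow> 0 \<le> \<mu> A" and E: "E \<in> sets borel"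
  shows "variation \<mu> E = ennreal (\<mu> E)"
proof (rule antisym)
  show "variation \<mu> E \<le> ennreal (\<mu> E)"
    unfolding variation_alt
  proof (rule SUP_least)
    fix A assume "A \<in> partitions E"
    then have A: "range A \<subseteq> sets borel" "disjoint_family A" "(\<Union>i. A i) = E"
      unfolding partitions_def by blast+
    have A': "A i \<in> sets borel" for i using A(1) by auto
    have "(\<Sum>i. ennreal (norm (\<mu> (A i)))) = (\<Sum>i. ennreal (\<mu> (A i)))"
      using nonneg[OF A'] by simp
    also have "\<dots> = ennreal (\<mu> E)"
      using sums[OF A(1,2)] nonneg[OF A'] unfolding A(3) by (intro suminf_ennreal_eq)
    finally show "(\<Sum>i. ennreal (norm (\<mu> (A i)))) \<le> ennreal (\<mu> E)" by simp
  qed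
  show "ennreal (\<mu> E) \<le> variation \<mu> E"
    using norm_le_variation[of \<mu>, OF sums E] nonneg[OF E] by simp
qed

text \<open>On every Borel set the variation of the difference is at most the sum of the two
  measures, which gives nonnegativity, and at least the absolute value of the difference, which puts
  the minimum below each of them. Being nonnegative, the minimum coincides with its own
  variation.\<close>

lemma min_measure_facts:
  fixes \<mu> \<nu> :: "'a::topological_space set \<Rightarrow> real"
  assumes s\<mu>: "\<And>A :: nat \<Rightarrow> 'a set. range A \<subseteq> sets borel \<Longrightarrow> disjoint_family A \<Longrightarrow>
      (\<lambda>i. \<mu> (A i)) sums \<mu> (\<Union>i. A i)"
    and s\<nu>: "\<And>A :: nat \<Rightarrow> 'a set. range A \<subseteq> sets borel \<Longrightarrow> disjoint_family A \<Longrightarrow>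
      (\<lambda>i. \<nu> (A i)) sums \<nu> (\<Union>i. A i)"
    and n\<mu>: "\<And>A. A \<in> sets borel \<Longrightarrow> 0 \<le> \<mu> A" and n\<nu>: "\<And>A. A \<in> sets borel \<Longrightarrow> 0 \<le> \<nu> A"
  shows "finite_vector_measure (min_measure \<mu> \<nu>)"
    "\<And>A. A \<in> sets borel \<Longrightarrow> measure (variation_measure (min_measure \<mu> \<nu>)) A = min_measure \<mu> \<nu> A"
    "\<And>A. A \<in> sets borel \<Longrightarrow> min_measure \<mu> \<nu> A \<le> \<mu> A"
    "\<And>A. A \<in> sets borel \<Longrightarrow> min_measure \<mu> \<nu> A \<le> \<nu> A"
proof -
  define D where "D A = \<mu> A - \<nu> A" for A
  define s where "s A = \<mu> A + \<nu> A" for A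
  have ss: "(\<lambda>i. s (A i)) sums s (\<Union>i. A i)" if "range A \<subseteq> sets borel" "disjoint_family A" for A :: "nat \<Rightarrow> 'a set"
    unfolding s_def using that by (intro sums_add s\<mu> s\<nu>)
  have sD: "(\<lambda>i. D (A i)) sums D (\<Union>i. A i)" if "range A \<subseteq> sets borel" "disjoint_family A" for A :: "nat \<Rightarrow> 'a set"
    unfolding D_def using that by (intro sums_diff s\<mu> s\<nu>)
  have ns: "0 \<le> s A" if "A \<in> sets borel" for A
    using n\<mu>[OF that] n\<nu>[OF that] by (simp add: s_def)
  have vD: "variation D E \<le> ennreal (s E)" if E: "E \<in> sets borel" for E
  proof -
    have "variation D E \<le> variation s E"
      unfolding variation_alt
    proof (rule SUP_mono)
      fix A assume A: "A \<in> partitions E"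
      have "norm (D (A i)) \<le> norm (s (A i))" for i
      proof -
        have "A i \<in> sets borel" using A unfolding partitions_def by blast
        then show ?thesis using n\<mu>[of "A i"] n\<nu>[of "A i"] by (simp add: D_def s_def)
      qed
      then have "(\<Sum>i. ennreal (norm (D (A i)))) \<le> (\<Sum>i. ennreal (norm (s (A i))))"
        by (intro suminf_le ennreal_leI) auto
      then show "\<exists>B\<in>partitions E. (\<Sum>i. ennreal (norm (D (A i)))) \<le> (\<Sum>i. ennreal (norm (s (B i))))"
        using A by blast
    qed
    also have "\<dots> = ennreal (s E)" by (rule variation_eq_of_nonneg[OF ss ns E])
    finally show ?thesis .
  qed
  have fD: "finite_vector_measure D"
    unfolding finite_vector_measure_def using sD vD[of UNIV] by (auto intro: order_le_less_trans)
  note K = variation_measure_facts[OF fD]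
  interpret K: finite_measure "variation_measure D" by (rule K(3))
  have m_def: "min_measure \<mu> \<nu> A = (s A - measure (variation_measure D) A) / 2" for A
    unfolding min_measure_def s_def D_def[abs_def] by simp
  have Ks: "measure (variation_measure D) A \<le> s A" if A: "A \<in> sets borel" for A
  proof -
    have "ennreal (measure (variation_measure D) A) \<le> ennreal (s A)"
      using vD[OF A] K(4)[OF A] by (simp add: K.emeasure_eq_measure)
    then show ?thesis using ns[OF A] by simp
  qed
  have nm: "0 \<le> min_measure \<mu> \<nu> A" if "A \<in> sets borel" for A
    using Ks[OF that] unfolding m_def by simp
  have sm: "(\<lambda>i. min_measure \<mu> \<nu> (A i)) sums min_measure \<mu> \<nu> (\<Union>i. A i)"
    if A: "range A \<subseteq> sets borel" "disjoint_family A" for A :: "nat \<Rightarrow> 'a set"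
    unfolding m_def using A K(1) by (intro sums_divide sums_diff ss K.finite_measure_UNION) auto
  show "min_measure \<mu> \<nu> A \<le> \<mu> A" "min_measure \<mu> \<nu> A \<le> \<nu> A" if "A \<in> sets borel" for A
    using K(5)[OF that] unfolding m_def s_def D_def by (auto simp: abs_le_iff)
  show fm: "finite_vector_measure (min_measure \<mu> \<nu>)"
    unfolding finite_vector_measure_def using sm variation_eq_of_nonneg[OF sm nm, of UNIV] by auto
  show "measure (variation_measure (min_measure \<mu> \<nu>)) A = min_measure \<mu> \<nu> A" if A: "A \<in> sets borel" for A
    using variation_measure_facts(4)[OF fm A] variation_eq_of_nonneg[OF sm nm A] nm[OF A]
    by (simp add: measure_def)
qed

text \<open>The polar density is at most 1 and its integral equals the total mass, so it is 1 almost
  everywhere and \<open>vint\<close> becomes an ordinary integral.\<close>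

lemma vint_of_nonneg:
  fixes \<mu> :: "'a::topological_space set \<Rightarrow> real"
  assumes fvm: "finite_vector_measure \<mu>"
    and eq: "\<And>A. A \<in> sets borel \<Longrightarrow> measure (variation_measure \<mu>) A = \<mu> A"
    and f: "f \<in> borel_measurable borel"
  shows "vint \<mu> f = (LINT z|variation_measure \<mu>. f z)"
proof -
  note K = variation_measure_facts[OF fvm]
  interpret K: finite_measure "variation_measure \<mu>" by (rule K(3))
  have pol: "is_polar \<mu> (polar \<mu>)" by (rule is_polar_polar[OF fvm])
  have ip: "integrable (variation_measure \<mu>) (polar \<mu>)"
    using integrable_polar[OF fvm, of "\<lambda>v. v"] by simp
  have le: "polar \<mu> z \<le> 1" for z
    using norm_polar[OF fvm, of z] by simp
  have "measure (variation_measure \<mu>) UNIV = (LINT z:UNIV|variation_measure \<mu>. polar \<mu> z)"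
    using eq[of UNIV] pol unfolding is_polar_def by simp
  then have "(LINT z|variation_measure \<mu>. 1 - polar \<mu> z) = 0"
    using ip by (simp add: K(2) set_lebesgue_integral_def)
  then have "AE z in variation_measure \<mu>. 1 - polar \<mu> z = 0"
    using ip le by (subst (asm) integral_nonneg_eq_0_iff_AE) auto
  then have ae: "AE z in variation_measure \<mu>. f z \<bullet> polar \<mu> z = f z"
    by (rule AE_mp) simp
  have fm: "f \<in> borel_measurable (variation_measure \<mu>)"
    using f by (simp only: measurable_cong_sets[OF K(1) refl])
  show ?thesis
    unfolding vint_def using ae fm ip by (intro integral_cong_AE) auto
qed

lemma finite_vector_measure_Pair:
  fixes \<mu> \<nu> :: "'a::topological_space set \<Rightarrow> real"
  assumes \<mu>: "finite_vector_measure \<mu>" and \<nu>: "finite_vector_measure \<nu>"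
  shows "finite_vector_measure (\<lambda>A. (\<mu> A, \<nu> A))"
proof -
  have sums: "(\<lambda>i. (\<mu> (A i), \<nu> (A i))) sums (\<mu> (\<Union>i. A i), \<nu> (\<Union>i. A i))"
    if "range A \<subseteq> sets borel" "disjoint_family A" for A :: "nat \<Rightarrow> 'a set"
  proof -
    have "(\<Sum>i<n. (\<mu> (A i), \<nu> (A i))) = (\<Sum>i<n. \<mu> (A i), \<Sum>i<n. \<nu> (A i))" for n
      by (induction n) (simp_all add: zero_prod_def)
    then show ?thesis
      using finite_vector_measure_sums[OF \<mu> that] finite_vector_measure_sums[OF \<nu> that]
      unfolding sums_def by (simp add: tendsto_Pair)
  qed
  have "variation (\<lambda>A. (\<mu> A, \<nu> A)) UNIV \<le> variation \<mu> UNIV + variation \<nu> UNIV"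
    unfolding variation_alt[of "\<lambda>A. (\<mu> A, \<nu> A)"]
  proof (rule SUP_least)
    fix A :: "nat \<Rightarrow> 'a set" assume A: "A \<in> partitions UNIV"
    have "(\<Sum>i. ennreal (norm (\<mu> (A i), \<nu> (A i)))) \<le> (\<Sum>i. ennreal (norm (\<mu> (A i))) + ennreal (norm (\<nu> (A i))))"
    proof (rule suminf_le)
      show "ennreal (norm (\<mu> (A i), \<nu> (A i))) \<le> ennreal (norm (\<mu> (A i))) + ennreal (norm (\<nu> (A i)))" for i
        using norm_Pair_le[of "\<mu> (A i)" "\<nu> (A i)"] by (simp flip: ennreal_plus)
    qed auto
    also have "\<dots> = (\<Sum>i. ennreal (norm (\<mu> (A i)))) + (\<Sum>i. ennreal (norm (\<nu> (A i))))"
      by (intro suminf_add[symmetric]) auto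
    also have "\<dots> \<le> variation \<mu> UNIV + variation \<nu> UNIV"
      unfolding variation_alt using A by (intro add_mono SUP_upper)
    finally show "(\<Sum>i. ennreal (norm (\<mu> (A i), \<nu> (A i)))) \<le> variation \<mu> UNIV + variation \<nu> UNIV" .
  qed
  moreover have "variation \<mu> UNIV + variation \<nu> UNIV < \<infinity>"
    using \<mu> \<nu> unfolding finite_vector_measure_def by simp
  ultimately show ?thesis
    unfolding finite_vector_measure_def using sums by (blast intro: order_le_less_trans)
qed

section \<open>Conclusion\<close>

lemma cone_part_bounds:
  shows "0 \<le> xP v" "xP v \<le> norm v" "0 \<le> yP v" "yP v \<le> norm v"
    "0 \<le> xN v" "0 \<le> yN v"
  using norm_prod_le(2,3)[of v] by (auto simp: xP_def yP_def xN_def yN_def)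

lemma cone_part_measurable:
  "xP \<in> borel_measurable borel" "yP \<in> borel_measurable borel"
  unfolding xP_def[abs_def] yP_def[abs_def]
  by (intro borel_measurable_continuous_onI continuous_intros)+

section \<open>Fields that are vector measures\<close>

lemma has_div_pairing_measure:
  assumes S: "finite_vector_measure S" and D: "finite_vector_measure D" and div: "has_measure_div S D"
  shows "has_div_pairing (variation_measure S) (polar S) (variation_measure D) (polar D)"
  unfolding has_div_pairing_def
proof (intro conjI allI impI)
  show "f \<in> borel_measurable (variation_measure S)" "f \<in> borel_measurable (variation_measure D)"
    if "f \<in> borel_measurable borel" for f :: "real \<times> real \<Rightarrow> real"
    using that by (simp_all only: measurable_cong_sets[OF variation_measure_facts(1)[OF S] refl]
        measurable_cong_sets[OF variation_measure_facts(1)[OF D] refl])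
  have "fst \<in> borel_measurable (borel :: (real \<times> real) measure)" "snd \<in> borel_measurable (borel :: (real \<times> real) measure)"
    by (intro borel_measurable_continuous_onI continuous_intros)+
  then show "integrable (variation_measure S) (\<lambda>z. fst (polar S z))"
    "integrable (variation_measure S) (\<lambda>z. snd (polar S z))"
    using integrable_polar[OF S, of fst] integrable_polar[OF S, of snd] norm_prod_le(2,3) by blast+
  show "integrable (variation_measure D) (polar D)"
    using integrable_polar[OF D, of "\<lambda>v. v"] by simp
  fix \<phi> :: "real \<times> real \<Rightarrow> real" assume "test_function \<phi>"
  then have "vint S (grad \<phi>) = - vint D \<phi>" using div unfolding has_measure_div_def by blast
  then show "(LINT z|variation_measure S. fst (polar S z) * partial_x \<phi> z + snd (polar S z) * partial_y \<phi> z)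
      = - (LINT z|variation_measure D. polar D z * \<phi> z)"
    by (simp add: vint_def grad_def inner_prod_def mult.commute)
qed

text \<open>The minimum of the two polar images lies below both of them, which supplies the two
  domination hypotheses. Since the polar density of the divergence has absolute value 1, its
  integral is the total variation.\<close>

lemma measure_field_estimate:
  fixes S T :: "(real \<times> real) set \<Rightarrow> real \<times> real" and D D' :: "(real \<times> real) set \<Rightarrow> real"
  assumes S: "finite_vector_measure S" and T: "finite_vector_measure T"
    and D: "finite_vector_measure D" and D': "finite_vector_measure D'"
    and div: "has_measure_div S D" "has_measure_div T D'"
    and chi: "chi \<in> borel_measurable borel" "\<And>z. 0 \<le> chi z" "\<And>z. chi z \<le> 1" "bounded {z. chi z \<noteq> 0}"
  shows "vint (min_measure (polar_image xP S) (polar_image yP T)) chi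
    \<le> 48 * sqrt (LINT z|lborel. (chi z)\<^sup>2) * sqrt (total_variation S + total_variation D)
        * sqrt (total_variation T + total_variation D')
      + (polar_image xN S UNIV + polar_image yN T UNIV)"
proof -
  \<comment> \<open>Stated for a general part \<open>p\<close> of the field so that it serves both
    for \<open>xP\<close> with \<open>S\<close> and for \<open>yP\<close> with
    \<open>T\<close>.\<close>
  have density: "sets V = sets borel" "integrable V (\<lambda>z. p (polar W z))"
      "\<And>A. A \<in> sets borel \<Longrightarrow> polar_image p W A = measure (density V (\<lambda>z. ennreal (p (polar W z)))) A"
      "\<And>A. A \<in> sets borel \<Longrightarrow> 0 \<le> polar_image p W A"
      "\<And>A. range A \<subseteq> sets borel \<Longrightarrow> disjoint_family A \<Longrightarrow>
        (\<lambda>i. polar_image p W (A i)) sums polar_image p W (\<Union>i::nat. A i)"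
    if W: "finite_vector_measure W" and V: "V = variation_measure W"
      and p: "p \<in> borel_measurable borel" "\<And>v. 0 \<le> p v" "\<And>v. p v \<le> norm v"
    for W :: "(real \<times> real) set \<Rightarrow> real \<times> real" and p V
  proof -
    show sV: "sets V = sets borel" unfolding V by (rule variation_measure_facts(1)[OF W])
    show iP: "integrable V (\<lambda>z. p (polar W z))"
      unfolding V using p by (intro integrable_polar[OF W]) auto
    have eq: "polar_image p W A = measure (density V (\<lambda>z. ennreal (p (polar W z)))) A" if "A \<in> sets borel" for A
      unfolding polar_image_def V[symmetric]
      using measure_density_set_integral[OF iP p(2)] that sV by simp
    then show "\<And>A. A \<in> sets borel \<Longrightarrow> polar_image p W A = measure (density V (\<lambda>z. ennreal (p (polar W z)))) A"
      by blast
    then show "\<And>A. A \<in> sets borel \<Longrightarrow> 0 \<le> polar_image p W A" by simp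
    interpret finite_measure "density V (\<lambda>z. ennreal (p (polar W z)))"
      by (rule finite_measure_density_integrable[OF iP p(2)])
    fix A :: "nat \<Rightarrow> (real \<times> real) set" assume A: "range A \<subseteq> sets borel" "disjoint_family A"
    have "(\<lambda>i. measure (density V (\<lambda>z. ennreal (p (polar W z)))) (A i))
        sums measure (density V (\<lambda>z. ennreal (p (polar W z)))) (\<Union>i. A i)"
      using A sV by (intro finite_measure_UNION) auto
    moreover have "A i \<in> sets borel" "(\<Union>i. A i) \<in> sets borel" for i using A(1) by auto
    ultimately show "(\<lambda>i. polar_image p W (A i)) sums polar_image p W (\<Union>i. A i)"
      by (simp add: eq)
  qed
  note dS = density[OF S refl cone_part_measurable(1) cone_part_bounds(1,2)]
  note dT = density[OF T refl cone_part_measurable(2) cone_part_bounds(3,4)]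
  define m where "m = min_measure (polar_image xP S) (polar_image yP T)"
  have mf: "finite_vector_measure m"
    "\<And>A. A \<in> sets borel \<Longrightarrow> measure (variation_measure m) A = m A"
    "\<And>A. A \<in> sets borel \<Longrightarrow> m A \<le> polar_image xP S A"
    "\<And>A. A \<in> sets borel \<Longrightarrow> m A \<le> polar_image yP T A"
    unfolding m_def by (rule min_measure_facts[OF dS(5) dT(5) dS(4) dT(4)]; assumption)+
  note vm = variation_measure_facts[OF mf(1)]
  have mS: "measure (variation_measure m) A \<le> (LINT z:A|variation_measure S. xP (polar S z))"
    and mT: "measure (variation_measure m) A \<le> (LINT z:A|variation_measure T. yP (polar T z))"
    if "A \<in> sets borel" for A
    using mf(2-4)[OF that] unfolding polar_image_def by simp_all
  have tv: "0 \<le> total_variation W" for W :: "(real \<times> real) set \<Rightarrow> 'c::real_normed_vector"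
    by (simp add: total_variation_def)
  have td: "(LINT z|variation_measure W. \<bar>polar W z\<bar>) = total_variation W"
    if W: "finite_vector_measure W" for W :: "(real \<times> real) set \<Rightarrow> real"
    using norm_polar[OF W] by (simp add: total_variation_def variation_measure_facts(2)[OF W])
  have "(LINT z|variation_measure m. chi z)
    \<le> 48 * sqrt (LINT z|lborel. (chi z)\<^sup>2) * sqrt (total_variation S + total_variation D)
        * sqrt (total_variation T + total_variation D')
      + ((LINT z|variation_measure S. xN (polar S z)) + (LINT z|variation_measure T. yN (polar T z)))"
  proof (rule transversal_flux_estimate[OF has_div_pairing_measure[OF S D div(1)]
        has_div_pairing_measure[OF T D' div(2)] vm(1,3) _ _ chi])
    fix f :: "real \<times> real \<Rightarrow> real"
    assume f: "f \<in> borel_measurable borel" "\<And>z. 0 \<le> f z" "\<And>z. f z \<le> 1"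
    show "(LINT z|variation_measure m. f z) \<le> (LINT z|variation_measure S. f z * xP (polar S z))"
      by (rule integral_le_of_measure_le[OF vm(1,3) dS(1,2) cone_part_bounds(1) mS f])
    show "(LINT z|variation_measure m. f z) \<le> (LINT z|variation_measure T. f z * yP (polar T z))"
      by (rule integral_le_of_measure_le[OF vm(1,3) dT(1,2) cone_part_bounds(3) mT f])
  next
    show "(LINT z|variation_measure D. \<bar>polar D z\<bar>) \<le> total_variation S + total_variation D"
      "(LINT z|variation_measure D'. \<bar>polar D' z\<bar>) \<le> total_variation T + total_variation D'"
      using td[OF D] td[OF D'] tv[of S] tv[of T] by simp_all
  qed
  moreover have "vint m chi = (LINT z|variation_measure m. chi z)"
    by (rule vint_of_nonneg[OF mf(1,2) chi(1)])
  ultimately show ?thesis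
    unfolding m_def[symmetric] by (simp add: polar_image_def set_lebesgue_integral_def)
qed

section \<open>Sobolev fields\<close>

lemma weak_partials:
  assumes "W11 f"
  shows "integrable lebesgue f" "has_weak_partial_x f (weak_partial_x f)" "has_weak_partial_y f (weak_partial_y f)"
proof -
  have "\<exists>g. has_weak_partial_x f g" "\<exists>g. has_weak_partial_y f g" and "integrable lebesgue f"
    using assms unfolding W11_def by blast+
  then show "integrable lebesgue f" "has_weak_partial_x f (weak_partial_x f)"
    "has_weak_partial_y f (weak_partial_y f)"
    unfolding weak_partial_x_def weak_partial_y_def by (simp_all only: someI_ex)
qed

lemma lebesgue_borel_measurable:
  fixes f :: "'a::euclidean_space \<Rightarrow> real"
  assumes "f \<in> borel_measurable borel"
  shows "f \<in> borel_measurable lebesgue"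
  using assms by (intro measurable_completion) simp

lemma has_div_pairing_W11:
  assumes "W11_field S"
  shows "has_div_pairing lebesgue S lebesgue (weak_div S)"
proof -
  note x = weak_partials[of "\<lambda>z. fst (S z)"] and y = weak_partials[of "\<lambda>z. snd (S z)"]
  have W: "W11 (\<lambda>z. fst (S z))" "W11 (\<lambda>z. snd (S z))" using assms unfolding W11_field_def by auto
  define a where "a = weak_partial_x (\<lambda>z. fst (S z))"
  define b where "b = weak_partial_y (\<lambda>z. snd (S z))"
  have a: "has_weak_partial_x (\<lambda>z. fst (S z)) a" and b: "has_weak_partial_y (\<lambda>z. snd (S z)) b"
    using x(2)[OF W(1)] y(3)[OF W(2)] by (simp_all add: a_def b_def)
  have ia: "integrable lebesgue a" and ib: "integrable lebesgue b"
    using a b unfolding has_weak_partial_x_def has_weak_partial_y_def by auto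
  have div: "weak_div S = (\<lambda>z. a z + b z)" by (simp add: weak_div_def a_def b_def fun_eq_iff)
  have int: "integrable lebesgue (\<lambda>z. f z * \<phi> z)"
    if f: "integrable lebesgue f" and \<phi>: "test_function \<phi>" for f \<phi> :: "real \<times> real \<Rightarrow> real"
  proof -
    obtain K where K: "\<And>z. \<bar>\<phi> z\<bar> \<le> K" using test_function_bounded[OF \<phi>] by blast
    have "\<phi> \<in> borel_measurable lebesgue"
      using \<phi> smooth_borel_measurable lebesgue_borel_measurable unfolding test_function_iff by blast
    from integrable_mult_bounded[OF f this K] show ?thesis by (simp add: mult.commute)
  qed
  show ?thesis
    unfolding has_div_pairing_def
  proof (intro conjI allI impI)
    show "integrable lebesgue (\<lambda>z. fst (S z))" "integrable lebesgue (\<lambda>z. snd (S z))" by (rule x(1) y(1), rule W)+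
    show "integrable lebesgue (weak_div S)" unfolding div using ia ib by simp
    fix \<phi> :: "real \<times> real \<Rightarrow> real" assume \<phi>: "test_function \<phi>"
    note t = test_function_partials[OF \<phi>]
    have "(LINT z|lebesgue. fst (S z) * partial_x \<phi> z + snd (S z) * partial_y \<phi> z)
        = (LINT z|lebesgue. fst (S z) * partial_x \<phi> z) + (LINT z|lebesgue. snd (S z) * partial_y \<phi> z)"
      by (intro Bochner_Integration.integral_add int x(1) y(1) W t)
    also have "\<dots> = - ((LINT z|lebesgue. a z * \<phi> z) + (LINT z|lebesgue. b z * \<phi> z))"
      using a b \<phi> unfolding has_weak_partial_x_def has_weak_partial_y_def by simp
    also have "(LINT z|lebesgue. a z * \<phi> z) + (LINT z|lebesgue. b z * \<phi> z) = (LINT z|lebesgue. a z * \<phi> z + b z * \<phi> z)"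
      by (intro Bochner_Integration.integral_add[symmetric] int ia ib \<phi>)
    finally show "(LINT z|lebesgue. fst (S z) * partial_x \<phi> z + snd (S z) * partial_y \<phi> z)
        = - (LINT z|lebesgue. weak_div S z * \<phi> z)"
      by (simp add: div distrib_right)
  qed (auto intro: lebesgue_borel_measurable)
qed

lemma W11_field_estimate:
  fixes S T :: "real \<times> real \<Rightarrow> real \<times> real"
  assumes S: "W11_field S" and T: "W11_field T"
    and chi: "chi \<in> borel_measurable borel" "\<And>z. 0 \<le> chi z" "\<And>z. chi z \<le> 1" "bounded {z. chi z \<noteq> 0}"
  shows "(LINT z|lebesgue. chi z * min (xP (S z)) (yP (T z)))
    \<le> 48 * sqrt (LINT z|lborel. (chi z)\<^sup>2) * sqrt (LINT z|lebesgue. norm (S z) + \<bar>weak_div S z\<bar>)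
        * sqrt (LINT z|lebesgue. norm (T z) + \<bar>weak_div T z\<bar>)
      + ((LINT z|lebesgue. xN (S z)) + (LINT z|lebesgue. yN (T z)))"
proof -
  note pS = has_div_pairing_W11[OF S] and pT = has_div_pairing_W11[OF T]
  note iS = has_div_pairing_integrable[OF pS] and iT = has_div_pairing_integrable[OF pT]
  define p where "p z = min (xP (S z)) (yP (T z))" for z
  have ip: "integrable lebesgue p" unfolding p_def using iS(1) iT(3) by (rule integrable_min)
  have p0: "0 \<le> p z" "p z \<le> xP (S z)" "p z \<le> yP (T z)" for z
    by (simp_all add: p_def cone_part_bounds)
  define N where "N = density lebesgue (\<lambda>z. ennreal (p z))"
  have idm: "(\<lambda>z. z) \<in> N \<rightarrow>\<^sub>M (borel :: (real \<times> real) measure)"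
    unfolding N_def by (simp add: measurable_completion)
  \<comment> \<open>The density \<open>p\<close> is only Lebesgue measurable, so \<open>N\<close>
    lives on the completed sigma-algebra. Pushing forward along the identity restricts it to Borel
    sets, where the abstract estimate applies.\<close>
  define m where "m = distr N borel (\<lambda>z. z)"
  interpret N: finite_measure N unfolding N_def by (rule finite_measure_density_integrable[OF ip p0(1)])
  have m: "sets m = sets borel" "finite_measure m"
    unfolding m_def using N.finite_measure_distr[OF idm] by auto
  have int_m: "(LINT z|m. f z) = (LINT z|lebesgue. f z * p z)" if f: "f \<in> borel_measurable borel" for f :: "real \<times> real \<Rightarrow> real"
  proof -
    have "(LINT z|m. f z) = (LINT z|N. f z)" unfolding m_def by (rule integral_distr[OF idm f])
    also have "\<dots> = (LINT z|lebesgue. p z * f z)"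
      unfolding N_def using lebesgue_borel_measurable[OF f] ip p0(1) by (subst integral_density) auto
    finally show ?thesis by (simp add: mult.commute)
  qed
  have le: "(LINT z|m. f z) \<le> (LINT z|lebesgue. f z * q z)"
    if f: "f \<in> borel_measurable borel" "\<And>z. 0 \<le> f z" "\<And>z. f z \<le> 1"
      and q: "integrable lebesgue q" "\<And>z. p z \<le> q z" for f q :: "real \<times> real \<Rightarrow> real"
  proof -
    have fb: "\<bar>f z\<bar> \<le> 1" for z using f(2,3)[of z] by simp
    show ?thesis
      unfolding int_m[OF f(1)]
      by (intro integral_mono integrable_mult_bounded[OF ip lebesgue_borel_measurable[OF f(1)] fb]
          integrable_mult_bounded[OF q(1) lebesgue_borel_measurable[OF f(1)] fb] mult_left_mono q(2) f(2))
  qed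
  have field: "(LINT z|lebesgue. \<bar>weak_div R z\<bar>) \<le> (LINT z|lebesgue. norm (R z) + \<bar>weak_div R z\<bar>)"
    if pR: "has_div_pairing lebesgue R lebesgue (weak_div R)" for R
  proof (rule integral_mono)
    have id: "integrable lebesgue (weak_div R)" and ix: "integrable lebesgue (\<lambda>z. fst (R z))"
      and iy: "integrable lebesgue (\<lambda>z. snd (R z))"
      using pR unfolding has_div_pairing_def by blast+
    \<comment> \<open>The norm is written through the two components, because integrability is known
      for these; the sum of their absolute values is a majorant.\<close>
    have "integrable lebesgue (\<lambda>z. sqrt ((fst (R z))\<^sup>2 + (snd (R z))\<^sup>2))"
    proof (rule Bochner_Integration.integrable_bound)
      show "integrable lebesgue (\<lambda>z. \<bar>fst (R z)\<bar> + \<bar>snd (R z)\<bar>)" using ix iy by simp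
      have [measurable]: "(\<lambda>z. fst (R z)) \<in> borel_measurable lebesgue"
        "(\<lambda>z. snd (R z)) \<in> borel_measurable lebesgue"
        using ix iy by blast+
      show "(\<lambda>z. sqrt ((fst (R z))\<^sup>2 + (snd (R z))\<^sup>2)) \<in> borel_measurable lebesgue" by measurable
      show "AE z in lebesgue. norm (sqrt ((fst (R z))\<^sup>2 + (snd (R z))\<^sup>2)) \<le> norm (\<bar>fst (R z)\<bar> + \<bar>snd (R z)\<bar>)"
        by (intro AE_I2) (simp add: sqrt_sum_squares_le_sum_abs)
    qed
    then show "integrable lebesgue (\<lambda>z. norm (R z) + \<bar>weak_div R z\<bar>)"
      using id by (simp add: norm_prod_def)
    show "integrable lebesgue (\<lambda>z. \<bar>weak_div R z\<bar>)" using id by simp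
  qed simp
  have "(LINT z|m. chi z)
    \<le> 48 * sqrt (LINT z|lborel. (chi z)\<^sup>2) * sqrt (LINT z|lebesgue. norm (S z) + \<bar>weak_div S z\<bar>)
        * sqrt (LINT z|lebesgue. norm (T z) + \<bar>weak_div T z\<bar>)
      + ((LINT z|lebesgue. xN (S z)) + (LINT z|lebesgue. yN (T z)))"
    by (rule transversal_flux_estimate[OF pS pT m _ _ chi field[OF pS] field[OF pT]])
       (rule le[OF _ _ _ iS(1) p0(2)] le[OF _ _ _ iT(3) p0(3)]; assumption)+
  then show ?thesis unfolding int_m[OF chi(1)] p_def .
qed

lemma L2norm_borel: "chi \<in> borel_measurable borel \<Longrightarrow> L2norm chi = sqrt (LINT z|lborel. (chi z)\<^sup>2)"
  unfolding L2norm_def by (subst integral_completion) auto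

theorem theorem1p7:
  shows "\<exists>C::real. C > 0 \<and>
    (\<forall>(S :: real \<times> real \<Rightarrow> real \<times> real) (T :: real \<times> real \<Rightarrow> real \<times> real) (chi :: real \<times> real \<Rightarrow> real).
       W11_field S \<and> W11_field T \<and>
       chi \<in> borel_measurable borel \<and> (\<forall>z. 0 \<le> chi z \<and> chi z \<le> 1) \<and> bounded {z. chi z \<noteq> 0} \<longrightarrow>
       (LINT z|lebesgue. chi z * min (xP (S z)) (yP (T z)))
         \<le> C * L2norm chi
             * sqrt (LINT z|lebesgue. norm (S z) + \<bar>weak_div S z\<bar>)
             * sqrt (LINT z|lebesgue. norm (T z) + \<bar>weak_div T z\<bar>)
           + C * (LINT z|lebesgue. \<bar>weak_div S z\<bar> + \<bar>weak_div T z\<bar>)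
           + (LINT z|lebesgue. xN (S z) + yN (T z))) \<and>
    (\<forall>(Sx :: (real \<times> real) set \<Rightarrow> real) (Sy :: (real \<times> real) set \<Rightarrow> real)
      (Tx :: (real \<times> real) set \<Rightarrow> real) (Ty :: (real \<times> real) set \<Rightarrow> real)
      (divS :: (real \<times> real) set \<Rightarrow> real) (divT :: (real \<times> real) set \<Rightarrow> real)
      (chi :: real \<times> real \<Rightarrow> real).
       let S = (\<lambda>A. (Sx A, Sy A)); T = (\<lambda>A. (Tx A, Ty A)) in
       finite_vector_measure Sx \<and> finite_vector_measure Sy \<and>
       finite_vector_measure Tx \<and> finite_vector_measure Ty \<and>
       finite_vector_measure divS \<and> finite_vector_measure divT \<and>
       has_measure_div S divS \<and> has_measure_div T divT \<and>
       chi \<in> borel_measurable borel \<and> (\<forall>z. 0 \<le> chi z \<and> chi z \<le> 1) \<and> bounded {z. chi z \<noteq> 0} \<longrightarrow>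
       vint (min_measure (polar_image xP S) (polar_image yP T)) chi
         \<le> C * L2norm chi
             * sqrt (total_variation S + total_variation divS)
             * sqrt (total_variation T + total_variation divT)
           + C * (total_variation divS + total_variation divT)
           + (polar_image xN S UNIV + polar_image yN T UNIV))"
proof (intro exI[of _ "48 :: real"] conjI allI impI)
  fix S T :: "real \<times> real \<Rightarrow> real \<times> real" and chi :: "real \<times> real \<Rightarrow> real"
  assume asm: "W11_field S \<and> W11_field T \<and>
    chi \<in> borel_measurable borel \<and> (\<forall>z. 0 \<le> chi z \<and> chi z \<le> 1) \<and> bounded {z. chi z \<noteq> 0}"
  then have S: "W11_field S" and T: "W11_field T"
    and chi: "chi \<in> borel_measurable borel" "\<And>z. 0 \<le> chi z" "\<And>z. chi z \<le> 1" "bounded {z. chi z \<noteq> 0}"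
    by blast+
  have "(LINT z|lebesgue. xN (S z) + yN (T z)) = (LINT z|lebesgue. xN (S z)) + (LINT z|lebesgue. yN (T z))"
    by (intro Bochner_Integration.integral_add
        has_div_pairing_integrable(2)[OF has_div_pairing_W11[OF S]]
        has_div_pairing_integrable(4)[OF has_div_pairing_W11[OF T]])
  \<comment> \<open>Nonnegativity allows 48 times this integral to be added to the right side of the
    estimate.\<close>
  moreover have "0 \<le> (LINT z|lebesgue. \<bar>weak_div S z\<bar> + \<bar>weak_div T z\<bar>)"
    by (intro Bochner_Integration.integral_nonneg) simp
  ultimately show "(LINT z|lebesgue. chi z * min (xP (S z)) (yP (T z)))
      \<le> 48 * L2norm chi * sqrt (LINT z|lebesgue. norm (S z) + \<bar>weak_div S z\<bar>)
          * sqrt (LINT z|lebesgue. norm (T z) + \<bar>weak_div T z\<bar>)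
        + 48 * (LINT z|lebesgue. \<bar>weak_div S z\<bar> + \<bar>weak_div T z\<bar>)
        + (LINT z|lebesgue. xN (S z) + yN (T z))"
    using W11_field_estimate[OF S T chi] unfolding L2norm_borel[OF chi(1)] by linarith
next
  fix Sx Sy Tx Ty divS divT :: "(real \<times> real) set \<Rightarrow> real" and chi :: "real \<times> real \<Rightarrow> real"
  define S where "S A = (Sx A, Sy A)" for A
  define T where "T A = (Tx A, Ty A)" for A
  show "let S = (\<lambda>A. (Sx A, Sy A)); T = (\<lambda>A. (Tx A, Ty A)) in
       finite_vector_measure Sx \<and> finite_vector_measure Sy \<and>
       finite_vector_measure Tx \<and> finite_vector_measure Ty \<and>
       finite_vector_measure divS \<and> finite_vector_measure divT \<and>
       has_measure_div S divS \<and> has_measure_div T divT \<and>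
       chi \<in> borel_measurable borel \<and> (\<forall>z. 0 \<le> chi z \<and> chi z \<le> 1) \<and> bounded {z. chi z \<noteq> 0} \<longrightarrow>
       vint (min_measure (polar_image xP S) (polar_image yP T)) chi
         \<le> 48 * L2norm chi
             * sqrt (total_variation S + total_variation divS)
             * sqrt (total_variation T + total_variation divT)
           + 48 * (total_variation divS + total_variation divT)
           + (polar_image xN S UNIV + polar_image yN T UNIV)"
    unfolding Let_def S_def[abs_def, symmetric] T_def[abs_def, symmetric]
  proof (intro impI, elim conjE)
    assume fin: "finite_vector_measure Sx" "finite_vector_measure Sy"
      "finite_vector_measure Tx" "finite_vector_measure Ty"
      and D: "finite_vector_measure divS" "finite_vector_measure divT"
      and div: "has_measure_div S divS" "has_measure_div T divT"
      and chi: "chi \<in> borel_measurable borel" "\<forall>z. 0 \<le> chi z \<and> chi z \<le> 1" "bounded {z. chi z \<noteq> 0}"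
    have ST: "finite_vector_measure S" "finite_vector_measure T"
      unfolding S_def T_def using fin by (simp_all add: finite_vector_measure_Pair)
    have "0 \<le> 48 * (total_variation divS + total_variation divT)"
      by (simp add: total_variation_def)
    moreover have "0 \<le> chi z" "chi z \<le> 1" for z using chi(2) by blast+
    note measure_field_estimate[OF ST D div chi(1) this chi(3)]
    ultimately show "vint (min_measure (polar_image xP S) (polar_image yP T)) chi
         \<le> 48 * L2norm chi
             * sqrt (total_variation S + total_variation divS)
             * sqrt (total_variation T + total_variation divT)
           + 48 * (total_variation divS + total_variation divT)
           + (polar_image xN S UNIV + polar_image yN T UNIV)"
      unfolding L2norm_borel[OF chi(1)] by linarith
  qed
qed simp

end
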